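(* Let $d\ge1$ and let $v\in\mathbb C^d$ be a fixed unit vector. The holomorphic kernel $$(\xi,\eta)\mapsto \frac12 \exp\left(\xi\cdot\eta\right)\mathrm{erfc}\left(\frac{\xi\cdot v+v\cdot \eta}{\sqrt {2}}\right)$$ is the reproducing kernel of the subspace $\mathcal H\subset \mathcal F(\mathbb C^d)$ consisting of those $f\in\mathcal F(\mathbb C^d)$ satisfying $|f(\xi) e^{\frac12\xi^2}|=\mathcal O(1)$ uniformly for $\xi\in\mathbb C^d$ with $\mathrm{Re}\,\xi \in v \mathbb R_+$. Furthermore, $\mathcal H$ is the isometric image of $L^2(\{x\in\mathbb R^d : x\cdot v\leq 0\})$ under the multidimensional Bargmann transform $\mathcal B$.
   Context: $\xi\cdot\eta=\sum_k\xi_k\overline{\eta_k}$, $\xi^2=\xi_1^2+\dots+\xi_d^2$; $\mathrm{erfc}\,z=\frac2{\sqrt\pi}\int_z^\infty e^{-t^2}dt$. $dA(x+iy)=\pi^{-1}dx\,dy$ and $d\omega=dA(z_1)\cdots dA(z_d)$. The Bargmann–Fock space $\mathcal F(\mathbb C^d)$ is the space of entire functions $f$ on $\mathbb C^d$ with $\|f\|_{\mathcal F}^2=\int_{\mathbb C^d}|f(z)|^2e^{-|z|^2}d\omega(z)<\infty$. The Bargmann transform is $\mathcal B[f](\xi)=(2\pi)^{-d/4}\int_{\mathbb R^d}f(x)e^{\xi\cdot x-\frac12\xi^2-\frac14|x|^2}dx_1\cdots dx_d$, a unitary operator from $L^2(\mathbb R^d)$ onto $\mathcal F(\mathbb C^d)$;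 functions on a subset of $\mathbb R^d$ are extended by zero.
   Formalization: The unit vector v is taken in ℝ^d instead of ℂ^d: for non-real v (e.g. d=1, v=i) the condition Re ξ ∈ vℝ_+ forces Re ξ=0, so H is all of the Fock space, while {x : x·v ≤ 0} is a null set, and the claim is false. *)

theory Defs
  imports "HOL-Analysis.Analysis"
begin

text \<open>Complementary error function on the complex plane:
  erfc z = 2/sqrt pi * integral from z to infinity of exp(-t^2), the path being the
  horizontal ray t = z + s, s in [0, infinity) (this is the entire function erfc).\<close>
definition cerfc :: "complex \<Rightarrow> complex" where
  "cerfc z = of_real (2 / sqrt pi) * integral {0..} (\<lambda>s::real. exp (- ((z + of_real s)\<^sup>2)))"

definition cdot :: "complex^'n \<Rightarrow> complex^'n \<Rightarrow> complex" where
  "cdot \<xi> \<eta> = (\<Sum>k\<in>UNIV. \<xi>$k * cnj (\<eta>$k))"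

definition csq :: "complex^'n \<Rightarrow> complex" where
  "csq \<xi> = (\<Sum>k\<in>UNIV. (\<xi>$k)\<^sup>2)"

definition cvec :: "real^'n \<Rightarrow> complex^'n" where
  "cvec x = (\<chi> k. complex_of_real (x$k))"

definition cre :: "complex^'n \<Rightarrow> real^'n" where
  "cre \<xi> = (\<chi> k. Re (\<xi>$k))"

definition entire_md :: "(complex^'n \<Rightarrow> complex) \<Rightarrow> bool" where
  "entire_md f \<longleftrightarrow> (\<forall>z. \<exists>L. (f has_derivative L) (at z) \<and>
      (\<forall>c w. L (c *s w) = c * L w))"

text \<open>Bargmann-Fock space F(C^d), with d omega = pi^(-d) times Lebesgue measure on C^d = R^(2d).\<close>
definition fock_space :: "(complex^'n \<Rightarrow> complex) set" where
  "fock_space = {f. entire_md f \<and>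
     (\<integral>\<^sup>+ z. ennreal ((cmod (f z))\<^sup>2 * exp (- (norm z)\<^sup>2)) \<partial>lborel) < \<infinity>}"

definition fock_inner :: "(complex^'n \<Rightarrow> complex) \<Rightarrow> (complex^'n \<Rightarrow> complex) \<Rightarrow> complex" where
  "fock_inner f g = of_real (1 / pi ^ CARD('n)) *
     (\<integral> z. f z * cnj (g z) * of_real (exp (- (norm z)\<^sup>2)) \<partial>lborel)"

definition fock_norm2 :: "(complex^'n \<Rightarrow> complex) \<Rightarrow> real" where
  "fock_norm2 f = (1 / pi ^ CARD('n)) *
     (\<integral> z. (cmod (f z))\<^sup>2 * exp (- (norm z)\<^sup>2) \<partial>lborel)"

definition L2 :: "(real^'n \<Rightarrow> complex) \<Rightarrow> bool" where
  "L2 f \<longleftrightarrow> f \<in> borel_measurable lborel \<and> integrable lborel (\<lambda>x. (cmod (f x))\<^sup>2)"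

definition bargmann :: "(real^'n \<Rightarrow> complex) \<Rightarrow> complex^'n \<Rightarrow> complex" where
  "bargmann f \<xi> = of_real ((2 * pi) powr (- real CARD('n) / 4)) *
     (\<integral> x. f x * exp (cdot \<xi> (cvec x) - csq \<xi> / 2 - of_real ((norm x)\<^sup>2 / 4)) \<partial>lborel)"

definition half_kernel :: "real^'n \<Rightarrow> complex^'n \<Rightarrow> complex^'n \<Rightarrow> complex" where
  "half_kernel v \<xi> \<eta> = 1/2 * exp (cdot \<xi> \<eta>) *
     cerfc ((cdot \<xi> (cvec v) + cdot (cvec v) \<eta>) / of_real (sqrt 2))"

definition H_space :: "real^'n \<Rightarrow> (complex^'n \<Rightarrow> complex) set" where
  "H_space v = {f \<in> fock_space. \<exists>C. \<forall>\<xi> t. t \<ge> 0 \<and> cre \<xi> = t *\<^sub>R v \<longrightarrow>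
      cmod (f \<xi> * exp (csq \<xi> / 2)) \<le> C}"

end

theory Submission
  imports Defs "HOL-Probability.Probability" "HOL-Complex_Analysis.Complex_Analysis"
begin

text \<open>For fixed real part the Bargmann transform is a windowed Fourier transform, so Plancherel
  makes it an isometry from \<open>L\<^sup>2\<close> into the Fock space. It is onto: by the reproducing formula the
  adjoint, applied to truncations of \<open>f\<close> to bounded sets, gives a Cauchy sequence whose limit is
  mapped to \<open>f\<close>. If \<open>f = B g\<close>, then \<open>f exp (\<xi>\<^sup>2/2)\<close> is the two-sided Laplace transform of
  \<open>h = g exp (- |x|\<^sup>2/4)\<close>; boundedness over the ray \<open>v \<real>\<^sub>+\<close> forces the Gaussian averages of \<open>h\<close> at scale
  \<open>1/r\<close> around a point \<open>a\<close> with \<open>a \<bullet> v > 0\<close> to be of order \<open>exp (- r\<^sup>2 (a \<bullet> v)\<^sup>2/2)\<close>, hence \<open>h\<close>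
  vanishes there. The kernel of the half-space subspace is a Gaussian integral over \<open>x \<bullet> v \<le> 0\<close>.\<close>

section \<open>Gaussian integrals\<close>

text \<open>The half-space kernel reproduces by duality. If \<open>f = bargmann g\<close> with
  \<open>g\<close> carried by x . v \<le> 0, then f(\<eta>) pairs \<open>g\<close> with the Bargmann
  kernel at \<eta>, and cutting that kernel off outside the half-space does not change the pairing;
  by the isometry it equals the Fock inner product of \<open>f\<close> with the transform of the
  cut-off conjugate kernel. The rest is to identify the image. Two obstacles shape this. The
  integral defining the adjoint need not converge absolutely for a general Fock function, so it is
  applied to pieces on bounded shells, and the radii are chosen to make the sum of the results
  converge almost everywhere. And bounds on a Laplace transform say nothing about single values of
  \<open>h\<close>, which is merely measurable, so Gaussian averages are estimated instead: on a . v
  > \<delta> a factor r^d from rescaling competes with exp (- r^2 \<delta>^2/2) and loses as r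
  grows. Testing against continuous functions then gives h = 0 almost everywhere.\<close>

lemma lborel_affine_has_bochner_integral:
  fixes f :: "'a::euclidean_space \<Rightarrow> 'b::{banach, second_countable_topology}" and c :: real
  assumes "c \<noteq> 0" and "integrable lborel f"
  shows "has_bochner_integral lborel (\<lambda>x. f (t + c *\<^sub>R x)) (integral\<^sup>L lborel f /\<^sub>R \<bar>c\<bar>^DIM('a))"
proof -
  have [measurable]: "f \<in> borel_measurable borel" using assms(2) by auto
  have m: "integrable (density (distr lborel borel (\<lambda>x. t + c *\<^sub>R x)) (\<lambda>_. ennreal (\<bar>c\<bar>^DIM('a)))) f"
    using assms(2) lborel_affine[OF assms(1), of t] by simp
  have "integrable lborel (\<lambda>x. \<bar>c\<bar>^DIM('a) *\<^sub>R f (t + c *\<^sub>R x))"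
    using m by (subst (asm) integrable_density) (auto simp: integrable_distr_eq)
  then have "integrable lborel (\<lambda>x. (1 / \<bar>c\<bar>^DIM('a)) *\<^sub>R \<bar>c\<bar>^DIM('a) *\<^sub>R f (t + c *\<^sub>R x))"
    by (rule integrable_scaleR_right)
  then have i: "integrable lborel (\<lambda>x. f (t + c *\<^sub>R x))"
    using assms(1) by simp
  have "integral\<^sup>L lborel f = integral\<^sup>L (density (distr lborel borel (\<lambda>x. t + c *\<^sub>R x)) (\<lambda>_. ennreal (\<bar>c\<bar>^DIM('a)))) f"
    using lborel_affine[OF assms(1), of t] by simp
  also have "\<dots> = \<bar>c\<bar>^DIM('a) *\<^sub>R (\<integral>x. f (t + c *\<^sub>R x) \<partial>lborel)"
    by (subst integral_density) (auto simp: integral_distr)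
  finally show ?thesis
    using i assms(1) by (auto simp: has_bochner_integral_iff)
qed

lemma lborel_integrable_affine:
  fixes f :: "'a::euclidean_space \<Rightarrow> 'b::{banach, second_countable_topology}"
  assumes "c \<noteq> 0" "integrable lborel f"
  shows "integrable lborel (\<lambda>x. f (t + c *\<^sub>R x))"
  using lborel_affine_has_bochner_integral[OF assms] by (auto simp: has_bochner_integral_iff)

lemma lborel_integral_affine:
  fixes f :: "'a::euclidean_space \<Rightarrow> 'b::{banach, second_countable_topology}"
  assumes "c \<noteq> 0" "integrable lborel f"
  shows "(\<integral>x. f (t + c *\<^sub>R x) \<partial>lborel) = integral\<^sup>L lborel f /\<^sub>R \<bar>c\<bar>^DIM('a)"
  using lborel_affine_has_bochner_integral[OF assms] by (auto simp: has_bochner_integral_iff)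

lemma lborel_nn_integral_affine:
  fixes f :: "'a::euclidean_space \<Rightarrow> ennreal"
  assumes "c \<noteq> 0" and [measurable]: "f \<in> borel_measurable borel"
  shows "(\<integral>\<^sup>+x. f x \<partial>lborel) = ennreal (\<bar>c\<bar>^DIM('a)) * (\<integral>\<^sup>+x. f (t + c *\<^sub>R x) \<partial>lborel)"
proof -
  have "(\<integral>\<^sup>+x. f x \<partial>lborel) = (\<integral>\<^sup>+x. f x \<partial>density (distr lborel borel (\<lambda>x. t + c *\<^sub>R x)) (\<lambda>_. ennreal (\<bar>c\<bar>^DIM('a))))"
    using lborel_affine[OF assms(1), of t] by simp
  also have "\<dots> = ennreal (\<bar>c\<bar>^DIM('a)) * (\<integral>\<^sup>+x. f (t + c *\<^sub>R x) \<partial>lborel)"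
    by (subst nn_integral_density) (auto simp: nn_integral_distr nn_integral_cmult)
  finally show ?thesis .
qed

lemma lborel_nn_integral_shift:
  fixes f :: "'a::euclidean_space \<Rightarrow> ennreal"
  assumes [measurable]: "f \<in> borel_measurable borel"
  shows "(\<integral>\<^sup>+x. f (t + x) \<partial>lborel) = (\<integral>\<^sup>+x. f x \<partial>lborel)"
  using lborel_nn_integral_affine[of 1 f t] by simp

lemma lborel_integrable_shift:
  fixes f :: "'a::euclidean_space \<Rightarrow> 'b::{banach, second_countable_topology}"
  shows "integrable lborel f \<Longrightarrow> integrable lborel (\<lambda>x. f (t + x))"
  using lborel_integrable_affine[of 1 f t] by simp

lemma lborel_integral_shift:
  fixes f :: "'a::euclidean_space \<Rightarrow> 'b::{banach, second_countable_topology}"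
  shows "integrable lborel f \<Longrightarrow> (\<integral>x. f (t + x) \<partial>lborel) = integral\<^sup>L lborel f"
  using lborel_integral_affine[of 1 f t] by simp

text \<open>The characteristic function of the standard normal law covers imaginary
  \<open>z\<close>. The real part p of \<open>z\<close> is produced by a real translation, since -
  (x - p)^2/2 = - x^2/2 + p x - p^2/2; no contour shift is involved.\<close>

lemma gauss_complex_1d:
  fixes z :: complex
  shows "has_bochner_integral lborel (\<lambda>t::real. exp (of_real (- t\<^sup>2/2) + z * of_real t))
           (of_real (sqrt (2*pi)) * exp (z\<^sup>2/2))"
proof -
  define p q where "p = Re z" and "q = Im z"
  have z: "z = of_real p + \<i> * of_real q" by (simp add: p_def q_def complex_eq)
  have int0: "integrable lborel (\<lambda>x::real. std_normal_density x *\<^sub>R iexp (q * x))"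
    by (rule Bochner_Integration.integrable_bound[of lborel std_normal_density]) auto
  have "(\<integral>x. std_normal_density x *\<^sub>R iexp (q * x) \<partial>lborel) = char std_normal_distribution q"
    unfolding char_def by (subst integral_density) auto
  then have val0: "(\<integral>x. std_normal_density x *\<^sub>R iexp (q * x) \<partial>lborel) = of_real (exp (- q\<^sup>2/2))"
    by (simp add: char_std_normal_distribution)
  let ?f = "\<lambda>x::real. (exp (of_real (p\<^sup>2/2) + \<i> * of_real (p*q)) * of_real (sqrt (2*pi)))
      * (std_normal_density x *\<^sub>R iexp (q * x))"
  have "has_bochner_integral lborel ?f
     ((exp (of_real (p\<^sup>2/2) + \<i> * of_real (p*q)) * of_real (sqrt (2*pi))) * of_real (exp (- q\<^sup>2/2)))"
    using int0 val0 by (intro has_bochner_integral_mult_right) (auto simp: has_bochner_integral_iff)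
  then have "has_bochner_integral lborel (\<lambda>x. ?f (- p + 1 * x))
     ((exp (of_real (p\<^sup>2/2) + \<i> * of_real (p*q)) * of_real (sqrt (2*pi))) * of_real (exp (- q\<^sup>2/2)) /\<^sub>R \<bar>1\<bar>)"
    by (subst (asm) lborel_has_bochner_integral_real_affine_iff[where c=1 and t="-p"]) simp_all
  moreover have "?f (- p + 1 * x) = exp (of_real (- x\<^sup>2/2) + z * of_real x)" for x
  proof -
    have "?f (- p + 1 * x) = exp (of_real (p\<^sup>2/2) + \<i> * of_real (p*q))
        * exp (of_real (- (x - p)\<^sup>2/2)) * exp (\<i> * of_real (q * (x - p)))"
      unfolding std_normal_density_def exp_of_real by (simp add: scaleR_conv_of_real)
    also have "\<dots> = exp (of_real (p\<^sup>2/2) + \<i> * of_real (p*q) + of_real (- (x - p)\<^sup>2/2) + \<i> * of_real (q * (x - p)))"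
      by (simp only: exp_add)
    also have "of_real (p\<^sup>2/2) + \<i> * of_real (p*q) + of_real (- (x - p)\<^sup>2/2) + \<i> * of_real (q * (x - p))
        = of_real (- x\<^sup>2/2) + z * of_real x"
      by (rule complex_eqI) (simp_all add: z power2_eq_square field_simps)
    finally show ?thesis .
  qed
  moreover have "(exp (of_real (p\<^sup>2/2) + \<i> * of_real (p*q)) * of_real (sqrt (2*pi))) * of_real (exp (- q\<^sup>2/2)) /\<^sub>R \<bar>1\<bar>
     = of_real (sqrt (2*pi)) * exp (z\<^sup>2/2)"
  proof -
    have "of_real (p\<^sup>2/2) + \<i> * of_real (p*q) + of_real (- q\<^sup>2/2) = z\<^sup>2/2"
      by (rule complex_eqI) (simp_all add: z power2_eq_square field_simps)
    then have "exp (z\<^sup>2/2) = exp (of_real (p\<^sup>2/2) + \<i> * of_real (p*q)) * of_real (exp (- q\<^sup>2/2))"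
      by (metis exp_add exp_of_real)
    then show ?thesis by (simp only: abs_one inverse_1 scaleR_one mult_ac)
  qed
  ultimately show ?thesis by (simp only:)
qed

lemma lborel_has_bochner_integral_prod:
  fixes f :: "'a::euclidean_space \<Rightarrow> real \<Rightarrow> complex"
  assumes "\<And>b. b \<in> Basis \<Longrightarrow> integrable lborel (f b)"
  shows "has_bochner_integral lborel (\<lambda>x::'a. \<Prod>b\<in>Basis. f b (x \<bullet> b)) (\<Prod>b\<in>Basis. integral\<^sup>L lborel (f b))"
proof -
  interpret product_sigma_finite "\<lambda>_::'a. lborel::real measure" ..
  have [measurable]: "b \<in> Basis \<Longrightarrow> f b \<in> borel_measurable borel" for b using assms by auto
  have meas: "(\<lambda>x::'a. \<Prod>b\<in>Basis. f b (x \<bullet> b)) \<in> borel_measurable borel"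
    by measurable
  have eq: "(\<Prod>b\<in>Basis. f b ((\<Sum>b\<in>Basis. x b *\<^sub>R b) \<bullet> b)) = (\<Prod>b\<in>Basis. f b (x b))" for x
    by (intro prod.cong refl) (simp add: inner_sum_left inner_Basis if_distrib cong: if_cong)
  have m2: "(\<lambda>f. \<Sum>b\<in>Basis. f b *\<^sub>R b) \<in> measurable (\<Pi>\<^sub>M b\<in>Basis. lborel) (borel :: 'a measure)"
    by measurable
  have "integrable (\<Pi>\<^sub>M b\<in>Basis. lborel) (\<lambda>x::'a\<Rightarrow>real. \<Prod>b\<in>Basis. f b (x b))"
    by (rule product_integrable_prod) (auto intro: assms)
  moreover have "(\<integral>x. (\<Prod>b\<in>Basis. f b (x b)) \<partial>(\<Pi>\<^sub>M b\<in>(Basis::'a set). lborel)) = (\<Prod>b\<in>Basis. integral\<^sup>L lborel (f b))"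
    by (rule product_integral_prod) (auto intro: assms)
  ultimately show ?thesis
    unfolding has_bochner_integral_iff
    by (subst (1 2) lborel_eq) (simp add: integrable_distr_eq[OF m2 meas] integral_distr[OF m2 meas] eq)
qed

text \<open>The integrand factors over an orthonormal basis into one-dimensional integrals. The
  value contains the squares of the complex numbers \<open>l b\<close>, not of their moduli, so it
  depends holomorphically on the coefficients of \<open>l\<close>.\<close>

lemma gauss_complex:
  fixes l :: "'a::euclidean_space \<Rightarrow> complex"
  assumes "linear l"
  shows "has_bochner_integral lborel (\<lambda>x. exp (of_real (- (norm x)\<^sup>2/2) + l x))
          (of_real (sqrt (2*pi) ^ DIM('a)) * exp ((\<Sum>b\<in>Basis. (l b)\<^sup>2)/2))"
proof -
  have l: "l x = (\<Sum>b\<in>Basis. l b * of_real (x \<bullet> b))" for x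
  proof -
    have "l x = l (\<Sum>b\<in>Basis. (x \<bullet> b) *\<^sub>R b)" by (simp add: euclidean_representation)
    also have "\<dots> = (\<Sum>b\<in>Basis. l b * of_real (x \<bullet> b))"
      by (simp add: linear_sum[OF assms] linear_cmul[OF assms] scaleR_conv_of_real mult.commute)
    finally show ?thesis .
  qed
  have n: "(norm x)\<^sup>2 = (\<Sum>b\<in>Basis. (x \<bullet> b)\<^sup>2)" for x :: 'a
    by (subst power2_norm_eq_inner, subst euclidean_inner) (simp add: power2_eq_square)
  have "has_bochner_integral lborel (\<lambda>x::'a. \<Prod>b\<in>Basis. exp (of_real (- (x\<bullet>b)\<^sup>2/2) + l b * of_real (x\<bullet>b)))
     (\<Prod>b\<in>Basis. integral\<^sup>L lborel (\<lambda>t. exp (of_real (- t\<^sup>2/2) + l b * of_real t)))"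
    using gauss_complex_1d by (intro lborel_has_bochner_integral_prod) (auto simp: has_bochner_integral_iff)
  also have "(\<Prod>b\<in>Basis. integral\<^sup>L lborel (\<lambda>t. exp (of_real (- t\<^sup>2/2) + l b * of_real t)))
     = (\<Prod>b\<in>(Basis::'a set). (of_real (sqrt (2*pi)) * exp ((l b)\<^sup>2/2)))"
    using gauss_complex_1d by (intro prod.cong) (auto simp: has_bochner_integral_iff)
  also have "\<dots> = of_real (sqrt (2*pi) ^ DIM('a)) * exp ((\<Sum>b\<in>Basis. (l b)\<^sup>2)/2)"
    by (simp add: prod.distrib exp_sum[symmetric] sum_divide_distrib)
  also have "(\<lambda>x::'a. \<Prod>b\<in>Basis. exp (of_real (- (x\<bullet>b)\<^sup>2/2) + l b * of_real (x\<bullet>b)))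
     = (\<lambda>x. exp (of_real (- (norm x)\<^sup>2/2) + l x))"
  proof
    fix x
    show "(\<Prod>b\<in>Basis. exp (of_real (- (x\<bullet>b)\<^sup>2/2) + l b * of_real (x\<bullet>b))) = exp (of_real (- (norm x)\<^sup>2/2) + l x)"
      unfolding exp_sum[OF finite_Basis, symmetric] n l[of x]
      by (simp add: sum.distrib sum_divide_distrib sum_negf sum_subtractf)
  qed
  finally show ?thesis .
qed

lemma gauss_real:
  "has_bochner_integral lborel (\<lambda>x::'a::euclidean_space. exp (- (norm x)\<^sup>2/2)) (sqrt (2*pi) ^ DIM('a))"
proof -
  have "has_bochner_integral lborel (\<lambda>x::'a. Re (exp (of_real (- (norm x)\<^sup>2/2) + 0)))
      (Re (of_real (sqrt (2*pi) ^ DIM('a)) * exp ((\<Sum>b\<in>(Basis::'a set). 0\<^sup>2)/2)))"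
    by (rule has_bochner_integral_Re[OF gauss_complex]) (auto intro: linearI)
  moreover have "Re (exp (of_real (- (norm x)\<^sup>2/2) + 0)) = exp (- (norm x)\<^sup>2/2)" for x :: 'a
    unfolding add_0_right exp_of_real by (rule Re_complex_of_real)
  ultimately show ?thesis by simp
qed

text \<open>Joint integrability is reduced to a one-variable check: the norm integral of each
  section lies below an integrable \<open>g\<close>. The third conclusion also supplies
  measurability of inner integrals that are to be compared almost everywhere.\<close>

lemma lborel_Fubini:
  fixes f :: "'a::euclidean_space \<Rightarrow> 'b::euclidean_space \<Rightarrow> 'c::{banach, second_countable_topology}"
  assumes m: "(\<lambda>(x, y). f x y) \<in> borel_measurable (lborel \<Otimes>\<^sub>M lborel)"
    and f: "\<And>x. integrable lborel (f x)"
    and g: "integrable lborel g" "\<And>x. (\<integral>y. norm (f x y) \<partial>lborel) \<le> g x"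
  shows "integrable (lborel \<Otimes>\<^sub>M lborel) (\<lambda>(x, y). f x y)"
    and "integrable lborel (\<lambda>x. \<integral>y. f x y \<partial>lborel)"
    and "integrable lborel (\<lambda>y. \<integral>x. f x y \<partial>lborel)"
    and "(\<integral>x. (\<integral>y. f x y \<partial>lborel) \<partial>lborel) = (\<integral>y. (\<integral>x. f x y \<partial>lborel) \<partial>lborel)"
proof -
  have [measurable]: "(\<lambda>x. \<integral>y. norm (f x y) \<partial>lborel) \<in> borel_measurable lborel"
    using m by (intro lborel.borel_measurable_lebesgue_integral) (auto simp: case_prod_beta)
  have i: "integrable lborel (\<lambda>x. \<integral>y. norm (f x y) \<partial>lborel)"
  proof (rule Bochner_Integration.integrable_bound[OF g(1)])
    have "norm (\<integral>y. norm (f x y) \<partial>lborel) \<le> norm (g x)" for x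
    proof -
      have "(\<integral>y. norm (f x y) \<partial>lborel) \<ge> 0" by simp
      then show ?thesis using g(2)[of x] by (simp del: integral_nonneg_AE)
    qed
    then show "AE x in lborel. norm (\<integral>y. norm (f x y) \<partial>lborel) \<le> norm (g x)" by blast
  qed measurable
  show i2: "integrable (lborel \<Otimes>\<^sub>M lborel) (\<lambda>(x, y). f x y)"
    by (rule lborel_pair.Fubini_integrable[OF m]) (use i f in auto)
  show "integrable lborel (\<lambda>x. \<integral>y. f x y \<partial>lborel)"
    using lborel_pair.integrable_fst'[OF i2] by simp
  show "integrable lborel (\<lambda>y. \<integral>x. f x y \<partial>lborel)"
    using lborel_pair.integrable_snd[OF i2] by simp
  show "(\<integral>x. (\<integral>y. f x y \<partial>lborel) \<partial>lborel) = (\<integral>y. (\<integral>x. f x y \<partial>lborel) \<partial>lborel)"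
    using lborel_pair.Fubini_integral[OF i2] by simp
qed

lemma borel_measurable_linear [measurable_dest]:
  fixes l :: "'a::euclidean_space \<Rightarrow> 'b::real_normed_vector"
  shows "linear l \<Longrightarrow> l \<in> borel_measurable borel"
  by (intro borel_measurable_continuous_onI linear_continuous_on) (simp add: linear_conv_bounded_linear)

lemma borel_measurable_cnj [measurable]: "cnj \<in> borel_measurable borel"
  by (intro borel_measurable_continuous_onI continuous_intros)

text \<open>Inserting a weight that integrates to one over each line in direction \<open>v\<close> and
  translating along \<open>v\<close> separates the direction \<open>v\<close> without any rotation of coordinates.\<close>

lemma gauss_slice:
  fixes l :: "'a::euclidean_space \<Rightarrow> complex" and v :: 'a and \<psi> :: "real \<Rightarrow> complex"
  assumes l: "linear l" and v: "norm v = 1"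
    and m[measurable]: "\<psi> \<in> borel_measurable borel" and b: "\<And>u. cmod (\<psi> u) \<le> 1"
  shows "(\<integral>x. exp (of_real (- (norm x)\<^sup>2/2) + l x) * \<psi> (x \<bullet> v) \<partial>lborel)
     = of_real (sqrt (2*pi) ^ DIM('a)) * exp ((\<Sum>b\<in>Basis. (l b)\<^sup>2)/2)
        * (exp (- (l v)\<^sup>2/2) / of_real (sqrt (2*pi)))
        * (\<integral>u. exp (of_real (- u\<^sup>2/2) + l v * of_real u) * \<psi> u \<partial>lborel)"
proof -
  define \<phi> where "\<phi> x = exp (of_real (- (norm x)\<^sup>2/2) + l x)" for x
  define e where "e u = exp (of_real (- u\<^sup>2/2) + l v * of_real u)" for u :: real
  define w :: "real \<Rightarrow> complex" where "w p = of_real (std_normal_density p)" for p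
  have [measurable]: "l \<in> borel_measurable borel" using l by measurable
  have [measurable]: "\<phi> \<in> borel_measurable borel" unfolding \<phi>_def by measurable
  have [measurable]: "e \<in> borel_measurable borel" unfolding e_def by measurable
  have [measurable]: "w \<in> borel_measurable borel" unfolding w_def by measurable
  have vv: "v \<bullet> v = 1" using v by (simp add: norm_eq_sqrt_inner)
  have i\<phi>: "integrable lborel \<phi>"
    using gauss_complex[OF l] by (auto simp: has_bochner_integral_iff \<phi>_def[abs_def])
  have ie: "integrable lborel e"
    using gauss_complex_1d[of "l v"] by (auto simp: has_bochner_integral_iff e_def[abs_def])
  have iw: "integrable lborel w" "integral\<^sup>L lborel w = 1"
    unfolding w_def by auto
  have ie\<psi>: "integrable lborel (\<lambda>u. e u * \<psi> u)"
    by (rule Bochner_Integration.integrable_bound[OF ie]) (auto simp: norm_mult b mult_left_le)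
  have i\<phi>\<psi>: "integrable lborel (\<lambda>x. \<phi> x * \<psi> (x \<bullet> v))"
    by (rule Bochner_Integration.integrable_bound[OF i\<phi>]) (auto simp: norm_mult b mult_left_le)
  have wflip: "integrable lborel (\<lambda>s. w (p - s))" "(\<integral>s. w (p - s) \<partial>lborel) = 1" for p
    using lborel_integrable_affine[of "-1" w p] lborel_integral_affine[of "-1" w p] iw by simp_all
  \<comment> \<open>With p = x . v one has p^2 + |x + s v|^2 = |x|^2 + (p + s)^2. So the product
    splits into a function of \<open>x\<close> and a function of p + s, whose integral over
    \<open>s\<close> does not depend on \<open>x\<close>.\<close>
  have key: "w (x \<bullet> v) * \<phi> (x + s *\<^sub>R v)
      = (\<phi> x * exp (- l v * of_real (x \<bullet> v)) / of_real (sqrt (2*pi))) * e (x \<bullet> v + s)" for x s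
  proof -
    have "w (x \<bullet> v) * \<phi> (x + s *\<^sub>R v) = exp (of_real (- (x \<bullet> v)\<^sup>2/2)) * exp (of_real (- (norm (x + s *\<^sub>R v))\<^sup>2/2) + l (x + s *\<^sub>R v)) / of_real (sqrt (2*pi))"
      unfolding w_def \<phi>_def std_normal_density_def exp_of_real by simp
    also have "exp (of_real (- (x \<bullet> v)\<^sup>2/2)) * exp (of_real (- (norm (x + s *\<^sub>R v))\<^sup>2/2) + l (x + s *\<^sub>R v))
      = exp (of_real (- (x \<bullet> v)\<^sup>2/2) + (of_real (- (norm (x + s *\<^sub>R v))\<^sup>2/2) + l (x + s *\<^sub>R v)))"
      by (simp only: exp_add)
    also have "of_real (- (x \<bullet> v)\<^sup>2/2) + (of_real (- (norm (x + s *\<^sub>R v))\<^sup>2/2) + l (x + s *\<^sub>R v))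
      = (of_real (- (norm x)\<^sup>2/2) + l x) + (- l v * of_real (x \<bullet> v)) + (of_real (- (x \<bullet> v + s)\<^sup>2/2) + l v * of_real (x \<bullet> v + s))"
    proof -
      have "- (x \<bullet> v)\<^sup>2/2 + - (norm (x + s *\<^sub>R v))\<^sup>2/2 = - (norm x)\<^sup>2/2 + - (x \<bullet> v + s)\<^sup>2/2"
        by (simp add: power2_norm_eq_inner inner_add_left inner_add_right vv inner_commute[of v x])
           (simp add: power2_eq_square field_simps)
      then have "complex_of_real (- (x \<bullet> v)\<^sup>2/2) + of_real (- (norm (x + s *\<^sub>R v))\<^sup>2/2)
         = of_real (- (norm x)\<^sup>2/2) + of_real (- (x \<bullet> v + s)\<^sup>2/2)"
        by (simp only: of_real_add[symmetric])
      moreover have "l (x + s *\<^sub>R v) = l x + (- l v * of_real (x \<bullet> v)) + l v * of_real (x \<bullet> v + s)"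
        by (simp add: linear_add[OF l] linear_cmul[OF l] scaleR_conv_of_real algebra_simps)
      ultimately show ?thesis by (simp only: add_ac)
    qed
    also have "exp \<dots> = exp (of_real (- (norm x)\<^sup>2/2) + l x) * exp (- l v * of_real (x \<bullet> v)) * e (x \<bullet> v + s)"
      unfolding e_def by (simp only: exp_add)
    finally show ?thesis unfolding \<phi>_def by simp
  qed
  define c where "c x = \<phi> x * exp (- l v * of_real (x \<bullet> v)) / of_real (sqrt (2*pi))" for x
  have c: "has_bochner_integral lborel c
     (of_real (sqrt (2*pi) ^ DIM('a)) * exp ((\<Sum>b\<in>Basis. (l b)\<^sup>2)/2) * exp (- (l v)\<^sup>2/2) / of_real (sqrt (2*pi)))"
  proof -
    \<comment> \<open>\<open>l'\<close> is \<open>l\<close> with its component along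
      \<open>v\<close> removed: l' v = 0, and the sum of squares drops by (l v)^2, whence the factor
      exp (- (l v)^2/2).\<close>
    define l' where "l' x = l x - l v * of_real (x \<bullet> v)" for x
    have "linear l'"
      by (rule linearI) (simp_all add: l'_def linear_add[OF l] linear_cmul[OF l] algebra_simps scaleR_conv_of_real)
    from has_bochner_integral_divide_zero[OF gauss_complex[OF this], of "of_real (sqrt (2*pi))"]
    have 1: "has_bochner_integral lborel (\<lambda>x. exp (of_real (- (norm x)\<^sup>2/2) + l' x) / of_real (sqrt (2*pi)))
      (of_real (sqrt (2*pi) ^ DIM('a)) * exp ((\<Sum>b\<in>Basis. (l' b)\<^sup>2)/2) / of_real (sqrt (2*pi)))" .
    have lv: "(\<Sum>b\<in>Basis. l b * of_real (b \<bullet> v)) = l v"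
    proof -
      have "l v = l (\<Sum>b\<in>Basis. (v \<bullet> b) *\<^sub>R b)" by (simp add: euclidean_representation)
      also have "\<dots> = (\<Sum>b\<in>Basis. l b * of_real (b \<bullet> v))"
        by (simp add: linear_sum[OF l] linear_cmul[OF l] scaleR_conv_of_real mult.commute inner_commute)
      finally show ?thesis by simp
    qed
    have v2: "(\<Sum>b\<in>Basis. (complex_of_real (b \<bullet> v))\<^sup>2) = 1"
    proof -
      have "(\<Sum>b\<in>Basis. (b \<bullet> v)\<^sup>2) = v \<bullet> v"
        by (subst euclidean_inner) (simp add: power2_eq_square inner_commute)
      then have "of_real (\<Sum>b\<in>Basis. (b \<bullet> v)\<^sup>2) = (1::complex)" using vv by simp
      then show ?thesis by simp
    qed
    have "(\<Sum>b\<in>Basis. (l' b)\<^sup>2) = (\<Sum>b\<in>Basis. (l b)\<^sup>2 - 2 * l v * (l b * of_real (b \<bullet> v)) + (l v)\<^sup>2 * (of_real (b \<bullet> v))\<^sup>2)"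
      unfolding l'_def by (intro sum.cong) (auto simp: power2_eq_square algebra_simps)
    also have "\<dots> = (\<Sum>b\<in>Basis. (l b)\<^sup>2) - 2 * l v * l v + (l v)\<^sup>2"
      by (simp add: sum.distrib sum_subtractf sum_distrib_left[symmetric] lv v2)
    finally have "(\<Sum>b\<in>Basis. (l' b)\<^sup>2)/2 = (\<Sum>b\<in>Basis. (l b)\<^sup>2)/2 + - (l v)\<^sup>2/2"
      by (simp add: power2_eq_square field_simps)
    moreover have "exp (of_real (- (norm x)\<^sup>2/2) + l' x) / of_real (sqrt (2*pi)) = c x" for x
      unfolding l'_def c_def \<phi>_def exp_add[symmetric] by (simp add: algebra_simps)
    ultimately show ?thesis using 1 by (simp only: exp_add mult.assoc)
  qed
  have [measurable]: "c \<in> borel_measurable borel" unfolding c_def by measurable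
  have ies: "integrable lborel (\<lambda>s. e (p + s) * \<psi> (p + s))" "(\<integral>s. e (p + s) * \<psi> (p + s) \<partial>lborel) = (\<integral>u. e u * \<psi> u \<partial>lborel)" for p
    using lborel_integrable_shift[OF ie\<psi>, of p] lborel_integral_shift[OF ie\<psi>, of p] by auto
  \<comment> \<open>\<open>F\<close> carries the weight at x . v - s, whose integral over
    \<open>s\<close> is 1. \<open>G\<close> is \<open>F\<close> with \<open>x\<close> moved by s v,
    which puts the weight at x . v and \<open>s\<close> into the arguments of \<open>\<phi>\<close>
    and \<open>\<psi>\<close>.\<close>
  define F where "F x s = w (x \<bullet> v - s) * (\<phi> x * \<psi> (x \<bullet> v))" for x s
  define G where "G x s = w (x \<bullet> v) * \<phi> (x + s *\<^sub>R v) * \<psi> (x \<bullet> v + s)" for x s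
  have GF: "G x s = F (s *\<^sub>R v + x) s" for x s
    by (simp add: F_def G_def inner_add_left vv add.commute)
  have F1: "(\<lambda>(x, s). F x s) \<in> borel_measurable (lborel \<Otimes>\<^sub>M lborel)"
    unfolding F_def by measurable
  have G1: "(\<lambda>(x, s). G x s) \<in> borel_measurable (lborel \<Otimes>\<^sub>M lborel)"
    unfolding G_def by measurable
  have Fn: "(\<integral>s. norm (F x s) \<partial>lborel) \<le> norm (\<phi> x * \<psi> (x \<bullet> v))" for x
  proof -
    have "norm (F x s) = std_normal_density (x \<bullet> v - s) * norm (\<phi> x * \<psi> (x \<bullet> v))" for s
      by (simp add: F_def norm_mult w_def)
    moreover have "(\<integral>s. std_normal_density (x \<bullet> v - s) \<partial>lborel) = 1"
      using lborel_integral_affine[of "-1" std_normal_density "x \<bullet> v"] by simp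
    ultimately show ?thesis by simp
  qed
  have Fi: "integrable lborel (F x)" for x
    unfolding F_def using wflip(1) by simp
  have Geq: "G x s = c x * (e (x \<bullet> v + s) * \<psi> (x \<bullet> v + s))" for x s
    unfolding G_def key c_def by (simp add: mult.assoc)
  have Gn: "(\<integral>s. norm (G x s) \<partial>lborel) \<le> norm (c x) * (\<integral>u. norm (e u * \<psi> u) \<partial>lborel)" for x
  proof -
    have "(\<integral>s. norm (G x s) \<partial>lborel) = norm (c x) * (\<integral>s. norm (e (x \<bullet> v + s) * \<psi> (x \<bullet> v + s)) \<partial>lborel)"
      by (simp add: Geq norm_mult)
    also have "\<dots> = norm (c x) * (\<integral>u. norm (e u * \<psi> u) \<partial>lborel)"
      using lborel_integral_shift[of "\<lambda>u. norm (e u * \<psi> u)" "x \<bullet> v"] ie\<psi> by simp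
    finally show ?thesis by simp
  qed
  have Gi: "integrable lborel (G x)" for x
    unfolding Geq using ies(1) by simp
  have ci: "integrable lborel c" using c by (simp add: has_bochner_integral_iff)
  have "(\<integral>x. \<phi> x * \<psi> (x \<bullet> v) \<partial>lborel) = (\<integral>x. (\<integral>s. F x s \<partial>lborel) \<partial>lborel)"
    by (simp add: F_def wflip(2))
  also have "\<dots> = (\<integral>s. (\<integral>x. F x s \<partial>lborel) \<partial>lborel)"
    by (rule lborel_Fubini(4)[OF F1 Fi integrable_norm[OF i\<phi>\<psi>] Fn])
  also have "\<dots> = (\<integral>s. (\<integral>x. G x s \<partial>lborel) \<partial>lborel)"
  proof (rule Bochner_Integration.integral_cong_AE)
    have i2: "integrable (lborel \<Otimes>\<^sub>M lborel) (\<lambda>(x, s). F x s)"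
      by (rule lborel_Fubini(1)[OF F1 Fi integrable_norm[OF i\<phi>\<psi>] Fn])
    \<comment> \<open>Fubini gives integrability of the sections in \<open>x\<close> only for almost
      every \<open>s\<close>, so the translation is carried out almost everywhere.\<close>
    have "AE s in lborel. integrable lborel (\<lambda>x. F x s)"
      using lborel_pair.AE_integrable_snd[OF i2] by simp
    then show "AE s in lborel. (\<integral>x. F x s \<partial>lborel) = (\<integral>x. G x s \<partial>lborel)"
    proof eventually_elim
      case (elim s)
      show ?case unfolding GF using lborel_integral_shift[OF elim, of "s *\<^sub>R v"] by simp
    qed
    show "(\<lambda>s. \<integral>x. F x s \<partial>lborel) \<in> borel_measurable lborel"
      using lborel_Fubini(3)[OF F1 Fi integrable_norm[OF i\<phi>\<psi>] Fn] by auto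
    show "(\<lambda>s. \<integral>x. G x s \<partial>lborel) \<in> borel_measurable lborel"
      using lborel_Fubini(3)[OF G1 Gi integrable_mult_left[OF integrable_norm[OF ci]] Gn] by auto
  qed
  also have "\<dots> = (\<integral>x. (\<integral>s. G x s \<partial>lborel) \<partial>lborel)"
    by (rule lborel_Fubini(4)[OF G1 Gi integrable_mult_left[OF integrable_norm[OF ci]] Gn, symmetric])
  also have "\<dots> = (\<integral>x. c x * (\<integral>u. e u * \<psi> u \<partial>lborel) \<partial>lborel)"
    by (simp add: Geq ies(2))
  also have "\<dots> = integral\<^sup>L lborel c * (\<integral>u. e u * \<psi> u \<partial>lborel)"
    by simp
  finally show ?thesis using c by (simp add: has_bochner_integral_iff \<phi>_def e_def)
qed

section \<open>Approximation of square integrable functions\<close>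

text \<open>Measurable functions are limits of continuous ones almost everywhere. The nearest-point
  map onto the closed disc of radius \<open>k\<close> is continuous and fixes the values of
  \<open>f\<close>, so composing with it forces the bound on the approximants without losing the
  limit.\<close>

lemma bounded_measurable_limit_continuous:
  fixes f :: "'a::euclidean_space \<Rightarrow> complex"
  assumes m[measurable]: "f \<in> borel_measurable borel" and b: "\<And>x. cmod (f x) \<le> k"
  obtains g where "\<And>n. continuous_on UNIV (g n)" "\<And>n x. cmod (g n x) \<le> k"
    "AE x in lborel. (\<lambda>n::nat. g n x) \<longlonglongrightarrow> f x"
proof -
  have "f \<in> borel_measurable lebesgue" using m by (intro measurable_completion) simp
  then have "f measurable_on UNIV" by (intro lebesgue_measurable_imp_measurable_on) auto
  then obtain N g where N: "negligible N" and g: "\<And>n. continuous_on UNIV (g n)"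
    and lim: "\<And>x. x \<notin> N \<Longrightarrow> (\<lambda>n. g n x) \<longlonglongrightarrow> f x"
    unfolding measurable_on_def by auto
  have k: "k \<ge> 0" using b[of 0] norm_ge_zero order_trans by blast
  let ?P = "closest_point (cball (0::complex) k)"
  have P: "continuous_on UNIV ?P"
    using k by (intro continuous_on_closest_point) auto
  show thesis
  proof
    show "continuous_on UNIV (\<lambda>x. ?P (g n x))" for n
      by (rule continuous_on_compose2[OF P g]) auto
    show "cmod (?P (g n x)) \<le> k" for n x
      using closest_point_in_set[of "cball (0::complex) k" "g n x"] k by auto
    have "(\<lambda>n. ?P (g n x)) \<longlonglongrightarrow> f x" if "x \<notin> N" for x
    proof -
      have "(\<lambda>n. ?P (g n x)) \<longlonglongrightarrow> ?P (f x)"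
        by (rule continuous_on_tendsto_compose[OF P lim[OF that]]) auto
      also have "?P (f x) = f x" using b by (intro closest_point_self) simp
      finally show ?thesis .
    qed
    moreover have "AE x in lebesgue. x \<notin> N"
      using N by (auto simp: negligible_iff_null_sets intro: AE_not_in)
    ultimately have "AE x in lebesgue. (\<lambda>n. ?P (g n x)) \<longlonglongrightarrow> f x" by auto
    then show "AE x in lborel. (\<lambda>n. ?P (g n x)) \<longlonglongrightarrow> f x"
      by (simp add: AE_completion_iff)
  qed
qed

lemma cmod_add_square_le: "(cmod (a + b))\<^sup>2 \<le> 2 * (cmod a)\<^sup>2 + 2 * (cmod b)\<^sup>2"
proof -
  have "(cmod (a + b))\<^sup>2 + (cmod (a - b))\<^sup>2 = 2 * (cmod a)\<^sup>2 + 2 * (cmod b)\<^sup>2"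
    unfolding cmod_power2 by (simp add: power2_eq_square algebra_simps)
  then show ?thesis by (smt (verit) zero_le_power2)
qed

lemma integrable_mult_L2:
  fixes f g :: "'a \<Rightarrow> complex"
  assumes [measurable]: "f \<in> borel_measurable M" "g \<in> borel_measurable M"
    and "integrable M (\<lambda>x. (cmod (f x))\<^sup>2)" "integrable M (\<lambda>x. (cmod (g x))\<^sup>2)"
  shows "integrable M (\<lambda>x. f x * g x)"
    and "(\<integral>x. cmod (f x * g x) \<partial>M) \<le> ((\<integral>x. (cmod (f x))\<^sup>2 \<partial>M) + (\<integral>x. (cmod (g x))\<^sup>2 \<partial>M)) / 2"
proof -
  have b: "cmod (f x * g x) \<le> ((cmod (f x))\<^sup>2 + (cmod (g x))\<^sup>2) / 2" for x
    using sum_squares_bound[of "cmod (f x)" "cmod (g x)"] by (simp add: norm_mult)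
  have i: "integrable M (\<lambda>x. ((cmod (f x))\<^sup>2 + (cmod (g x))\<^sup>2) / 2)" using assms by simp
  show p: "integrable M (\<lambda>x. f x * g x)"
    by (rule Bochner_Integration.integrable_bound[OF i]) (use b in auto)
  have "(\<integral>x. cmod (f x * g x) \<partial>M) \<le> (\<integral>x. ((cmod (f x))\<^sup>2 + (cmod (g x))\<^sup>2) / 2 \<partial>M)"
    by (intro integral_mono integrable_norm p i b)
  also have "\<dots> = ((\<integral>x. (cmod (f x))\<^sup>2 \<partial>M) + (\<integral>x. (cmod (g x))\<^sup>2 \<partial>M)) / 2"
    using assms by simp
  finally show "(\<integral>x. cmod (f x * g x) \<partial>M) \<le> ((\<integral>x. (cmod (f x))\<^sup>2 \<partial>M) + (\<integral>x. (cmod (g x))\<^sup>2 \<partial>M)) / 2" .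
qed

lemma integrable_add_L2:
  fixes f g :: "'a \<Rightarrow> complex"
  assumes [measurable]: "f \<in> borel_measurable M" "g \<in> borel_measurable M"
    and "integrable M (\<lambda>x. (cmod (f x))\<^sup>2)" "integrable M (\<lambda>x. (cmod (g x))\<^sup>2)"
  shows "integrable M (\<lambda>x. (cmod (f x + g x))\<^sup>2)" "integrable M (\<lambda>x. (cmod (f x - g x))\<^sup>2)"
proof -
  have i: "integrable M (\<lambda>x. 2 * (cmod (f x))\<^sup>2 + 2 * (cmod (g x))\<^sup>2)" using assms by simp
  show "integrable M (\<lambda>x. (cmod (f x + g x))\<^sup>2)"
    by (rule Bochner_Integration.integrable_bound[OF i])
       (use cmod_add_square_le[of "f _" "g _"] in auto)
  show "integrable M (\<lambda>x. (cmod (f x - g x))\<^sup>2)"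
    by (rule Bochner_Integration.integrable_bound[OF i])
       (use cmod_add_square_le[of "f _" "- g _"] in auto)
qed

text \<open>The Gaussian \<open>w\<close> serves twice. Discarding \<open>u\<close> where it exceeds
  k w makes the quotient by \<open>w\<close> bounded, so bounded continuous functions approximate
  it; multiplying them back by \<open>w\<close> yields approximants that are at once continuous,
  bounded, integrable and square integrable, with a common majorant for dominated
  convergence.\<close>

lemma continuous_bounded_dense_L2:
  fixes u :: "'a::euclidean_space \<Rightarrow> complex"
  assumes [measurable]: "u \<in> borel_measurable borel"
    and u2: "integrable lborel (\<lambda>x. (cmod (u x))\<^sup>2)" and "\<epsilon> > 0"
  obtains h M where "continuous_on UNIV h" "\<And>x. cmod (h x) \<le> M" "integrable lborel h"
    "integrable lborel (\<lambda>x. (cmod (h x))\<^sup>2)" "(\<integral>x. (cmod (u x - h x))\<^sup>2 \<partial>lborel) < \<epsilon>"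
proof -
  define w where "w x = exp (- (norm x)\<^sup>2/2)" for x :: 'a
  have wc: "continuous_on UNIV w" unfolding w_def by (intro continuous_intros) auto
  then have [measurable]: "w \<in> borel_measurable borel" by (rule borel_measurable_continuous_onI)
  have w0: "w x > 0" and w1: "w x \<le> 1" for x by (auto simp: w_def)
  have wi: "integrable lborel w"
    using gauss_real[where 'a='a] by (auto simp: has_bochner_integral_iff w_def[abs_def])
  have w2: "integrable lborel (\<lambda>x. (w x)\<^sup>2)"
    by (rule Bochner_Integration.integrable_bound[OF wi])
       (use w0 w1 in \<open>auto simp: power2_eq_square less_imp_le mult_left_le\<close>)
  define U where "U k x = (if cmod (u x) \<le> real k * w x then u x else 0)" for k :: nat and x
  have [measurable]: "U k \<in> borel_measurable borel" for k unfolding U_def by measurable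
  have "(\<lambda>k. \<integral>x. (cmod (u x - U k x))\<^sup>2 \<partial>lborel) \<longlonglongrightarrow> integral\<^sup>L lborel (\<lambda>x::'a. 0)"
  proof (rule integral_dominated_convergence[OF _ _ u2])
    have "(\<lambda>k. (cmod (u x - U k x))\<^sup>2) \<longlonglongrightarrow> 0" for x
    proof (rule tendsto_eventually)
      obtain K :: nat where K: "cmod (u x) / w x \<le> real K" using real_arch_simple by blast
      have "cmod (u x) \<le> real k * w x" if "k \<ge> K" for k
      proof -
        have "cmod (u x) / w x \<le> real k" using K that by linarith
        then show ?thesis using w0[of x] by (simp add: field_simps)
      qed
      then show "\<forall>\<^sub>F k in sequentially. (cmod (u x - U k x))\<^sup>2 = 0"
        by (intro eventually_sequentiallyI[of K]) (simp add: U_def)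
    qed
    then show "AE x in lborel. (\<lambda>k. (cmod (u x - U k x))\<^sup>2) \<longlonglongrightarrow> 0" by simp
    show "AE x in lborel. norm ((cmod (u x - U k x))\<^sup>2) \<le> (cmod (u x))\<^sup>2" for k
      by (auto simp: U_def)
  qed auto
  \<comment> \<open>Two errors below \<epsilon>/4 suffice, because |a + b|^2 \<le> 2 |a|^2 + 2 |b|^2
    doubles each of them.\<close>
  then have "\<forall>\<^sub>F k in sequentially. (\<integral>x. (cmod (u x - U k x))\<^sup>2 \<partial>lborel) < \<epsilon>/4"
    using \<open>\<epsilon> > 0\<close> by (intro order_tendstoD) auto
  then obtain k where k: "(\<integral>x. (cmod (u x - U k x))\<^sup>2 \<partial>lborel) < \<epsilon>/4"
    by (auto simp: eventually_sequentially)
  have Ub: "cmod (U k x / of_real (w x)) \<le> real k" for x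
    using w0[of x] by (auto simp: U_def norm_divide field_simps)
  obtain g where gc: "\<And>n. continuous_on UNIV (g n)" and gb: "\<And>n x. cmod (g n x) \<le> real k"
    and gl: "AE x in lborel. (\<lambda>n::nat. g n x) \<longlonglongrightarrow> U k x / of_real (w x)"
    using bounded_measurable_limit_continuous[of "\<lambda>x. U k x / of_real (w x)" "real k"] Ub by auto
  have [measurable]: "g n \<in> borel_measurable borel" for n using gc by (rule borel_measurable_continuous_onI)
  define h where "h n x = g n x * of_real (w x)" for n x
  have hw: "cmod (h n x) \<le> real k * w x" for n x
    using gb[of n x] w0[of x] by (simp add: h_def norm_mult mult_right_mono)
  have [measurable]: "h n \<in> borel_measurable borel" for n unfolding h_def by measurable
  have Uw: "cmod (U k x) \<le> real k * w x" for x using w0[of x] by (auto simp: U_def)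
  have "(\<lambda>n. \<integral>x. (cmod (U k x - h n x))\<^sup>2 \<partial>lborel) \<longlonglongrightarrow> integral\<^sup>L lborel (\<lambda>x::'a. 0)"
  proof (rule integral_dominated_convergence[where w="\<lambda>x. (2 * real k)\<^sup>2 * (w x)\<^sup>2"])
    show "integrable lborel (\<lambda>x. (2 * real k)\<^sup>2 * (w x)\<^sup>2)" using w2 by simp
    show "AE x in lborel. (\<lambda>n. (cmod (U k x - h n x))\<^sup>2) \<longlonglongrightarrow> 0"
      using gl
    proof eventually_elim
      case (elim x)
      have "(\<lambda>n. (cmod (U k x - g n x * of_real (w x)))\<^sup>2) \<longlonglongrightarrow> (cmod (U k x - U k x / of_real (w x) * of_real (w x)))\<^sup>2"
        by (intro tendsto_intros elim)
      then show ?case using w0[of x] by (simp add: h_def)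
    qed
    have "cmod (U k x - h n x) \<le> 2 * real k * w x" for n x
      using norm_triangle_ineq4[of "U k x" "h n x"] Uw[of x] hw[of n x] by linarith
    then have "(cmod (U k x - h n x))\<^sup>2 \<le> (2 * real k * w x)\<^sup>2" for n x by (intro power_mono) auto
    then show "AE x in lborel. norm ((cmod (U k x - h n x))\<^sup>2) \<le> (2 * real k)\<^sup>2 * (w x)\<^sup>2" for n
      by (simp add: power_mult_distrib)
  qed auto
  then have "\<forall>\<^sub>F n in sequentially. (\<integral>x. (cmod (U k x - h n x))\<^sup>2 \<partial>lborel) < \<epsilon>/4"
    using \<open>\<epsilon> > 0\<close> by (intro order_tendstoD) auto
  then obtain n where n: "(\<integral>x. (cmod (U k x - h n x))\<^sup>2 \<partial>lborel) < \<epsilon>/4"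
    by (auto simp: eventually_sequentially)
  have hi: "integrable lborel (h n)"
    by (rule Bochner_Integration.integrable_bound[of _ "\<lambda>x. real k * w x"])
       (use wi hw w0 in \<open>auto simp: less_imp_le abs_mult\<close>)
  have sq: "(cmod z)\<^sup>2 \<le> (real k)\<^sup>2 * (w x)\<^sup>2" if "cmod z \<le> real k * w x" for z x
    using power_mono[OF that, of 2] by (simp add: power_mult_distrib)
  have h2: "integrable lborel (\<lambda>x. (cmod (h n x))\<^sup>2)"
    by (rule Bochner_Integration.integrable_bound[of _ "\<lambda>x. (real k)\<^sup>2 * (w x)\<^sup>2"])
       (use w2 sq[OF hw] in auto)
  have U2: "integrable lborel (\<lambda>x. (cmod (U k x))\<^sup>2)"
    by (rule Bochner_Integration.integrable_bound[of _ "\<lambda>x. (real k)\<^sup>2 * (w x)\<^sup>2"])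
       (use w2 sq[OF Uw] in auto)
  have d1: "integrable lborel (\<lambda>x. (cmod (u x - U k x))\<^sup>2)"
    and d2: "integrable lborel (\<lambda>x. (cmod (U k x - h n x))\<^sup>2)"
    and d3: "integrable lborel (\<lambda>x. (cmod (u x - h n x))\<^sup>2)"
    using u2 U2 h2 by (auto intro!: integrable_add_L2(2))
  have "(\<integral>x. (cmod (u x - h n x))\<^sup>2 \<partial>lborel) \<le> (\<integral>x. 2 * (cmod (u x - U k x))\<^sup>2 + 2 * (cmod (U k x - h n x))\<^sup>2 \<partial>lborel)"
  proof (intro integral_mono)
    show "(cmod (u x - h n x))\<^sup>2 \<le> 2 * (cmod (u x - U k x))\<^sup>2 + 2 * (cmod (U k x - h n x))\<^sup>2" for x
      using cmod_add_square_le[of "u x - U k x" "U k x - h n x"] by simp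
  qed (use d1 d2 d3 in auto)
  also have "\<dots> < \<epsilon>" using k n d1 d2 by simp
  finally have "(\<integral>x. (cmod (u x - h n x))\<^sup>2 \<partial>lborel) < \<epsilon>" .
  moreover have "continuous_on UNIV (h n)" unfolding h_def by (intro continuous_intros gc wc)
  moreover have "cmod (h n x) \<le> real k" for x
    using hw[of n x] mult_left_mono[OF w1[of x], of "real k"] by simp
  ultimately show thesis using that hi h2 by blast
qed

section \<open>The Fourier transform on square integrable functions\<close>

text \<open>The sign is that of the factor exp (i b . x) of the Bargmann kernel over the point a + i
  b. No power of 2 pi is included, so Plancherel carries the constant (2 pi)^d.\<close>

definition fourier :: "('a::euclidean_space \<Rightarrow> complex) \<Rightarrow> 'a \<Rightarrow> complex" where
  "fourier u b = (\<integral>x. u x * exp (\<i> * of_real (b \<bullet> x)) \<partial>lborel)"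

lemma borel_measurable_fourier [measurable]:
  assumes [measurable]: "u \<in> borel_measurable borel"
  shows "fourier u \<in> borel_measurable borel"
proof -
  have "(\<lambda>b. \<integral>x. u x * exp (\<i> * of_real (b \<bullet> x)) \<partial>lborel) \<in> borel_measurable lborel"
    by (rule lborel.borel_measurable_lebesgue_integral) measurable
  then show ?thesis by (simp add: fourier_def[abs_def])
qed

lemma integrable_fourier_integrand:
  assumes "integrable lborel u"
  shows "integrable lborel (\<lambda>x. u x * exp (\<i> * of_real (b \<bullet> x)))"
  using assms by (intro Bochner_Integration.integrable_bound[OF assms]) (auto simp: norm_mult)

lemma fourier_le:
  assumes "integrable lborel u"
  shows "cmod (fourier u b) \<le> (\<integral>x. cmod (u x) \<partial>lborel)"
  unfolding fourier_def
  by (rule order_trans[OF integral_norm_bound]) (simp add: norm_mult)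

lemma fourier_add:
  assumes "integrable lborel u" "integrable lborel v"
  shows "fourier (\<lambda>x. u x + v x) b = fourier u b + fourier v b"
    "fourier (\<lambda>x. u x - v x) b = fourier u b - fourier v b"
  unfolding fourier_def using assms[THEN integrable_fourier_integrand]
  by (simp_all add: ring_distribs)

lemma gauss_fourier_scaled:
  fixes z :: "'a::euclidean_space" and r :: real
  assumes r: "r > 0"
  shows "has_bochner_integral lborel (\<lambda>b. exp (of_real (- (norm b)\<^sup>2/(2*r\<^sup>2)) + \<i> * of_real (b \<bullet> z)))
     (of_real (sqrt (2*pi) ^ DIM('a) * r ^ DIM('a) * exp (- r\<^sup>2 * (norm z)\<^sup>2/2)))"
proof -
  define l where "l b = \<i> * of_real (b \<bullet> (r *\<^sub>R z))" for b
  have l: "linear l" by (rule linearI) (simp_all add: l_def inner_add_left algebra_simps scaleR_conv_of_real)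
  have s: "(\<Sum>b\<in>Basis. (l b)\<^sup>2)/2 = of_real (- r\<^sup>2 * (norm z)\<^sup>2/2)"
  proof -
    have n: "(norm z)\<^sup>2 = (\<Sum>b\<in>Basis. (b \<bullet> z)\<^sup>2)"
      by (subst power2_norm_eq_inner, subst euclidean_inner) (simp add: power2_eq_square inner_commute)
    show ?thesis unfolding n
      by (simp add: l_def power_mult_distrib sum_negf sum_distrib_left)
  qed
  have "has_bochner_integral lborel (\<lambda>x. exp (of_real (- (norm (0 + (1/r) *\<^sub>R x))\<^sup>2/2) + l (0 + (1/r) *\<^sub>R x)))
     ((of_real (sqrt (2*pi) ^ DIM('a)) * exp ((\<Sum>b\<in>(Basis::'a set). (l b)\<^sup>2)/2)) /\<^sub>R \<bar>1/r\<bar>^DIM('a))"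
    using lborel_affine_has_bochner_integral[of "1/r" "\<lambda>x. exp (of_real (- (norm x)\<^sup>2/2) + l x)" 0] gauss_complex[OF l] r
    by (simp add: has_bochner_integral_iff)
  moreover have "exp (of_real (- (norm (0 + (1/r) *\<^sub>R x))\<^sup>2/2) + l (0 + (1/r) *\<^sub>R x))
     = exp (of_real (- (norm x)\<^sup>2/(2*r\<^sup>2)) + \<i> * of_real (x \<bullet> z))" for x
    using r by (simp add: l_def power_divide mult.commute)
  moreover have "(of_real (sqrt (2*pi) ^ DIM('a)) * exp ((\<Sum>b\<in>(Basis::'a set). (l b)\<^sup>2)/2)) /\<^sub>R \<bar>1/r\<bar>^DIM('a)
     = of_real (sqrt (2*pi) ^ DIM('a) * r ^ DIM('a) * exp (- r\<^sup>2 * (norm z)\<^sup>2/2))"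
    unfolding s exp_of_real using r by (simp add: scaleR_conv_of_real power_divide field_simps)
  ultimately show ?thesis by (simp only:)
qed

lemma integrable_tensor:
  fixes u v :: "'a::euclidean_space \<Rightarrow> complex"
  assumes "integrable lborel u" "integrable lborel v"
  shows "integrable (lborel \<Otimes>\<^sub>M lborel) (\<lambda>(x, y). u x * v y)"
proof (rule lborel_Fubini(1)[where g="\<lambda>x. norm (u x) * (\<integral>y. norm (v y) \<partial>lborel)"])
  have [measurable]: "u \<in> borel_measurable borel" "v \<in> borel_measurable borel" using assms by auto
  show "(\<lambda>(x, y). u x * v y) \<in> borel_measurable (lborel \<Otimes>\<^sub>M lborel)" by measurable
qed (use assms in \<open>auto simp: norm_mult\<close>)

text \<open>The bound does not depend on \<open>y\<close>, so it majorises the autocorrelation of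
  \<open>u\<close> at all shifts simultaneously.\<close>

lemma L2_translate:
  fixes u :: "'a::euclidean_space \<Rightarrow> complex"
  assumes [measurable]: "u \<in> borel_measurable borel" and u2: "integrable lborel (\<lambda>x. (cmod (u x))\<^sup>2)"
  shows "integrable lborel (\<lambda>x. u x * cnj (u (x + y)))"
    and "(\<integral>x. cmod (u x * cnj (u (x + y))) \<partial>lborel) \<le> (\<integral>x. (cmod (u x))\<^sup>2 \<partial>lborel)"
proof -
  have s: "integrable lborel (\<lambda>x. (cmod (cnj (u (x + y))))\<^sup>2)" "(\<integral>x. (cmod (cnj (u (x + y))))\<^sup>2 \<partial>lborel) = (\<integral>x. (cmod (u x))\<^sup>2 \<partial>lborel)"
    using lborel_integrable_shift[OF u2, of y] lborel_integral_shift[OF u2, of y] by (simp_all add: add.commute)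
  show "integrable lborel (\<lambda>x. u x * cnj (u (x + y)))"
    by (rule integrable_mult_L2) (use s u2 in auto)
  show "(\<integral>x. cmod (u x * cnj (u (x + y))) \<partial>lborel) \<le> (\<integral>x. (cmod (u x))\<^sup>2 \<partial>lborel)"
    using integrable_mult_L2(2)[of u lborel "\<lambda>x. cnj (u (x + y))"] s u2 by simp
qed

text \<open>Writing |fourier u|^2 as a double integral leaves an oscillating integral over
  \<open>b\<close> that does not converge absolutely. The Gaussian factor repairs this. Its own
  transform concentrates x - y at scale 1/r, and the substitution y = x + w/r turns the result into
  a Gaussian average of the autocorrelation of \<open>u\<close> at the shifts w/r.\<close>

lemma fourier_regularised:
  fixes u :: "'a::euclidean_space \<Rightarrow> complex" and r :: real
  assumes u: "integrable lborel u" and u2: "integrable lborel (\<lambda>x. (cmod (u x))\<^sup>2)" and r: "r > 0"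
  shows "(\<integral>b. of_real (exp (- (norm b)\<^sup>2/(2*r\<^sup>2)) * (cmod (fourier u b))\<^sup>2) \<partial>lborel)
    = of_real (sqrt (2*pi) ^ DIM('a))
        * (\<integral>w. of_real (exp (- (norm w)\<^sup>2/2)) * (\<integral>x. u x * cnj (u (x + (1/r) *\<^sub>R w)) \<partial>lborel) \<partial>lborel)"
proof -
  have [measurable]: "u \<in> borel_measurable borel" using u by auto
  define K where "K = sqrt (2*pi) ^ DIM('a)"
  have cu: "integrable lborel (\<lambda>x. cnj (u x))" using u by simp
  have tens: "integrable (lborel \<Otimes>\<^sub>M lborel) (\<lambda>(x, y). u x * cnj (u y))"
    by (rule integrable_tensor[OF u cu])
  then have tens': "integrable lborel (\<lambda>z. u (fst z) * cnj (u (snd z)))"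
    by (simp add: lborel_prod case_prod_beta')
  define E where "E b z = exp (of_real (- (norm b)\<^sup>2/(2*r\<^sup>2)) + \<i> * of_real (b \<bullet> z))" for b z :: 'a
  define F where "F b z = E b (fst z - snd z) * (u (fst z) * cnj (u (snd z)))" for b and z :: "'a \<times> 'a"
  have bd: "cmod (of_real (A * exp (- r\<^sup>2 * t/2)) * P) \<le> cmod (of_real A * P)" if "t \<ge> 0" for A t P
  proof -
    have "\<bar>A\<bar> * exp (- r\<^sup>2 * t/2) \<le> \<bar>A\<bar> * 1" using that by (intro mult_left_mono) auto
    then show ?thesis by (simp add: norm_mult abs_mult mult_right_mono)
  qed
  have En: "cmod (E b z) = exp (- (norm b)\<^sup>2/(2*r\<^sup>2))" for b z
    by (simp add: E_def)
  have Ei: "integrable lborel (\<lambda>b. E b z)" and Ev: "(\<integral>b. E b z \<partial>lborel) = of_real (K * r ^ DIM('a) * exp (- r\<^sup>2 * (norm z)\<^sup>2/2))" for z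
    using gauss_fourier_scaled[OF r, of z] by (auto simp: has_bochner_integral_iff E_def K_def)
  have En0: "integrable lborel (\<lambda>b::'a. exp (- (norm b)\<^sup>2/(2*r\<^sup>2)))"
    using integrable_norm[OF Ei[of 0]] by (simp add: En)
  have Fm: "(\<lambda>(b, z). F b z) \<in> borel_measurable (lborel \<Otimes>\<^sub>M lborel)"
    unfolding lborel_prod[symmetric] F_def E_def by measurable
  have Fi: "integrable lborel (F b)" for b
  proof (rule Bochner_Integration.integrable_bound[OF integrable_mult_right[OF integrable_norm[OF tens'], of "exp (- (norm b)\<^sup>2/(2*r\<^sup>2))"]])
    show "F b \<in> borel_measurable lborel"
      unfolding lborel_prod[symmetric] F_def E_def by measurable
  qed (auto simp: F_def En norm_mult)
  have Fn: "(\<integral>z. norm (F b z) \<partial>lborel) \<le> exp (- (norm b)\<^sup>2/(2*r\<^sup>2)) * (\<integral>z. norm (u (fst z) * cnj (u (snd z))) \<partial>lborel)" for b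
    by (simp add: F_def En norm_mult)
  have "of_real (exp (- (norm b)\<^sup>2/(2*r\<^sup>2)) * (cmod (fourier u b))\<^sup>2) = (\<integral>z. F b z \<partial>lborel)" for b
  proof -
    have i1: "integrable (lborel \<Otimes>\<^sub>M lborel) (\<lambda>(x, y). (u x * exp (\<i> * of_real (b \<bullet> x))) * cnj (u y * exp (\<i> * of_real (b \<bullet> y))))"
      using integrable_fourier_integrand[OF u, of b] by (intro integrable_tensor integrable_cnj)
    have "fourier u b * cnj (fourier u b)
      = (\<integral>x. (\<integral>y. (u x * exp (\<i> * of_real (b \<bullet> x))) * cnj (u y * exp (\<i> * of_real (b \<bullet> y))) \<partial>lborel) \<partial>lborel)"
      by (simp only: fourier_def Bochner_Integration.integral_cnj[symmetric] integral_mult_right_zero integral_mult_left_zero)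
    also have "\<dots> = (\<integral>(x, y). (u x * exp (\<i> * of_real (b \<bullet> x))) * cnj (u y * exp (\<i> * of_real (b \<bullet> y))) \<partial>(lborel \<Otimes>\<^sub>M lborel))"
      using lborel_pair.integral_fst'[OF i1] by simp
    also have "\<dots> = (\<integral>z. exp (\<i> * of_real (b \<bullet> (fst z - snd z))) * (u (fst z) * cnj (u (snd z))) \<partial>lborel)"
      unfolding lborel_prod
    proof (intro Bochner_Integration.integral_cong refl)
      fix z :: "'a \<times> 'a"
      have "exp (\<i> * of_real (b \<bullet> (fst z - snd z))) = exp (\<i> * of_real (b \<bullet> fst z)) * cnj (exp (\<i> * of_real (b \<bullet> snd z)))"
        by (simp add: exp_cnj inner_diff_right right_diff_distrib exp_diff exp_minus divide_inverse)
      then show "(case z of (x, y) \<Rightarrow> u x * exp (\<i> * of_real (b \<bullet> x)) * cnj (u y * exp (\<i> * of_real (b \<bullet> y))))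
          = exp (\<i> * of_real (b \<bullet> (fst z - snd z))) * (u (fst z) * cnj (u (snd z)))"
        unfolding case_prod_beta by (simp only: complex_cnj_mult mult_ac)
    qed
    finally have 1: "of_real ((cmod (fourier u b))\<^sup>2) = (\<integral>z. exp (\<i> * of_real (b \<bullet> (fst z - snd z))) * (u (fst z) * cnj (u (snd z))) \<partial>lborel)"
      by (simp add: complex_norm_square[symmetric])
    have 2: "F b z = of_real (exp (- (norm b)\<^sup>2/(2*r\<^sup>2))) * (exp (\<i> * of_real (b \<bullet> (fst z - snd z))) * (u (fst z) * cnj (u (snd z))))" for z
      unfolding F_def E_def exp_add exp_of_real by (simp add: mult.assoc)
    show ?thesis unfolding 2 of_real_mult 1 by simp
  qed
  then have "(\<integral>b. of_real (exp (- (norm b)\<^sup>2/(2*r\<^sup>2)) * (cmod (fourier u b))\<^sup>2) \<partial>lborel) = (\<integral>b. (\<integral>z. F b z \<partial>lborel) \<partial>lborel)"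
    by simp
  also have "\<dots> = (\<integral>z. (\<integral>b. F b z \<partial>lborel) \<partial>lborel)"
    by (rule lborel_Fubini(4)[OF Fm Fi integrable_mult_left[OF En0] Fn])
  also have "\<dots> = (\<integral>z. of_real (K * r ^ DIM('a) * exp (- r\<^sup>2 * (norm (fst z - snd z))\<^sup>2/2)) * (u (fst z) * cnj (u (snd z))) \<partial>lborel)"
    unfolding F_def by (simp add: Ev)
  also have "\<dots> = (\<integral>(x, y). of_real (K * r ^ DIM('a) * exp (- r\<^sup>2 * (norm (x - y))\<^sup>2/2)) * (u x * cnj (u y)) \<partial>(lborel \<Otimes>\<^sub>M lborel))"
    unfolding lborel_prod case_prod_beta' by (rule refl)
  also have "\<dots> = (\<integral>x. (\<integral>y. of_real (K * r ^ DIM('a) * exp (- r\<^sup>2 * (norm (x - y))\<^sup>2/2)) * (u x * cnj (u y)) \<partial>lborel) \<partial>lborel)"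
  proof -
    have "integrable (lborel \<Otimes>\<^sub>M lborel) (\<lambda>(x, y). of_real (K * r ^ DIM('a) * exp (- r\<^sup>2 * (norm (x - y))\<^sup>2/2)) * (u x * cnj (u y)))"
    proof (rule Bochner_Integration.integrable_bound[OF integrable_mult_right[OF tens, of "of_real (K * r ^ DIM('a))"]])
      show "AE z in lborel \<Otimes>\<^sub>M lborel. norm (case z of (x, y) \<Rightarrow> of_real (K * r ^ DIM('a) * exp (- r\<^sup>2 * (norm (x - y))\<^sup>2/2)) * (u x * cnj (u y)))
        \<le> norm (of_real (K * r ^ DIM('a)) * (case z of (x, y) \<Rightarrow> u x * cnj (u y)))"
        unfolding case_prod_beta by (intro AE_I2 bd) simp
    qed measurable
    from lborel_pair.integral_fst'[OF this] show ?thesis by simp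
  qed
  also have "\<dots> = (\<integral>x. (\<integral>w. of_real (K * exp (- (norm w)\<^sup>2/2)) * (u x * cnj (u (x + (1/r) *\<^sub>R w))) \<partial>lborel) \<partial>lborel)"
  proof (rule Bochner_Integration.integral_cong[OF refl])
    fix x
    let ?f = "\<lambda>y. of_real (K * r ^ DIM('a) * exp (- r\<^sup>2 * (norm (x - y))\<^sup>2/2)) * (u x * cnj (u y))"
    have i: "integrable lborel ?f"
      by (rule Bochner_Integration.integrable_bound[OF integrable_mult_right[OF cu, of "of_real (K * r ^ DIM('a)) * u x"]])
         (use bd[of _ "K * r ^ DIM('a)" "u x * cnj (u _)"] in \<open>auto simp: mult.assoc\<close>)
    \<comment> \<open>The Jacobian of y = x + w/r cancels the factor r^d of the transformed
      Gaussian, which is why only \<open>K\<close> remains.\<close>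
    have f: "?f (x + (1/r) *\<^sub>R w) = r ^ DIM('a) *\<^sub>R (of_real (K * exp (- (norm w)\<^sup>2/2)) * (u x * cnj (u (x + (1/r) *\<^sub>R w))))" for w
      using r by (simp add: scaleR_conv_of_real power_divide)
    have "(\<integral>w. ?f (x + (1/r) *\<^sub>R w) \<partial>lborel) = integral\<^sup>L lborel ?f /\<^sub>R \<bar>1/r\<bar>^DIM('a)"
      using r by (intro lborel_integral_affine i) auto
    then show "integral\<^sup>L lborel ?f = (\<integral>w. of_real (K * exp (- (norm w)\<^sup>2/2)) * (u x * cnj (u (x + (1/r) *\<^sub>R w))) \<partial>lborel)"
      unfolding f using r by (simp add: power_divide)
  qed
  also have "\<dots> = (\<integral>w. (\<integral>x. of_real (K * exp (- (norm w)\<^sup>2/2)) * (u x * cnj (u (x + (1/r) *\<^sub>R w))) \<partial>lborel) \<partial>lborel)"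
  proof (rule lborel_Fubini(4)[symmetric, where f="\<lambda>w x. of_real (K * exp (- (norm w)\<^sup>2/2)) * (u x * cnj (u (x + (1/r) *\<^sub>R w)))"
        and g="\<lambda>w. K * exp (- (norm w)\<^sup>2/2) * (\<integral>x. (cmod (u x))\<^sup>2 \<partial>lborel)"])
    show "integrable lborel (\<lambda>w::'a. K * exp (- (norm w)\<^sup>2/2) * (\<integral>x. (cmod (u x))\<^sup>2 \<partial>lborel))"
      using gauss_real[where 'a='a] by (simp add: has_bochner_integral_iff)
    have um: "u \<in> borel_measurable borel" by measurable
    note p = L2_translate(1)[OF um u2] and q = L2_translate(2)[OF um u2]
    show "integrable lborel (\<lambda>x. of_real (K * exp (- (norm w)\<^sup>2/2)) * (u x * cnj (u (x + (1/r) *\<^sub>R w))))" for w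
      using p by simp
    have K0: "K \<ge> 0" by (simp add: K_def)
    have nm: "cmod (of_real (K * exp (- (norm w)\<^sup>2/2)) * z) = (K * exp (- (norm w)\<^sup>2/2)) * cmod z" for w::'a and z
      using K0 by (simp add: norm_mult)
    show "(\<integral>x. norm (of_real (K * exp (- (norm w)\<^sup>2/2)) * (u x * cnj (u (x + (1/r) *\<^sub>R w)))) \<partial>lborel) \<le> K * exp (- (norm w)\<^sup>2/2) * (\<integral>x. (cmod (u x))\<^sup>2 \<partial>lborel)" for w
      unfolding nm integral_mult_right_zero by (rule mult_left_mono[OF q]) (use K0 in auto)
  qed measurable
  finally show ?thesis by (simp add: K_def mult.assoc)
qed

lemma sqrt_2pi_power: "sqrt (2*pi) ^ n * sqrt (2*pi) ^ n = (2*pi) ^ n"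
proof -
  have "sqrt (2*pi) ^ n * sqrt (2*pi) ^ n = (sqrt (2*pi) * sqrt (2*pi)) ^ n"
    by (rule power_mult_distrib[symmetric])
  also have "sqrt (2*pi) * sqrt (2*pi) = 2*pi"
    by (rule real_sqrt_mult_self[THEN trans]) simp
  finally show ?thesis .
qed

lemma gauss_regulariser_tendsto:
  fixes b :: "'a::real_normed_vector" and c :: real
  shows "(\<lambda>n. exp (- (norm b)\<^sup>2/(2*(real (Suc n))\<^sup>2)) * c) \<longlonglongrightarrow> c"
proof -
  have "(\<lambda>n. - (norm b)\<^sup>2/2 * (inverse (real (Suc n)))\<^sup>2) \<longlonglongrightarrow> - (norm b)\<^sup>2/2 * 0\<^sup>2"
    by (intro tendsto_intros LIMSEQ_inverse_real_of_nat)
  then have "(\<lambda>n. exp (- (norm b)\<^sup>2/2 * (inverse (real (Suc n)))\<^sup>2) * c) \<longlonglongrightarrow> exp 0 * c"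
    by (intro tendsto_intros) simp
  then show ?thesis by (simp add: field_simps)
qed

text \<open>Autocorrelations never exceed the squared norm, so the regularised integrals are bounded
  by one constant, and Fatou's lemma removes the Gaussian. This inequality has to come before the
  equality: the integrable function |fourier u|^2 is the majorant in the exact limit.\<close>

lemma fourier_L2_bound:
  fixes u :: "'a::euclidean_space \<Rightarrow> complex"
  assumes u: "integrable lborel u" and u2: "integrable lborel (\<lambda>x. (cmod (u x))\<^sup>2)"
  shows "integrable lborel (\<lambda>b. (cmod (fourier u b))\<^sup>2)"
    and "(\<integral>b. (cmod (fourier u b))\<^sup>2 \<partial>lborel) \<le> (2*pi) ^ DIM('a) * (\<integral>x. (cmod (u x))\<^sup>2 \<partial>lborel)"
proof -
  have [measurable]: "u \<in> borel_measurable borel" using u by auto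
  define B where "B = (2*pi) ^ DIM('a) * (\<integral>x. (cmod (u x))\<^sup>2 \<partial>lborel)"
  have B0: "B \<ge> 0" by (simp add: B_def)
  \<comment> \<open>The regularisation parameter is r = n + 1, positive for every \<open>n\<close>;
    the Gaussian factor tends to 1 from below.\<close>
  define J where "J n b = exp (- (norm b)\<^sup>2/(2*(real (Suc n))\<^sup>2)) * (cmod (fourier u b))\<^sup>2" for n and b :: 'a
  have [measurable]: "J n \<in> borel_measurable borel" for n unfolding J_def by measurable
  have Ji: "integrable lborel (J n)" for n
  proof (rule Bochner_Integration.integrable_bound)
    have "integrable lborel (\<lambda>b::'a. cmod (exp (of_real (- (norm b)\<^sup>2/(2*(real (Suc n))\<^sup>2)) + \<i> * of_real (b \<bullet> 0))))"
      using gauss_fourier_scaled[of "real (Suc n)" "0::'a"] by (intro integrable_norm) (simp add: has_bochner_integral_iff)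
    then have "integrable lborel (\<lambda>b::'a. exp (- (norm b)\<^sup>2/(2*(real (Suc n))\<^sup>2)))" by simp
    then show "integrable lborel (\<lambda>b::'a. exp (- (norm b)\<^sup>2/(2*(real (Suc n))\<^sup>2)) * (\<integral>x. cmod (u x) \<partial>lborel)\<^sup>2)" by simp
    have "J n b \<le> exp (- (norm b)\<^sup>2/(2*(real (Suc n))\<^sup>2)) * (\<integral>x. cmod (u x) \<partial>lborel)\<^sup>2" for b
      unfolding J_def by (intro mult_left_mono power_mono fourier_le u) auto
    moreover have "J n b \<ge> 0" for b by (simp add: J_def)
    ultimately show "AE b in lborel. norm (J n b) \<le> norm (exp (- (norm b)\<^sup>2/(2*(real (Suc n))\<^sup>2)) * (\<integral>x. cmod (u x) \<partial>lborel)\<^sup>2)"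
      by auto
  qed measurable
  have JB: "integral\<^sup>L lborel (J n) \<le> B" for n
  proof -
    have "complex_of_real (integral\<^sup>L lborel (J n)) = (\<integral>b. of_real (J n b) \<partial>lborel)" by simp
    also have "\<dots> = of_real (sqrt (2*pi) ^ DIM('a))
        * (\<integral>w. of_real (exp (- (norm w)\<^sup>2/2)) * (\<integral>x. u x * cnj (u (x + (1/real (Suc n)) *\<^sub>R w)) \<partial>lborel) \<partial>lborel)" (is "_ = _ * ?I")
      unfolding J_def by (rule fourier_regularised[OF u u2]) simp
    finally have e1: "cmod (complex_of_real (integral\<^sup>L lborel (J n))) = sqrt (2*pi) ^ DIM('a) * cmod ?I"
      by (simp add: norm_mult norm_power)
    have e2: "cmod ?I \<le> (\<integral>(w::'a). exp (- (norm w)\<^sup>2/2) * (\<integral>x. (cmod (u x))\<^sup>2 \<partial>lborel) \<partial>lborel)"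
    proof (rule order_trans[OF integral_norm_bound], rule integral_mono')
      fix w :: 'a
      show "cmod (of_real (exp (- (norm w)\<^sup>2/2)) * (\<integral>x. u x * cnj (u (x + (1/real (Suc n)) *\<^sub>R w)) \<partial>lborel)) \<le> exp (- (norm w)\<^sup>2/2) * (\<integral>x. (cmod (u x))\<^sup>2 \<partial>lborel)"
        using order_trans[OF integral_norm_bound L2_translate(2)[OF _ u2, of "(1/real (Suc n)) *\<^sub>R w"]]
        by (simp add: norm_mult)
    next
      show "integrable lborel (\<lambda>w::'a. exp (- (norm w)\<^sup>2/2) * (\<integral>x. (cmod (u x))\<^sup>2 \<partial>lborel))"
        using gauss_real[where 'a='a] by (simp add: has_bochner_integral_iff)
      show "0 \<le> exp (- (norm w)\<^sup>2/2) * (\<integral>x. (cmod (u x))\<^sup>2 \<partial>lborel)" for w :: 'a by simp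
    qed
    have e3: "(\<integral>(w::'a). exp (- (norm w)\<^sup>2/2) * (\<integral>x. (cmod (u x))\<^sup>2 \<partial>lborel) \<partial>lborel) = sqrt (2*pi) ^ DIM('a) * (\<integral>x. (cmod (u x))\<^sup>2 \<partial>lborel)"
      using gauss_real[where 'a='a] by (simp add: has_bochner_integral_iff)
    have "cmod (complex_of_real (integral\<^sup>L lborel (J n))) \<le> sqrt (2*pi) ^ DIM('a) * (sqrt (2*pi) ^ DIM('a) * (\<integral>x. (cmod (u x))\<^sup>2 \<partial>lborel))"
      unfolding e1 by (rule mult_left_mono[OF e2[unfolded e3]]) simp
    also have "\<dots> = B" by (simp only: B_def mult.assoc[symmetric] sqrt_2pi_power)
    finally show ?thesis using abs_ge_self order_trans unfolding norm_of_real by blast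
  qed
  have lim: "(\<lambda>n. ennreal (J n b)) \<longlonglongrightarrow> ennreal ((cmod (fourier u b))\<^sup>2)" for b
    unfolding J_def by (intro tendsto_ennrealI gauss_regulariser_tendsto)
  have "(\<integral>\<^sup>+b. ennreal ((cmod (fourier u b))\<^sup>2) \<partial>lborel) = (\<integral>\<^sup>+b. liminf (\<lambda>n. ennreal (J n b)) \<partial>lborel)"
    by (intro nn_integral_cong) (simp only: lim_imp_Liminf[OF sequentially_bot lim])
  also have "\<dots> \<le> liminf (\<lambda>n. \<integral>\<^sup>+b. ennreal (J n b) \<partial>lborel)"
    by (rule nn_integral_liminf) measurable
  also have "\<dots> \<le> liminf (\<lambda>n. ennreal B)"
  proof (rule Liminf_mono, rule always_eventually, rule allI)
    fix n
    have "(\<integral>\<^sup>+b. ennreal (J n b) \<partial>lborel) = ennreal (integral\<^sup>L lborel (J n))"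
      by (rule nn_integral_eq_integral[OF Ji]) (simp add: J_def)
    then show "(\<integral>\<^sup>+b. ennreal (J n b) \<partial>lborel) \<le> ennreal B" using JB[of n] by (simp add: ennreal_leI)
  qed
  also have "\<dots> = ennreal B" by (simp add: Liminf_const)
  finally have le: "(\<integral>\<^sup>+b. ennreal ((cmod (fourier u b))\<^sup>2) \<partial>lborel) \<le> ennreal B" .
  show i: "integrable lborel (\<lambda>b. (cmod (fourier u b))\<^sup>2)"
  proof (rule integrableI_bounded)
    show "(\<integral>\<^sup>+b. ennreal (norm ((cmod (fourier u b))\<^sup>2)) \<partial>lborel) < \<infinity>"
      using le by (simp add: le_less_trans)
  qed measurable
  have "(\<integral>\<^sup>+b. ennreal ((cmod (fourier u b))\<^sup>2) \<partial>lborel) = ennreal (\<integral>b. (cmod (fourier u b))\<^sup>2 \<partial>lborel)"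
    by (rule nn_integral_eq_integral[OF i]) simp
  with le B0 show "(\<integral>b. (cmod (fourier u b))\<^sup>2 \<partial>lborel) \<le> (2*pi) ^ DIM('a) * (\<integral>x. (cmod (u x))\<^sup>2 \<partial>lborel)"
    by (simp add: B_def)
qed

text \<open>Continuity makes the autocorrelation at shifts tending to 0 converge to the squared
  norm, with M |u| as majorant, so the regularised identity passes to the limit as an
  equality.\<close>

lemma plancherel_continuous:
  fixes u :: "'a::euclidean_space \<Rightarrow> complex"
  assumes u: "integrable lborel u" and u2: "integrable lborel (\<lambda>x. (cmod (u x))\<^sup>2)"
    and uc: "continuous_on UNIV u" and ub: "\<And>x. cmod (u x) \<le> M"
  shows "(\<integral>b. (cmod (fourier u b))\<^sup>2 \<partial>lborel) = (2*pi) ^ DIM('a) * (\<integral>x. (cmod (u x))\<^sup>2 \<partial>lborel)"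
proof -
  have [measurable]: "u \<in> borel_measurable borel" using u by auto
  define J where "J n b = exp (- (norm b)\<^sup>2/(2*(real (Suc n))\<^sup>2)) * (cmod (fourier u b))\<^sup>2" for n and b :: 'a
  have [measurable]: "J n \<in> borel_measurable borel" for n unfolding J_def by measurable
  have 1: "(\<lambda>n. integral\<^sup>L lborel (J n)) \<longlonglongrightarrow> (\<integral>b. (cmod (fourier u b))\<^sup>2 \<partial>lborel)"
  proof (rule integral_dominated_convergence[OF _ _ fourier_L2_bound(1)[OF u u2]])
    show "AE b in lborel. (\<lambda>n. J n b) \<longlonglongrightarrow> (cmod (fourier u b))\<^sup>2"
      unfolding J_def by (intro AE_I2 gauss_regulariser_tendsto)
    show "AE b in lborel. norm (J n b) \<le> (cmod (fourier u b))\<^sup>2" for n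
      by (simp add: J_def abs_mult mult_left_le_one_le)
  qed measurable
  define C where "C n w = (\<integral>x. u x * cnj (u (x + (1/real (Suc n)) *\<^sub>R w)) \<partial>lborel)" for n w
  have C: "(\<lambda>n. C n w) \<longlonglongrightarrow> (\<integral>x. u x * cnj (u x) \<partial>lborel)" for w
    unfolding C_def
  proof (rule integral_dominated_convergence[where w="\<lambda>x. M * cmod (u x)"])
    have "(\<lambda>n. u x * cnj (u (x + (1/real (Suc n)) *\<^sub>R w))) \<longlonglongrightarrow> u x * cnj (u x)" for x
    proof -
      have "(\<lambda>n. x + inverse (real (Suc n)) *\<^sub>R w) \<longlonglongrightarrow> x + 0 *\<^sub>R w"
        by (intro tendsto_intros LIMSEQ_inverse_real_of_nat)
      then have "(\<lambda>n. x + (1/real (Suc n)) *\<^sub>R w) \<longlonglongrightarrow> x" by (simp add: inverse_eq_divide)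
      then have "(\<lambda>n. u (x + (1/real (Suc n)) *\<^sub>R w)) \<longlonglongrightarrow> u x"
        by (rule continuous_on_tendsto_compose[OF uc]) auto
      then show ?thesis by (intro tendsto_intros)
    qed
    then show "AE x in lborel. (\<lambda>n. u x * cnj (u (x + (1/real (Suc n)) *\<^sub>R w))) \<longlonglongrightarrow> u x * cnj (u x)" by simp
    show "AE x in lborel. norm (u x * cnj (u (x + (1/real (Suc n)) *\<^sub>R w))) \<le> M * cmod (u x)" for n
      using ub by (auto simp: norm_mult mult.commute[of M] intro!: mult_left_mono)
    show "integrable lborel (\<lambda>x. M * cmod (u x))" using u by simp
  qed measurable
  have "(\<lambda>n. \<integral>w. of_real (exp (- (norm w)\<^sup>2/2)) * C n w \<partial>lborel) \<longlonglongrightarrow> (\<integral>(w::'a). of_real (exp (- (norm w)\<^sup>2/2)) * (\<integral>x. u x * cnj (u x) \<partial>lborel) \<partial>lborel)"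
  proof (rule integral_dominated_convergence[where w="\<lambda>w. exp (- (norm w)\<^sup>2/2) * (\<integral>x. (cmod (u x))\<^sup>2 \<partial>lborel)"])
    show "integrable lborel (\<lambda>w::'a. exp (- (norm w)\<^sup>2/2) * (\<integral>x. (cmod (u x))\<^sup>2 \<partial>lborel))"
      using gauss_real[where 'a='a] by (simp add: has_bochner_integral_iff)
    show "AE w in lborel. (\<lambda>n. of_real (exp (- (norm w)\<^sup>2/2)) * C n w) \<longlonglongrightarrow> of_real (exp (- (norm w)\<^sup>2/2)) * (\<integral>x. u x * cnj (u x) \<partial>lborel)"
      by (intro AE_I2 tendsto_intros C)
    show "AE w in lborel. norm (of_real (exp (- (norm w)\<^sup>2/2)) * C n w) \<le> exp (- (norm w)\<^sup>2/2) * (\<integral>x. (cmod (u x))\<^sup>2 \<partial>lborel)" for n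
      unfolding C_def using order_trans[OF integral_norm_bound L2_translate(2)[OF _ u2]]
      by (intro AE_I2) (simp add: norm_mult)
    show "(\<lambda>w. of_real (exp (- (norm w)\<^sup>2/2)) * C n w) \<in> borel_measurable lborel" for n
    proof -
      have [measurable]: "C n \<in> borel_measurable lborel"
        unfolding C_def by (rule lborel.borel_measurable_lebesgue_integral) measurable
      show ?thesis by measurable
    qed
  qed measurable
  moreover have "(\<integral>(w::'a). of_real (exp (- (norm w)\<^sup>2/2)) * (\<integral>x. u x * cnj (u x) \<partial>lborel) \<partial>lborel)
     = complex_of_real (sqrt (2*pi) ^ DIM('a) * (\<integral>x. (cmod (u x))\<^sup>2 \<partial>lborel))"
    using gauss_real[where 'a='a] by (simp add: has_bochner_integral_iff complex_norm_square[symmetric] del: of_real_power of_real_exp flip: of_real_power)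
  ultimately have "(\<lambda>n. complex_of_real (sqrt (2*pi) ^ DIM('a)) * (\<integral>w. of_real (exp (- (norm w)\<^sup>2/2)) * C n w \<partial>lborel))
     \<longlonglongrightarrow> of_real (sqrt (2*pi) ^ DIM('a)) * of_real (sqrt (2*pi) ^ DIM('a) * (\<integral>x. (cmod (u x))\<^sup>2 \<partial>lborel))"
    by (intro tendsto_intros) simp
  moreover have "of_real (sqrt (2*pi) ^ DIM('a)) * (\<integral>w. of_real (exp (- (norm w)\<^sup>2/2)) * C n w \<partial>lborel) = complex_of_real (integral\<^sup>L lborel (J n))" for n
  proof -
    have "of_real (sqrt (2*pi) ^ DIM('a)) * (\<integral>w. of_real (exp (- (norm w)\<^sup>2/2)) * C n w \<partial>lborel) = (\<integral>b. of_real (J n b) \<partial>lborel)"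
      unfolding C_def J_def by (rule fourier_regularised[OF u u2, symmetric]) simp
    then show ?thesis by simp
  qed
  ultimately have "(\<lambda>n. complex_of_real (integral\<^sup>L lborel (J n))) \<longlonglongrightarrow> of_real (sqrt (2*pi) ^ DIM('a)) * of_real (sqrt (2*pi) ^ DIM('a) * (\<integral>x. (cmod (u x))\<^sup>2 \<partial>lborel))"
    by (simp only:)
  also have "of_real (sqrt (2*pi) ^ DIM('a)) * of_real (sqrt (2*pi) ^ DIM('a) * (\<integral>x. (cmod (u x))\<^sup>2 \<partial>lborel))
    = complex_of_real ((2*pi) ^ DIM('a) * (\<integral>x. (cmod (u x))\<^sup>2 \<partial>lborel))"
    by (simp only: of_real_mult[symmetric] mult.assoc[symmetric] sqrt_2pi_power)
  finally have "(\<lambda>n. integral\<^sup>L lborel (J n)) \<longlonglongrightarrow> (2*pi) ^ DIM('a) * (\<integral>x. (cmod (u x))\<^sup>2 \<partial>lborel)"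
    by (simp only: tendsto_of_real_iff)
  then show ?thesis using 1 LIMSEQ_unique by blast
qed

lemma parallelogram_integral:
  fixes f g :: "'a \<Rightarrow> complex"
  assumes [measurable]: "f \<in> borel_measurable M" "g \<in> borel_measurable M"
    and f: "integrable M (\<lambda>x. (cmod (f x))\<^sup>2)" and g: "integrable M (\<lambda>x. (cmod (g x))\<^sup>2)"
  shows "(\<integral>x. (cmod (f x + g x))\<^sup>2 \<partial>M) + (\<integral>x. (cmod (f x - g x))\<^sup>2 \<partial>M)
     = 2 * (\<integral>x. (cmod (f x))\<^sup>2 \<partial>M) + 2 * (\<integral>x. (cmod (g x))\<^sup>2 \<partial>M)"
proof -
  have p: "(cmod (a + b))\<^sup>2 + (cmod (a - b))\<^sup>2 = 2 * (cmod a)\<^sup>2 + 2 * (cmod b)\<^sup>2" for a b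
    unfolding cmod_power2 by (simp add: power2_eq_square algebra_simps)
  have "(\<integral>x. (cmod (f x + g x))\<^sup>2 \<partial>M) + (\<integral>x. (cmod (f x - g x))\<^sup>2 \<partial>M)
     = (\<integral>x. (cmod (f x + g x))\<^sup>2 + (cmod (f x - g x))\<^sup>2 \<partial>M)"
    using integrable_add_L2[OF assms] by simp
  then show ?thesis unfolding p using f g by simp
qed

text \<open>Only the lower bound is missing. With \<open>h\<close> close to \<open>u\<close>, d = u
  - h and the reflected function m = h - d, the parallelogram law holds before and after
  transforming. Equality for \<open>h\<close>, the upper bound for \<open>m\<close> and
  nonnegativity for \<open>d\<close> bound the squared norm of the transform of \<open>u\<close>
  from below by D |u|^2 - 2 D |d|^2, in terms of squared L2 norms.\<close>

lemma plancherel: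
  fixes u :: "'a::euclidean_space \<Rightarrow> complex"
  assumes u: "integrable lborel u" and u2: "integrable lborel (\<lambda>x. (cmod (u x))\<^sup>2)"
  shows "(\<integral>b. (cmod (fourier u b))\<^sup>2 \<partial>lborel) = (2*pi) ^ DIM('a) * (\<integral>x. (cmod (u x))\<^sup>2 \<partial>lborel)"
proof -
  have um[measurable]: "u \<in> borel_measurable borel" using u by auto
  define D where "D = (2*pi) ^ DIM('a)"
  have D: "D > 0" by (simp add: D_def)
  have "D * (\<integral>x. (cmod (u x))\<^sup>2 \<partial>lborel) \<le> (\<integral>b. (cmod (fourier u b))\<^sup>2 \<partial>lborel) + \<epsilon>" if "\<epsilon> > 0" for \<epsilon>
  proof -
    \<comment> \<open>This size makes the loss 2 D |u - h|^2 of the parallelogram argument at most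
      \<epsilon>.\<close>
    have e: "\<epsilon> / (2*D) > 0" using D that by simp
    obtain h M where h: "continuous_on UNIV h" "\<And>x. cmod (h x) \<le> M" "integrable lborel h"
      "integrable lborel (\<lambda>x. (cmod (h x))\<^sup>2)" and less: "(\<integral>x. (cmod (u x - h x))\<^sup>2 \<partial>lborel) < \<epsilon> / (2*D)"
      by (rule continuous_bounded_dense_L2[OF um u2 e]) blast
    have [measurable]: "h \<in> borel_measurable borel" using h by auto
    define d where "d x = u x - h x" for x
    have di: "integrable lborel d" unfolding d_def using u h by simp
    have d2: "integrable lborel (\<lambda>x. (cmod (d x))\<^sup>2)" unfolding d_def using u2 h by (intro integrable_add_L2(2)) auto
    have [measurable]: "d \<in> borel_measurable borel" using di by auto
    define m where "m x = h x - d x" for x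
    have mi: "integrable lborel m" unfolding m_def using di h by simp
    have m2: "integrable lborel (\<lambda>x. (cmod (m x))\<^sup>2)" unfolding m_def using d2 h by (intro integrable_add_L2(2)) auto
    have hd: "h x + d x = u x" "h x - d x = m x" for x by (simp_all add: d_def m_def)
    have fu: "fourier h b + fourier d b = fourier u b" for b
      using fourier_add(1)[OF h(3) di, of b] by (simp add: hd)
    have fm: "fourier h b - fourier d b = fourier m b" for b
      using fourier_add(2)[OF h(3) di, of b] by (simp add: hd)
    have p1: "(\<integral>x. (cmod (u x))\<^sup>2 \<partial>lborel) + (\<integral>x. (cmod (m x))\<^sup>2 \<partial>lborel) = 2 * (\<integral>x. (cmod (h x))\<^sup>2 \<partial>lborel) + 2 * (\<integral>x. (cmod (d x))\<^sup>2 \<partial>lborel)"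
      using parallelogram_integral[of h lborel d] h d2 by (simp add: hd)
    have p2: "(\<integral>b. (cmod (fourier u b))\<^sup>2 \<partial>lborel) + (\<integral>b. (cmod (fourier m b))\<^sup>2 \<partial>lborel)
       = 2 * (\<integral>b. (cmod (fourier h b))\<^sup>2 \<partial>lborel) + 2 * (\<integral>b. (cmod (fourier d b))\<^sup>2 \<partial>lborel)"
      using parallelogram_integral[of "fourier h" lborel "fourier d"] fourier_L2_bound(1)[OF h(3,4)] fourier_L2_bound(1)[OF di d2]
      by (simp add: fu fm)
    have p3: "(\<integral>b. (cmod (fourier h b))\<^sup>2 \<partial>lborel) = D * (\<integral>x. (cmod (h x))\<^sup>2 \<partial>lborel)"
      unfolding D_def by (rule plancherel_continuous[OF h(3,4,1,2)])
    have p4: "(\<integral>b. (cmod (fourier m b))\<^sup>2 \<partial>lborel) \<le> D * (\<integral>x. (cmod (m x))\<^sup>2 \<partial>lborel)"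
      unfolding D_def by (rule fourier_L2_bound(2)[OF mi m2])
    have p5: "(\<integral>b. (cmod (fourier d b))\<^sup>2 \<partial>lborel) \<ge> 0" by simp
    have p6: "2 * (D * (\<integral>x. (cmod (d x))\<^sup>2 \<partial>lborel)) \<le> \<epsilon>"
      using less D by (simp add: d_def field_simps)
    have p7: "D * (\<integral>x. (cmod (u x))\<^sup>2 \<partial>lborel) + D * (\<integral>x. (cmod (m x))\<^sup>2 \<partial>lborel)
        = 2 * (D * (\<integral>x. (cmod (h x))\<^sup>2 \<partial>lborel)) + 2 * (D * (\<integral>x. (cmod (d x))\<^sup>2 \<partial>lborel))"
      using arg_cong[OF p1, of "\<lambda>t. D * t"] by (simp add: algebra_simps)
    show ?thesis using p2 p3 p4 p5 p6 p7 by linarith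
  qed
  then have "D * (\<integral>x. (cmod (u x))\<^sup>2 \<partial>lborel) \<le> (\<integral>b. (cmod (fourier u b))\<^sup>2 \<partial>lborel)"
    by (rule field_le_epsilon)
  then show ?thesis using fourier_L2_bound(2)[OF u u2] unfolding D_def by (rule antisym[rotated])
qed

section \<open>Lebesgue measure on complex vectors\<close>

definition cpair :: "real^'n \<Rightarrow> real^'n \<Rightarrow> complex^'n" where
  "cpair a b = (\<chi> k. Complex (a$k) (b$k))"

definition cim :: "complex^'n \<Rightarrow> real^'n" where
  "cim \<xi> = (\<chi> k. Im (\<xi>$k))"

lemma cpair_cre_cim [simp]: "cpair (cre \<xi>) (cim \<xi>) = \<xi>"
  by (simp add: cpair_def cre_def cim_def vec_eq_iff)

lemma cre_cpair [simp]: "cre (cpair a b) = a" and cim_cpair [simp]: "cim (cpair a b) = b"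
  by (simp_all add: cpair_def cre_def cim_def vec_eq_iff)

lemma continuous_on_vec_lambda [continuous_intros]:
  fixes f :: "'i::finite \<Rightarrow> 'a::topological_space \<Rightarrow> 'b::real_normed_vector"
  assumes "\<And>k. continuous_on S (f k)"
  shows "continuous_on S (\<lambda>x. \<chi> k. f k x)"
  using assms unfolding continuous_on_def by (auto intro!: vec_tendstoI)

lemma borel_measurable_cre_cim [measurable]:
  "cre \<in> borel_measurable borel" "cim \<in> borel_measurable borel"
  unfolding cre_def cim_def by (intro borel_measurable_continuous_onI continuous_intros)+

lemma borel_measurable_cpair [measurable]: "(\<lambda>z. cpair (fst z) (snd z)) \<in> borel_measurable (borel \<Otimes>\<^sub>M borel)"
proof -
  have "continuous_on UNIV (\<lambda>z::(real^'n)\<times>(real^'n). cpair (fst z) (snd z))"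
    unfolding cpair_def Complex_eq by (intro continuous_intros)
  then show ?thesis unfolding borel_prod by (rule borel_measurable_continuous_onI)
qed

lemma borel_measurable_cpair' [measurable (raw)]:
  assumes [measurable]: "f \<in> borel_measurable M" "g \<in> borel_measurable M"
  shows "(\<lambda>x. cpair (f x) (g x)) \<in> borel_measurable M"
  using measurable_compose[OF _ borel_measurable_cpair, of "\<lambda>x. (f x, g x)" M] by simp

lemma sum_prod_Basis_real_vec:
  "(\<Sum>b\<in>(Basis::(real^'n) set). F b) = (\<Sum>k\<in>UNIV. F (axis k 1))"
  "(\<Prod>b\<in>(Basis::(real^'n) set). G b) = (\<Prod>k\<in>UNIV. G (axis k 1))"
proof -
  have B: "(Basis::(real^'n) set) = (\<lambda>k. axis k 1) ` UNIV" by (auto simp: Basis_vec_def)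
  have i: "inj (\<lambda>k::'n. axis k (1::real))" by (auto simp: inj_def axis_eq_axis)
  show "(\<Sum>b\<in>(Basis::(real^'n) set). F b) = (\<Sum>k\<in>UNIV. F (axis k 1))"
    unfolding B by (subst sum.reindex[OF i]) simp
  show "(\<Prod>b\<in>(Basis::(real^'n) set). G b) = (\<Prod>k\<in>UNIV. G (axis k 1))"
    unfolding B by (subst prod.reindex[OF i]) simp
qed

lemma prod_Basis_complex_vec:
  "(\<Prod>b\<in>(Basis::(complex^'n) set). G b) = (\<Prod>k\<in>UNIV. G (axis k 1) * G (axis k \<i>))"
proof -
  have B: "(Basis::(complex^'n) set) = (\<lambda>k. axis k 1) ` UNIV \<union> (\<lambda>k. axis k \<i>) ` UNIV"
    by (auto simp: Basis_vec_def Basis_complex_def)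
  have i: "inj (\<lambda>k::'n. axis k (1::complex))" "inj (\<lambda>k::'n. axis k \<i>)" by (auto simp: inj_def axis_eq_axis)
  show ?thesis unfolding B
    by (subst prod.union_disjoint) (auto simp: axis_eq_axis prod.reindex[OF i(1)] prod.reindex[OF i(2)] prod.distrib)
qed

lemma mem_box_complex_vec:
  fixes l u x :: "complex^'n"
  shows "x \<in> box l u \<longleftrightarrow> cre x \<in> box (cre l) (cre u) \<and> cim x \<in> box (cim l) (cim u)"
proof -
  have B: "(Basis::(complex^'n) set) = (\<lambda>k. axis k 1) ` UNIV \<union> (\<lambda>k. axis k \<i>) ` UNIV"
    by (auto simp: Basis_vec_def Basis_complex_def)
  show ?thesis
    unfolding mem_box_cart mem_box[of x] B ball_Un ball_simps
    by (auto simp: inner_axis inner_complex_def cre_def cim_def)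
qed

text \<open>Lebesgue measure is determined by its values on boxes, and a complex box is the product
  of a box of real parts and a box of imaginary parts.\<close>

lemma lborel_complex_vec:
  "distr (lborel \<Otimes>\<^sub>M lborel) borel (\<lambda>z. cpair (fst z) (snd z)) = (lborel :: (complex^'n) measure)"
proof (rule lborel_eqI[symmetric])
  fix l u :: "complex^'n"
  assume le: "\<And>b. b \<in> Basis \<Longrightarrow> l \<bullet> b \<le> u \<bullet> b"
  have le1: "Re (l$k) \<le> Re (u$k)" "Im (l$k) \<le> Im (u$k)" for k
    using le[of "axis k 1"] le[of "axis k \<i>"]
    by (simp_all add: axis_in_Basis_iff Basis_complex_def inner_axis inner_complex_def)
  have vim: "(\<lambda>z. cpair (fst z) (snd z)) -` box l u \<inter> space (lborel \<Otimes>\<^sub>M lborel) = box (cre l) (cre u) \<times> box (cim l) (cim u)"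
    by (auto simp: mem_box_complex_vec space_pair_measure)
  have e1: "emeasure lborel (box (cre l) (cre u)) = (\<Prod>k\<in>UNIV. Re (u$k) - Re (l$k))"
    and e2: "emeasure lborel (box (cim l) (cim u)) = (\<Prod>k\<in>UNIV. Im (u$k) - Im (l$k))"
  proof -
    have B: "b \<in> (Basis :: (real^'n) set) \<Longrightarrow> \<exists>k. b = axis k 1" for b by (auto simp: Basis_vec_def)
    have "emeasure lborel (box (cre l) (cre u)) = (\<Prod>b\<in>Basis. (cre u - cre l) \<bullet> b)"
      by (rule emeasure_lborel_box) (use B le1 in \<open>force simp: inner_axis cre_def\<close>)
    then show "emeasure lborel (box (cre l) (cre u)) = (\<Prod>k\<in>UNIV. Re (u$k) - Re (l$k))"
      by (simp add: sum_prod_Basis_real_vec inner_axis cre_def)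
    have "emeasure lborel (box (cim l) (cim u)) = (\<Prod>b\<in>Basis. (cim u - cim l) \<bullet> b)"
      by (rule emeasure_lborel_box) (use B le1 in \<open>force simp: inner_axis cim_def\<close>)
    then show "emeasure lborel (box (cim l) (cim u)) = (\<Prod>k\<in>UNIV. Im (u$k) - Im (l$k))"
      by (simp add: sum_prod_Basis_real_vec inner_axis cim_def)
  qed
  have "emeasure (distr (lborel \<Otimes>\<^sub>M lborel) borel (\<lambda>z. cpair (fst z) (snd z))) (box l u)
    = emeasure (lborel \<Otimes>\<^sub>M lborel) (box (cre l) (cre u) \<times> box (cim l) (cim u))"
    by (subst emeasure_distr) (auto simp: vim)
  also have "\<dots> = (\<Prod>k\<in>UNIV. Re (u$k) - Re (l$k)) * (\<Prod>k\<in>UNIV. Im (u$k) - Im (l$k))"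
    by (subst lborel.emeasure_pair_measure_Times) (auto simp: e1 e2 ennreal_mult' prod_nonneg le1)
  also have "\<dots> = (\<Prod>b\<in>Basis. (u - l) \<bullet> b)"
    by (simp add: prod_Basis_complex_vec inner_axis inner_complex_def prod.distrib)
  finally show "emeasure (distr (lborel \<Otimes>\<^sub>M lborel) borel (\<lambda>z. cpair (fst z) (snd z))) (box l u) = (\<Prod>b\<in>Basis. (u - l) \<bullet> b)" .
qed simp

text \<open>Both orders are needed: a shear moves the real parts for fixed imaginary parts or
  conversely, and the moved variable has to be the inner one.\<close>

lemma nn_integral_complex_vec:
  fixes F :: "complex^'n \<Rightarrow> ennreal"
  assumes [measurable]: "F \<in> borel_measurable borel"
  shows "(\<integral>\<^sup>+\<xi>. F \<xi> \<partial>lborel) = (\<integral>\<^sup>+a. \<integral>\<^sup>+b. F (cpair a b) \<partial>lborel \<partial>lborel)"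
    and "(\<integral>\<^sup>+\<xi>. F \<xi> \<partial>lborel) = (\<integral>\<^sup>+b. \<integral>\<^sup>+a. F (cpair a b) \<partial>lborel \<partial>lborel)"
proof -
  have "(\<integral>\<^sup>+\<xi>. F \<xi> \<partial>lborel) = (\<integral>\<^sup>+z. F (cpair (fst z) (snd z)) \<partial>(lborel \<Otimes>\<^sub>M lborel))"
    by (subst lborel_complex_vec[symmetric], subst nn_integral_distr) auto
  also have "\<dots> = (\<integral>\<^sup>+a. \<integral>\<^sup>+b. F (cpair a b) \<partial>lborel \<partial>lborel)"
    by (subst lborel.nn_integral_fst[symmetric]) auto
  finally show 1: "(\<integral>\<^sup>+\<xi>. F \<xi> \<partial>lborel) = (\<integral>\<^sup>+a. \<integral>\<^sup>+b. F (cpair a b) \<partial>lborel \<partial>lborel)" .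
  have "(\<lambda>(a, b). F (cpair a b)) \<in> borel_measurable (lborel \<Otimes>\<^sub>M lborel)" by measurable
  from lborel_pair.Fubini'[OF this] show "(\<integral>\<^sup>+\<xi>. F \<xi> \<partial>lborel) = (\<integral>\<^sup>+b. \<integral>\<^sup>+a. F (cpair a b) \<partial>lborel \<partial>lborel)"
    unfolding 1 by simp
qed

section \<open>Invariance of Lebesgue measure under unimodular scalars\<close>

lemma cscale_cpair: "\<mu> *s cpair a b = cpair (Re \<mu> *\<^sub>R a - Im \<mu> *\<^sub>R b) (Im \<mu> *\<^sub>R a + Re \<mu> *\<^sub>R b)"
  by (simp add: cpair_def vec_eq_iff complex_eq_iff)

lemma continuous_on_cscale: "continuous_on UNIV (\<lambda>\<xi>::complex^'n. \<mu> *s \<xi>)"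
  unfolding vector_scalar_mult_def by (intro continuous_intros)

lemma borel_measurable_cscale [measurable]: "(\<lambda>\<xi>::complex^'n. \<mu> *s \<xi>) \<in> borel_measurable borel"
  by (rule borel_measurable_continuous_onI[OF continuous_on_cscale])

text \<open>A rotation that is not real is a product of three shears, each of which preserves Lebesgue
  measure by translation invariance along the fibres.\<close>

lemma nn_integral_rotate:
  fixes F :: "complex^'n \<Rightarrow> ennreal"
  assumes [measurable]: "F \<in> borel_measurable borel" and "cmod \<mu> = 1"
  shows "(\<integral>\<^sup>+\<xi>. F (\<mu> *s \<xi>) \<partial>lborel) = (\<integral>\<^sup>+\<xi>. F \<xi> \<partial>lborel)"
proof -
  define c s where "c = Re \<mu>" and "s = Im \<mu>"
  have cs: "c\<^sup>2 + s\<^sup>2 = 1" using assms(2) by (simp add: c_def s_def cmod_def)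
  show ?thesis
  \<comment> \<open>The shear parameter has \<open>s\<close> in its denominator, so \<mu> = 1 and
    \<mu> = -1 are treated as real scalings.\<close>
  proof (cases "s = 0")
    case True
    then have ac: "\<bar>c\<bar> = 1" using cs by (simp add: power2_eq_1_iff abs_if) (auto simp: power2_eq_1_iff)
    have "\<mu> *s \<xi> = c *\<^sub>R \<xi>" for \<xi> :: "complex^'n"
      using True by (simp add: vec_eq_iff complex_eq_iff c_def s_def)
    then show ?thesis using lborel_nn_integral_affine[of c F 0] ac by auto
  next
    case False
    \<comment> \<open>For \<mu> = cos \<theta> + i sin \<theta> this is - tan (\<theta>/2), the
      parameter of the two outer shears; the middle one has parameter sin \<theta>.
      \<open>st\<close> and \<open>tc\<close> are the relations that make the product of the three
      the rotation.\<close>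
    define t where "t = (c - 1) / s"
    have st: "1 + s * t = c" using False by (simp add: t_def)
    have tc: "t * (1 + c) = - s"
    proof -
      have "(c - 1) * (1 + c) = - s * s" using cs by (simp add: power2_eq_square algebra_simps)
      then show ?thesis using False by (simp add: t_def field_simps)
    qed
    have sh1: "(\<integral>\<^sup>+\<xi>. G (cpair (cre \<xi> + r *\<^sub>R cim \<xi>) (cim \<xi>)) \<partial>lborel) = (\<integral>\<^sup>+\<xi>. G \<xi> \<partial>lborel)"
      and sh2: "(\<integral>\<^sup>+\<xi>. G (cpair (cre \<xi>) (cim \<xi> + r *\<^sub>R cre \<xi>)) \<partial>lborel) = (\<integral>\<^sup>+\<xi>. G \<xi> \<partial>lborel)"
      if [measurable]: "G \<in> borel_measurable borel" for G :: "complex^'n \<Rightarrow> ennreal" and r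
    proof -
      have "(\<integral>\<^sup>+a. G (cpair (a + r *\<^sub>R b) b) \<partial>lborel) = (\<integral>\<^sup>+a. G (cpair a b) \<partial>lborel)" for b
        using lborel_nn_integral_shift[of "\<lambda>a. G (cpair a b)" "r *\<^sub>R b"] by (simp add: add.commute)
      then show "(\<integral>\<^sup>+\<xi>. G (cpair (cre \<xi> + r *\<^sub>R cim \<xi>) (cim \<xi>)) \<partial>lborel) = (\<integral>\<^sup>+\<xi>. G \<xi> \<partial>lborel)"
        by (subst (1 2) nn_integral_complex_vec(2)) simp_all
      have "(\<integral>\<^sup>+b. G (cpair a (b + r *\<^sub>R a)) \<partial>lborel) = (\<integral>\<^sup>+b. G (cpair a b) \<partial>lborel)" for a
        using lborel_nn_integral_shift[of "\<lambda>b. G (cpair a b)" "r *\<^sub>R a"] by (simp add: add.commute)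
      then show "(\<integral>\<^sup>+\<xi>. G (cpair (cre \<xi>) (cim \<xi> + r *\<^sub>R cre \<xi>)) \<partial>lborel) = (\<integral>\<^sup>+\<xi>. G \<xi> \<partial>lborel)"
        by (subst (1 2) nn_integral_complex_vec(1)) simp_all
    qed
    define S1 where "S1 \<xi> = cpair (cre \<xi> + t *\<^sub>R cim \<xi>) (cim \<xi>)" for \<xi> :: "complex^'n"
    define S2 where "S2 \<xi> = cpair (cre \<xi>) (cim \<xi> + s *\<^sub>R cre \<xi>)" for \<xi> :: "complex^'n"
    have [measurable]: "S1 \<in> borel_measurable borel" "S2 \<in> borel_measurable borel"
      unfolding S1_def S2_def by measurable
    have rot: "S1 (S2 (S1 \<xi>)) = \<mu> *s \<xi>" for \<xi>
    proof -
      define a b where "a = cre \<xi>" and "b = cim \<xi>"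
      have \<xi>: "\<xi> = cpair a b" by (simp add: a_def b_def)
      have "b + s *\<^sub>R (a + t *\<^sub>R b) = s *\<^sub>R a + c *\<^sub>R b"
        unfolding st[symmetric] by (simp add: algebra_simps)
      moreover have "(a + t *\<^sub>R b) + t *\<^sub>R (s *\<^sub>R a + c *\<^sub>R b) = (1 + s * t) *\<^sub>R a + (t * (1 + c)) *\<^sub>R b"
        by (simp add: algebra_simps)
      ultimately show ?thesis
        unfolding \<xi> S1_def S2_def cscale_cpair by (simp add: st tc c_def[symmetric] s_def[symmetric])
    qed
    have "(\<integral>\<^sup>+\<xi>. F (\<mu> *s \<xi>) \<partial>lborel) = (\<integral>\<^sup>+\<xi>. F (S1 (S2 (S1 \<xi>))) \<partial>lborel)" by (simp add: rot)
    also have "\<dots> = (\<integral>\<^sup>+\<xi>. F (S1 (S2 \<xi>)) \<partial>lborel)"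
      using sh1[of "\<lambda>\<xi>. F (S1 (S2 \<xi>))" t] by (simp add: S1_def[symmetric])
    also have "\<dots> = (\<integral>\<^sup>+\<xi>. F (S1 \<xi>) \<partial>lborel)"
      using sh2[of "\<lambda>\<xi>. F (S1 \<xi>)" s] by (simp add: S2_def[symmetric])
    also have "\<dots> = (\<integral>\<^sup>+\<xi>. F \<xi> \<partial>lborel)"
      using sh1[of F t] by (simp add: S1_def[symmetric])
    finally show ?thesis .
  qed
qed

lemma lborel_distr_rotate:
  assumes "cmod \<mu> = 1"
  shows "distr lborel borel (\<lambda>\<xi>. \<mu> *s \<xi>) = (lborel :: (complex^'n) measure)"
proof (rule measure_eqI)
  fix A assume "A \<in> sets (distr lborel borel (\<lambda>\<xi>::complex^'n. \<mu> *s \<xi>))"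
  then have [measurable]: "A \<in> sets borel" by simp
  have "emeasure (distr lborel borel (\<lambda>\<xi>. \<mu> *s \<xi>)) A = (\<integral>\<^sup>+\<xi>. indicator A \<xi> \<partial>distr lborel borel (\<lambda>\<xi>. \<mu> *s \<xi>))"
    by simp
  also have "\<dots> = (\<integral>\<^sup>+\<xi>. indicator A (\<mu> *s \<xi>) \<partial>lborel)"
    by (rule nn_integral_distr) measurable
  also have "\<dots> = (\<integral>\<^sup>+\<xi>. indicator A \<xi> \<partial>lborel)"
    by (rule nn_integral_rotate[OF _ assms]) measurable
  finally show "emeasure (distr lborel borel (\<lambda>\<xi>. \<mu> *s \<xi>)) A = emeasure lborel A" by simp
qed simp

lemma integral_rotate:
  fixes F :: "complex^'n \<Rightarrow> complex"
  assumes [measurable]: "F \<in> borel_measurable borel" and l: "cmod \<mu> = 1"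
  shows "(\<integral>\<xi>. F (\<mu> *s \<xi>) \<partial>lborel) = (\<integral>\<xi>. F \<xi> \<partial>lborel)"
    and "integrable lborel (\<lambda>\<xi>. F (\<mu> *s \<xi>)) \<longleftrightarrow> integrable lborel F"
proof -
  have m: "(\<lambda>\<xi>::complex^'n. \<mu> *s \<xi>) \<in> measurable lborel borel" by measurable
  show "(\<integral>\<xi>. F (\<mu> *s \<xi>) \<partial>lborel) = (\<integral>\<xi>. F \<xi> \<partial>lborel)"
    using integral_distr[OF m assms(1)] by (simp add: lborel_distr_rotate[OF l])
  show "integrable lborel (\<lambda>\<xi>. F (\<mu> *s \<xi>)) \<longleftrightarrow> integrable lborel F"
    using integrable_distr_eq[OF m assms(1)] by (simp add: lborel_distr_rotate[OF l])
qed

section \<open>Norms and pairings of complex vectors\<close>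

lemma norm_cpair: "(norm (cpair a b))\<^sup>2 = (norm a)\<^sup>2 + (norm b)\<^sup>2"
  by (simp add: norm_vec_def L2_set_def cpair_def sum_nonneg cmod_power2 sum.distrib)

lemma csq_cpair: "csq (cpair a b) = of_real ((norm a)\<^sup>2 - (norm b)\<^sup>2) + \<i> * of_real (2 * (a \<bullet> b))"
  by (simp add: csq_def cpair_def complex_eq_iff norm_vec_def L2_set_def sum_nonneg inner_vec_def
      sum_subtractf power2_eq_square sum_distrib_left algebra_simps)

lemma cdot_cpair_cvec: "cdot (cpair a b) (cvec x) = of_real (a \<bullet> x) + \<i> * of_real (b \<bullet> x)"
  by (simp add: cdot_def cpair_def cvec_def complex_eq_iff inner_vec_def)

lemma linear_cdot_cvec: "linear (\<lambda>x. cdot \<xi> (cvec x))"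
  by (rule linearI)
     (simp_all add: cdot_def cvec_def algebra_simps sum.distrib sum_distrib_left scaleR_conv_of_real[where 'a=complex])

lemma norm_cdot_le: "cmod (cdot \<xi> \<eta>) \<le> norm \<xi> * norm \<eta>"
proof -
  have "cmod (cdot \<xi> \<eta>) \<le> (\<Sum>k\<in>UNIV. \<bar>cmod (\<xi>$k)\<bar> * \<bar>cmod (\<eta>$k)\<bar>)"
    unfolding cdot_def by (rule order_trans[OF norm_sum]) (simp add: norm_mult)
  also have "\<dots> \<le> norm \<xi> * norm \<eta>" unfolding norm_vec_def by (rule L2_set_mult_ineq)
  finally show ?thesis .
qed

lemma norm_cvec [simp]: "norm (cvec x) = norm x"
  by (simp add: norm_vec_def cvec_def)

lemma cdot_self: "cdot \<xi> \<xi> = of_real ((norm \<xi>)\<^sup>2)"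
  by (simp add: cdot_def norm_vec_def L2_set_def sum_nonneg complex_norm_square[symmetric])

lemma cnj_cdot: "cnj (cdot \<xi> \<eta>) = cdot \<eta> \<xi>"
  by (simp add: cdot_def mult.commute)

lemma cdot_add: "cdot (\<xi> + \<zeta>) \<eta> = cdot \<xi> \<eta> + cdot \<zeta> \<eta>" "cdot \<xi> (\<eta> + \<zeta>) = cdot \<xi> \<eta> + cdot \<xi> \<zeta>"
  by (simp_all add: cdot_def algebra_simps sum.distrib)

lemma cdot_cscale: "cdot (c *s \<xi>) \<eta> = c * cdot \<xi> \<eta>"
  by (simp add: cdot_def sum_distrib_left mult.assoc)

section \<open>Entire functions of several variables\<close>

lemma entire_mdE:
  assumes "entire_md f"
  obtains L where "(f has_derivative L) (at z)" "\<And>c w. L (c *s w) = c * L w"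
  using assms unfolding entire_md_def by blast

lemma entire_mdI:
  assumes "\<And>z. (f has_derivative L z) (at z)" "\<And>z c w. L z (c *s w) = c * L z w"
  shows "entire_md f"
  using assms unfolding entire_md_def by blast

lemma entire_md_continuous: "entire_md f \<Longrightarrow> continuous_on UNIV f"
  by (metis entire_md_def has_derivative_continuous continuous_at_imp_continuous_on)

lemma entire_md_measurable: "entire_md f \<Longrightarrow> f \<in> borel_measurable borel"
  by (intro borel_measurable_continuous_onI entire_md_continuous)

lemma entire_md_const: "entire_md (\<lambda>_. c)"
  by (rule entire_mdI[where L="\<lambda>_ _. 0"]) auto

lemma entire_md_linear:
  assumes "linear f" "\<And>c w. f (c *s w) = c * f w"
  shows "entire_md f"
  by (rule entire_mdI[where L="\<lambda>_. f"]) (use assms in \<open>auto intro: linear_imp_has_derivative\<close>)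

lemma entire_md_add:
  assumes "entire_md f" "entire_md g"
  shows "entire_md (\<lambda>\<xi>. f \<xi> + g \<xi>)"
  unfolding entire_md_def
proof
  fix z
  from entire_mdE[OF assms(1)] obtain L where L: "(f has_derivative L) (at z)" "\<And>c w. L (c *s w) = c * L w" by metis
  from entire_mdE[OF assms(2)] obtain M where M: "(g has_derivative M) (at z)" "\<And>c w. M (c *s w) = c * M w" by metis
  show "\<exists>L. ((\<lambda>\<xi>. f \<xi> + g \<xi>) has_derivative L) (at z) \<and> (\<forall>c w. L (c *s w) = c * L w)"
    by (rule exI[of _ "\<lambda>h. L h + M h"]) (use L M in \<open>auto intro: has_derivative_add simp: algebra_simps\<close>)
qed

lemma entire_md_mult:
  assumes "entire_md f" "entire_md g"
  shows "entire_md (\<lambda>\<xi>. f \<xi> * g \<xi>)"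
  unfolding entire_md_def
proof
  fix z
  from entire_mdE[OF assms(1)] obtain L where L: "(f has_derivative L) (at z)" "\<And>c w. L (c *s w) = c * L w" by metis
  from entire_mdE[OF assms(2)] obtain M where M: "(g has_derivative M) (at z)" "\<And>c w. M (c *s w) = c * M w" by metis
  show "\<exists>L. ((\<lambda>\<xi>. f \<xi> * g \<xi>) has_derivative L) (at z) \<and> (\<forall>c w. L (c *s w) = c * L w)"
    by (rule exI[of _ "\<lambda>h. f z * M h + L h * g z"])
       (use L(2) M(2) has_derivative_mult[OF L(1) M(1)] in \<open>auto simp: algebra_simps\<close>)
qed

lemma entire_md_exp:
  assumes "entire_md f"
  shows "entire_md (\<lambda>\<xi>. exp (f \<xi>))"
  unfolding entire_md_def
proof
  fix z
  from entire_mdE[OF assms] obtain L where L: "(f has_derivative L) (at z)" "\<And>c w. L (c *s w) = c * L w" by metis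
  have "(exp has_derivative (*) (exp (f z))) (at (f z))"
    using DERIV_exp[of "f z"] by (simp add: has_field_derivative_def)
  from has_derivative_compose[OF L(1) this]
  show "\<exists>L. ((\<lambda>\<xi>. exp (f \<xi>)) has_derivative L) (at z) \<and> (\<forall>c w. L (c *s w) = c * L w)"
    by (rule_tac exI[of _ "\<lambda>h. exp (f z) * L h"]) (use L(2) in auto)
qed

lemma entire_md_translate:
  assumes "entire_md f"
  shows "entire_md (\<lambda>\<xi>. f (\<xi> + \<eta>))"
  unfolding entire_md_def
proof
  fix z
  from entire_mdE[OF assms] obtain L where L: "(f has_derivative L) (at (z + \<eta>))" "\<And>c w. L (c *s w) = c * L w" by metis
  have "((\<lambda>\<xi>. \<xi> + \<eta>) has_derivative (\<lambda>h. h)) (at z)" by (auto intro!: derivative_eq_intros)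
  from has_derivative_compose[OF this L(1)]
  show "\<exists>L. ((\<lambda>\<xi>. f (\<xi> + \<eta>)) has_derivative L) (at z) \<and> (\<forall>c w. L (c *s w) = c * L w)"
    using L(2) by blast
qed

lemma entire_md_cdot: "entire_md (\<lambda>\<xi>. cdot \<xi> \<eta>)"
proof (rule entire_md_linear)
  show "linear (\<lambda>\<xi>. cdot \<xi> \<eta>)"
    by (rule linearI, rule cdot_add(1)) (simp add: cdot_def scaleR_sum_right)
qed (simp add: cdot_cscale)

lemma entire_md_sum:
  assumes "\<And>k. k \<in> S \<Longrightarrow> entire_md (f k)"
  shows "entire_md (\<lambda>\<xi>. \<Sum>k\<in>S. f k \<xi>)"
proof (cases "finite S")
  case True
  then show ?thesis using assms
    by (induction S rule: finite_induct) (auto intro: entire_md_const entire_md_add)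
qed (simp add: entire_md_const)

lemma entire_md_csq: "entire_md csq"
proof -
  have "entire_md (\<lambda>\<xi>::complex^'n. \<xi>$k)" for k
    by (rule entire_md_linear) (auto intro: linearI)
  then have "entire_md (\<lambda>\<xi>::complex^'n. \<Sum>k\<in>UNIV. \<xi>$k * \<xi>$k)"
    by (intro entire_md_sum entire_md_mult)
  then show ?thesis by (simp add: csq_def[abs_def] power2_eq_square)
qed

text \<open>Finite exponential moments allow differentiation under the integral. The derivative at
  \<xi> inserts the factor \<open>cdot \<zeta> (cvec x)\<close>, which is complex linear in \<zeta>;
  the powers of |x| that Taylor's formula produces are absorbed by raising the order of the moment
  by 1 or 2.\<close>

lemma entire_md_laplace:
  fixes h :: "real^'n \<Rightarrow> complex"
  assumes h: "\<And>R. integrable lborel (\<lambda>x. h x * of_real (exp (R * norm x)))"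
  shows "entire_md (\<lambda>\<xi>. \<integral>x. h x * exp (cdot \<xi> (cvec x)) \<partial>lborel)"
proof -
  have [measurable]: "h \<in> borel_measurable borel" using h[of 0] by auto
  have [measurable]: "(\<lambda>x::real^'n. cdot \<xi> (cvec x)) \<in> borel_measurable borel" for \<xi>
    by (rule borel_measurable_linear[OF linear_cdot_cvec])
  have hn: "integrable lborel (\<lambda>x. cmod (h x) * exp (R * norm x))" for R
    using integrable_norm[OF h[of R]] by (simp add: norm_mult)
  have cd: "cmod (cdot \<xi> (cvec x)) \<le> norm \<xi> * norm x" for \<xi> and x :: "real^'n"
    using norm_cdot_le[of \<xi> "cvec x"] by simp
  have ex: "cmod (exp (cdot \<xi> (cvec x))) \<le> exp (norm \<xi> * norm x)" for \<xi> and x :: "real^'n"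
    using cd[of \<xi> x] complex_Re_le_cmod[of "cdot \<xi> (cvec x)"] by simp
  have n1: "norm x \<le> exp (norm x)" for x :: "real^'n" using exp_ge_add_one_self[of "norm x"] by linarith
  have n2: "(norm x)\<^sup>2 \<le> 2 * exp (norm x)" for x :: "real^'n"
    using exp_lower_Taylor_quadratic[of "norm x"] norm_ge_zero[of x] by linarith
  define E where "E \<xi> x = h x * exp (cdot \<xi> (cvec x))" for \<xi> x
  have [measurable]: "E \<xi> \<in> borel_measurable borel" for \<xi> unfolding E_def by measurable
  have En: "cmod (E \<xi> x) \<le> cmod (h x) * exp (norm \<xi> * norm x)" for \<xi> x
    unfolding E_def norm_mult by (intro mult_left_mono ex) auto
  have Ei: "integrable lborel (E \<xi>)" for \<xi>
    by (rule Bochner_Integration.integrable_bound[OF hn[of "norm \<xi>"]]) (use En in auto)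
  define C where "C R = (\<integral>x. cmod (h x) * exp (R * norm x) \<partial>lborel)" for R
  have Dn: "cmod (E \<xi> x * cdot \<zeta> (cvec x)) \<le> norm \<zeta> * (cmod (h x) * exp ((norm \<xi> + 1) * norm x))" for \<xi> \<zeta> x
  proof -
    have "cmod (E \<xi> x * cdot \<zeta> (cvec x)) \<le> (cmod (h x) * exp (norm \<xi> * norm x)) * (norm \<zeta> * exp (norm x))"
      unfolding norm_mult[of "E \<xi> x"]
      using En[of \<xi> x] cd[of \<zeta> x] mult_left_mono[OF n1[of x], of "norm \<zeta>"] by (intro mult_mono) auto
    also have "\<dots> = norm \<zeta> * (cmod (h x) * exp ((norm \<xi> + 1) * norm x))"
      by (simp add: algebra_simps exp_add)
    finally show ?thesis .
  qed
  have Di: "integrable lborel (\<lambda>x. E \<xi> x * cdot \<zeta> (cvec x))" for \<xi> \<zeta>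
    by (rule Bochner_Integration.integrable_bound[OF integrable_mult_right[OF hn[of "norm \<xi> + 1"], of "norm \<zeta>"]])
       (use Dn in auto)
  define D where "D \<xi> \<zeta> = (\<integral>x. E \<xi> x * cdot \<zeta> (cvec x) \<partial>lborel)" for \<xi> \<zeta>
  have Dlin: "bounded_linear (D \<xi>)" for \<xi>
  proof (rule bounded_linear_intro[where K="C (norm \<xi> + 1)"])
    show "D \<xi> (\<zeta> + \<zeta>') = D \<xi> \<zeta> + D \<xi> \<zeta>'" for \<zeta> \<zeta>'
      using Di[of \<xi> \<zeta>] Di[of \<xi> \<zeta>'] by (simp add: D_def cdot_add ring_distribs)
    show "D \<xi> (r *\<^sub>R \<zeta>) = r *\<^sub>R D \<xi> \<zeta>" for r \<zeta>
    proof -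
      have "cdot (r *\<^sub>R \<zeta>) (cvec x) = r *\<^sub>R cdot \<zeta> (cvec x)" for x
        by (simp add: cdot_def scaleR_sum_right)
      then show ?thesis by (simp add: D_def)
    qed
    show "norm (D \<xi> \<zeta>) \<le> norm \<zeta> * C (norm \<xi> + 1)" for \<zeta>
    proof -
      have "norm (D \<xi> \<zeta>) \<le> (\<integral>x. norm \<zeta> * (cmod (h x) * exp ((norm \<xi> + 1) * norm x)) \<partial>lborel)"
        unfolding D_def by (rule order_trans[OF integral_norm_bound integral_mono])
          (use Di Dn hn in auto)
      then show ?thesis by (simp add: C_def)
    qed
  qed
  \<comment> \<open>One factor exp |x| bounds exp |Re z|, for which |\<zeta>| \<le> 1 is required,
    and a second one bounds |x|^2 up to the factor 2; together they turn the moment of order |\<xi>|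
    into the one of order |\<xi>| + 2.\<close>
  have rem: "cmod ((\<integral>x. E (\<xi> + \<zeta>) x \<partial>lborel) - (\<integral>x. E \<xi> x \<partial>lborel) - D \<xi> \<zeta>) \<le> 2 * C (norm \<xi> + 2) * (norm \<zeta>)\<^sup>2"
    if "norm \<zeta> \<le> 1" for \<xi> \<zeta>
  proof -
    have pt: "cmod (E (\<xi> + \<zeta>) x - E \<xi> x - E \<xi> x * cdot \<zeta> (cvec x)) \<le> 2 * (norm \<zeta>)\<^sup>2 * (cmod (h x) * exp ((norm \<xi> + 2) * norm x))" for x
    proof -
      define z where "z = cdot \<zeta> (cvec x)"
      have z: "cmod z \<le> norm \<zeta> * norm x" unfolding z_def by (rule cd)
      then have "cmod z \<le> norm x" using that mult_right_mono[OF that, of "norm x"] by simp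
      then have rz: "\<bar>Re z\<bar> \<le> norm x" using abs_Re_le_cmod[of z] by linarith
      have "cmod (exp z - (1 + z)) \<le> exp \<bar>Re z\<bar> * (cmod z)\<^sup>2"
        using Taylor_exp[of z 1] by (simp add: numeral_2_eq_2)
      also have "\<dots> \<le> exp (norm x) * ((norm \<zeta>)\<^sup>2 * (2 * exp (norm x)))"
      proof (intro mult_mono)
        have "(cmod z)\<^sup>2 \<le> (norm \<zeta> * norm x)\<^sup>2" using z by (intro power_mono) auto
        also have "\<dots> \<le> (norm \<zeta>)\<^sup>2 * (2 * exp (norm x))"
          unfolding power_mult_distrib by (intro mult_left_mono n2) auto
        finally show "(cmod z)\<^sup>2 \<le> (norm \<zeta>)\<^sup>2 * (2 * exp (norm x))" .
      qed (use rz in auto)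
      finally have tz: "cmod (exp z - (1 + z)) \<le> exp (norm x) * ((norm \<zeta>)\<^sup>2 * (2 * exp (norm x)))" .
      have "E (\<xi> + \<zeta>) x - E \<xi> x - E \<xi> x * cdot \<zeta> (cvec x) = E \<xi> x * (exp z - (1 + z))"
        by (simp add: E_def z_def cdot_add exp_add algebra_simps)
      then have "cmod (E (\<xi> + \<zeta>) x - E \<xi> x - E \<xi> x * cdot \<zeta> (cvec x)) = cmod (E \<xi> x) * cmod (exp z - (1 + z))"
        by (simp add: norm_mult)
      also have "\<dots> \<le> (cmod (h x) * exp (norm \<xi> * norm x)) * (exp (norm x) * ((norm \<zeta>)\<^sup>2 * (2 * exp (norm x))))"
        using En[of \<xi> x] tz by (intro mult_mono) auto
      also have "\<dots> = 2 * (norm \<zeta>)\<^sup>2 * (cmod (h x) * exp ((norm \<xi> + 2) * norm x))"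
      proof -
        have "exp ((norm \<xi> + 2) * norm x) = exp (norm \<xi> * norm x) * exp (norm x) * exp (norm x)"
          unfolding exp_add[symmetric] by (simp add: algebra_simps)
        then show ?thesis by (simp only: mult_ac)
      qed
      finally show ?thesis .
    qed
    have "(\<integral>x. E (\<xi> + \<zeta>) x \<partial>lborel) - (\<integral>x. E \<xi> x \<partial>lborel) - D \<xi> \<zeta> = (\<integral>x. E (\<xi> + \<zeta>) x - E \<xi> x - E \<xi> x * cdot \<zeta> (cvec x) \<partial>lborel)"
      unfolding D_def using Ei[of "\<xi> + \<zeta>"] Ei[of \<xi>] Di[of \<xi> \<zeta>] by simp
    also have "cmod \<dots> \<le> (\<integral>x. 2 * (norm \<zeta>)\<^sup>2 * (cmod (h x) * exp ((norm \<xi> + 2) * norm x)) \<partial>lborel)"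
      by (rule order_trans[OF integral_norm_bound integral_mono])
         (use Ei Di pt hn in auto)
    also have "\<dots> = 2 * C (norm \<xi> + 2) * (norm \<zeta>)\<^sup>2" by (simp add: C_def)
    finally show ?thesis .
  qed
  have C0: "C R \<ge> 0" for R unfolding C_def by simp
  have "((\<lambda>\<xi>. \<integral>x. E \<xi> x \<partial>lborel) has_derivative D \<xi>) (at \<xi>)" for \<xi>
    unfolding has_derivative_at_alt
  proof (intro conjI Dlin allI impI)
    fix e :: real assume e: "e > 0"
    \<comment> \<open>The summand 1 keeps \<open>K\<close> positive even if the moment is 0.\<close>
    define K where "K = 2 * C (norm \<xi> + 2) + 1"
    have K: "K > 0" using C0[of "norm \<xi> + 2"] by (simp add: K_def)
    show "\<exists>d>0. \<forall>y. norm (y - \<xi>) < d \<longrightarrow> norm ((\<integral>x. E y x \<partial>lborel) - (\<integral>x. E \<xi> x \<partial>lborel) - D \<xi> (y - \<xi>)) \<le> e * norm (y - \<xi>)"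
    proof (intro exI[of _ "min 1 (e / K)"] conjI allI impI)
      show "min 1 (e / K) > 0" using e K by simp
      fix y assume y: "norm (y - \<xi>) < min 1 (e / K)"
      then have "norm ((\<integral>x. E y x \<partial>lborel) - (\<integral>x. E \<xi> x \<partial>lborel) - D \<xi> (y - \<xi>)) \<le> 2 * C (norm \<xi> + 2) * (norm (y - \<xi>))\<^sup>2"
        using rem[of "y - \<xi>" \<xi>] by simp
      also have "\<dots> \<le> K * (norm (y - \<xi>))\<^sup>2" by (intro mult_right_mono) (auto simp: K_def)
      also have "\<dots> = (K * norm (y - \<xi>)) * norm (y - \<xi>)" by (simp add: power2_eq_square)
      also have "\<dots> \<le> e * norm (y - \<xi>)"
        using y K by (intro mult_right_mono) (auto simp: field_simps)
      finally show "norm ((\<integral>x. E y x \<partial>lborel) - (\<integral>x. E \<xi> x \<partial>lborel) - D \<xi> (y - \<xi>)) \<le> e * norm (y - \<xi>)" .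
    qed
  qed
  moreover have "D \<xi> (c *s w) = c * D \<xi> w" for \<xi> c w
    by (simp add: D_def cdot_cscale mult.left_commute)
  ultimately have "entire_md (\<lambda>\<xi>. \<integral>x. E \<xi> x \<partial>lborel)" by (rule entire_mdI)
  then show ?thesis by (simp add: E_def)
qed

section \<open>Mean value properties of entire functions\<close>

text \<open>On the complex line through \<xi> the function is holomorphic in one variable, so
  Cauchy's formula on the unit circle applies. The indicator of [0,1] makes the average an integral
  over the whole real line, the form in which it enters Fubini.\<close>

lemma circle_mean_value:
  assumes "entire_md (f :: complex^'n \<Rightarrow> complex)"
  shows "(\<integral>t. indicator {0..1} t *\<^sub>R f (exp (2 * of_real pi * \<i> * of_real t) *s \<xi>) \<partial>lborel) = f 0"
proof -
  define F where "F u = f (u *s \<xi>)" for u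
  have "F field_differentiable at u" for u
  proof -
    from entire_mdE[OF assms] obtain L where L: "(f has_derivative L) (at (u *s \<xi>))" "\<And>c w. L (c *s w) = c * L w" by metis
    have "linear (\<lambda>u. u *s \<xi>)"
      by (rule linearI) (simp_all add: vec_eq_iff algebra_simps)
    then have "((\<lambda>u. u *s \<xi>) has_derivative (\<lambda>u. u *s \<xi>)) (at u)" by (rule linear_imp_has_derivative)
    from has_derivative_compose[OF this L(1)]
    have "(F has_derivative (\<lambda>c. L \<xi> * c)) (at u)" by (simp add: F_def[abs_def] L(2) mult.commute)
    then show ?thesis by (auto simp: field_differentiable_def has_field_derivative_def)
  qed
  then have hol: "F holomorphic_on S" for S
    by (auto simp: holomorphic_on_def field_differentiable_at_within)
  have "((\<lambda>u. F u / (u - 0)) has_contour_integral (2 * of_real pi * \<i> * F 0)) (circlepath 0 1)"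
    by (rule Cauchy_integral_circlepath_simple[OF hol]) simp
  then have "((\<lambda>t. F (circlepath 0 1 t) / circlepath 0 1 t * vector_derivative (circlepath 0 1) (at t)) has_integral (2 * of_real pi * \<i> * F 0)) {0..1}"
    unfolding has_contour_integral by simp
  moreover have "F (circlepath 0 1 t) / circlepath 0 1 t * vector_derivative (circlepath 0 1) (at t)
     = F (exp (2 * of_real pi * \<i> * of_real t)) * (2 * of_real pi * \<i>)" for t
    unfolding vector_derivative_circlepath by (simp add: circlepath)
  ultimately have "((\<lambda>t. F (exp (2 * of_real pi * \<i> * of_real t)) * (2 * of_real pi * \<i>)) has_integral (2 * of_real pi * \<i> * F 0)) {0..1}"
    by simp
  then have "((\<lambda>t. F (exp (2 * of_real pi * \<i> * of_real t)) * (2 * of_real pi * \<i>) * inverse (2 * of_real pi * \<i>)) has_integral (2 * of_real pi * \<i> * F 0 * inverse (2 * of_real pi * \<i>))) {0..1}"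
    by (rule has_integral_mult_left)
  then have hi: "((\<lambda>t. F (exp (2 * of_real pi * \<i> * of_real t))) has_integral F 0) {0..1}"
    by (simp add: field_simps)
  have cF: "continuous_on UNIV F" by (rule holomorphic_on_imp_continuous_on[OF hol])
  have cont: "continuous_on {0..1} (\<lambda>t. F (exp (2 * of_real pi * \<i> * of_real t)))"
    by (rule continuous_on_compose2[OF cF]) (auto intro!: continuous_intros)
  have "set_integrable lborel {0..1} (\<lambda>t. F (exp (2 * of_real pi * \<i> * of_real t)))"
    by (rule borel_integrable_atLeastAtMost'[OF cont])
  then have "(LINT t:{0..1}|lborel. F (exp (2 * of_real pi * \<i> * of_real t))) = F 0"
    using set_borel_integral_eq_integral(2) hi by (metis integral_unique)
  then show ?thesis by (simp add: set_lebesgue_integral_def F_def)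
qed

lemma DIM_complex_vec: "DIM(complex^'n) = 2 * CARD('n)" by simp

lemma gauss_complex_vec:
  "has_bochner_integral lborel (\<lambda>\<xi>::complex^'n. exp (- (norm \<xi>)\<^sup>2)) (pi ^ CARD('n))"
proof -
  have "has_bochner_integral lborel (\<lambda>x::complex^'n. exp (- (norm (0 + sqrt 2 *\<^sub>R x))\<^sup>2/2)) ((sqrt (2*pi) ^ DIM(complex^'n)) /\<^sub>R \<bar>sqrt 2\<bar> ^ DIM(complex^'n))"
    using lborel_affine_has_bochner_integral[of "sqrt 2" "\<lambda>x::complex^'n. exp (- (norm x)\<^sup>2/2)" 0] gauss_real[where 'a="complex^'n"]
    by (simp add: has_bochner_integral_iff)
  moreover have "(sqrt (2*pi) ^ DIM(complex^'n)) /\<^sub>R \<bar>sqrt 2\<bar> ^ DIM(complex^'n) = pi ^ CARD('n)"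
    unfolding DIM_complex_vec power_mult by (simp add: power_mult_distrib)
  moreover have "exp (- (norm (0 + sqrt 2 *\<^sub>R x))\<^sup>2/2) = exp (- (norm x)\<^sup>2)" for x :: "complex^'n"
    by (simp add: power_mult_distrib)
  ultimately show ?thesis by (simp only:)
qed

text \<open>Lebesgue measure and the Gaussian are both invariant under multiplication by unimodular
  scalars, so \<open>f\<close> may be replaced by its average over circles, which is the constant
  f(0). What is left is the mass pi^d of the Gaussian.\<close>

lemma gaussian_mean_value:
  fixes f :: "complex^'n \<Rightarrow> complex"
  assumes f: "entire_md f" and i: "integrable lborel (\<lambda>\<xi>. f \<xi> * of_real (exp (- (norm \<xi>)\<^sup>2)))"
  shows "(\<integral>\<xi>. f \<xi> * of_real (exp (- (norm \<xi>)\<^sup>2)) \<partial>lborel) = of_real (pi ^ CARD('n)) * f 0"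
proof -
  have fc: "continuous_on UNIV f" by (rule entire_md_continuous[OF f])
  have [measurable]: "f \<in> borel_measurable borel" by (rule entire_md_measurable[OF f])
  define e where "e t = exp (2 * of_real pi * \<i> * of_real t)" for t :: real
  have e1: "cmod (e t) = 1" for t by (simp add: e_def)
  have ns: "norm (e t *s \<xi>) = norm \<xi>" for t and \<xi> :: "complex^'n"
    by (simp add: norm_vec_def norm_mult e1)
  define P where "P \<xi> = f \<xi> * of_real (exp (- (norm \<xi>)\<^sup>2))" for \<xi>
  have Pi: "integrable lborel P" using i by (simp add: P_def[abs_def])
  have [measurable]: "P \<in> borel_measurable borel" using Pi by auto
  have Pc: "continuous_on UNIV P" unfolding P_def by (intro continuous_intros fc)
  define F where "F t \<xi> = indicator {0..1} t *\<^sub>R P (e t *s \<xi>)" for t \<xi>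
  have cs: "continuous_on UNIV (\<lambda>z::real \<times> (complex^'n). e (fst z) *s snd z)"
    unfolding e_def vector_scalar_mult_def by (intro continuous_intros)
  have "(\<lambda>z::real \<times> (complex^'n). P (e (fst z) *s snd z)) \<in> borel_measurable borel"
    by (intro borel_measurable_continuous_onI continuous_on_compose2[OF Pc cs]) auto
  then have [measurable]: "(\<lambda>z. P (e (fst z) *s snd z)) \<in> borel_measurable (borel \<Otimes>\<^sub>M borel)"
    by (simp add: borel_prod)
  have Fm: "(\<lambda>(t, \<xi>). F t \<xi>) \<in> borel_measurable (lborel \<Otimes>\<^sub>M lborel)"
    unfolding F_def case_prod_beta' by measurable
  have Pe: "integrable lborel (\<lambda>\<xi>. P (e t *s \<xi>))" for t
    using Pi by (subst integral_rotate(2)[OF _ e1]) auto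
  have Fi: "integrable lborel (F t)" for t unfolding F_def using Pe by simp
  have "(\<integral>\<xi>. of_real (cmod (P (e t *s \<xi>))) \<partial>lborel) = (\<integral>\<xi>. complex_of_real (cmod (P \<xi>)) \<partial>lborel)" for t
    by (rule integral_rotate(1)[OF _ e1]) measurable
  then have Pn: "(\<integral>\<xi>. cmod (P (e t *s \<xi>)) \<partial>lborel) = (\<integral>\<xi>. cmod (P \<xi>) \<partial>lborel)" for t by simp
  have Fn: "(\<integral>\<xi>. norm (F t \<xi>) \<partial>lborel) \<le> indicator {0..1} t * (\<integral>\<xi>. cmod (P \<xi>) \<partial>lborel)" for t
    by (simp add: F_def Pn)
  have gi: "integrable lborel (\<lambda>t::real. indicator {0..1} t * (\<integral>\<xi>. cmod (P \<xi>) \<partial>lborel))"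
    by (intro integrable_mult_left integrable_real_indicator) auto
  have "(\<integral>t. (\<integral>\<xi>. F t \<xi> \<partial>lborel) \<partial>lborel) = (\<integral>\<xi>. (\<integral>t. F t \<xi> \<partial>lborel) \<partial>lborel)"
    by (rule lborel_Fubini(4)[OF Fm Fi gi Fn])
  moreover have "(\<integral>\<xi>. F t \<xi> \<partial>lborel) = indicator {0..1} t *\<^sub>R integral\<^sup>L lborel P" for t
    unfolding F_def by (simp add: integral_rotate(1)[OF _ e1])
  moreover have "(\<integral>t. F t \<xi> \<partial>lborel) = of_real (exp (- (norm \<xi>)\<^sup>2)) * f 0" for \<xi>
  proof -
    have "F t \<xi> = of_real (exp (- (norm \<xi>)\<^sup>2)) * (indicator {0..1} t *\<^sub>R f (e t *s \<xi>))" for t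
      by (simp add: F_def P_def ns)
    then have "(\<integral>t. F t \<xi> \<partial>lborel) = of_real (exp (- (norm \<xi>)\<^sup>2)) * (\<integral>t. indicator {0..1} t *\<^sub>R f (e t *s \<xi>) \<partial>lborel)"
      by (simp only: integral_mult_right_zero)
    then show ?thesis using circle_mean_value[OF f, of \<xi>] by (simp only: e_def)
  qed
  moreover have "(\<integral>t. indicator {0..1::real} t *\<^sub>R integral\<^sup>L lborel P \<partial>lborel) = integral\<^sup>L lborel P"
    by simp
  ultimately have "integral\<^sup>L lborel P = (\<integral>(\<xi>::complex^'n). of_real (exp (- (norm \<xi>)\<^sup>2)) * f 0 \<partial>lborel)"
    by simp
  also have "\<dots> = of_real (pi ^ CARD('n)) * f 0"
    using gauss_complex_vec[where 'n='n] by (simp add: has_bochner_integral_iff del: of_real_exp)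
  finally show ?thesis by (simp add: P_def[abs_def])
qed

section \<open>The Bargmann transform as an isometry\<close>

definition bargmann_const :: "nat \<Rightarrow> real" where
  "bargmann_const n = (2 * pi) powr (- real n / 4)"

lemma bargmann_const_pos: "bargmann_const n > 0"
  by (simp add: bargmann_const_def)

text \<open>This identity explains the constant: sqrt (2 pi)^n is the integral of exp (- |x|^2/2),
  so the constant times exp (- |x|^2/4) is a unit vector of L2.\<close>

lemma bargmann_const_square: "(bargmann_const n)\<^sup>2 * sqrt (2*pi) ^ n = 1"
proof -
  have "sqrt (2*pi) ^ n = (2*pi) powr (real n / 2)"
    by (simp add: powr_half_sqrt[symmetric] powr_powr powr_realpow[symmetric])
  then have "(bargmann_const n)\<^sup>2 * sqrt (2*pi) ^ n = (2*pi) powr (- real n / 4 + - real n / 4 + real n / 2)"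
    unfolding bargmann_const_def power2_eq_square powr_add by simp
  then show ?thesis by simp
qed

definition bargmann_kernel :: "complex^'n \<Rightarrow> real^'n \<Rightarrow> complex" where
  "bargmann_kernel \<xi> x = of_real (bargmann_const CARD('n)) *
     exp (cdot \<xi> (cvec x) - csq \<xi> / 2 - of_real ((norm x)\<^sup>2 / 4))"

lemma bargmann_eq: "bargmann f \<xi> = (\<integral>x. f x * bargmann_kernel \<xi> x \<partial>lborel)"
proof -
  have "f x * bargmann_kernel \<xi> x = of_real (bargmann_const CARD('a)) *
      (f x * exp (cdot \<xi> (cvec x) - csq \<xi> / 2 - of_real ((norm x)\<^sup>2 / 4)))" for x
    by (simp only: bargmann_kernel_def mult.left_commute)
  then show ?thesis by (simp only: bargmann_def bargmann_const_def integral_mult_right_zero)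
qed

lemma borel_measurable_bargmann_kernel [measurable]:
  fixes \<xi> :: "complex^'n"
  shows "bargmann_kernel \<xi> \<in> borel_measurable borel"
proof -
  have [measurable]: "(\<lambda>x::real^'n. cdot \<xi> (cvec x)) \<in> borel_measurable borel"
    by (rule borel_measurable_linear[OF linear_cdot_cvec])
  show ?thesis unfolding bargmann_kernel_def by measurable
qed

lemma continuous_on_cdot_cvec:
  "continuous_on UNIV (\<lambda>z::(complex^'n) \<times> (real^'n). cdot (fst z) (cvec (snd z)))"
  unfolding cdot_def cvec_def by (simp, intro continuous_intros)

lemma continuous_on_csq: "continuous_on UNIV csq"
  by (rule entire_md_continuous[OF entire_md_csq])

lemma borel_measurable_bargmann_kernel_pair [measurable]:
  "(\<lambda>z::(complex^'n) \<times> (real^'n). bargmann_kernel (fst z) (snd z)) \<in> borel_measurable (borel \<Otimes>\<^sub>M borel)"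
proof -
  have "continuous_on UNIV (\<lambda>z::(complex^'n) \<times> (real^'n). csq (fst z))"
    by (rule continuous_on_compose2[OF continuous_on_csq]) (auto intro: continuous_intros)
  then have "continuous_on UNIV (\<lambda>z::(complex^'n) \<times> (real^'n). bargmann_kernel (fst z) (snd z))"
    unfolding bargmann_kernel_def by (intro continuous_intros continuous_on_cdot_cvec) auto
  then show ?thesis unfolding borel_prod by (rule borel_measurable_continuous_onI)
qed

lemma borel_measurable_bargmann_kernel' [measurable (raw)]:
  assumes [measurable]: "f \<in> borel_measurable M" "g \<in> borel_measurable M"
  shows "(\<lambda>x. bargmann_kernel (f x) (g x)) \<in> borel_measurable M"
  using measurable_compose[OF _ borel_measurable_bargmann_kernel_pair, of "\<lambda>x. (f x, g x)" M] by simp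

text \<open>Completing the square exhibits the window: over a + i b the kernel is a Gaussian in
  \<open>x\<close> centred at 2 a times the character of frequency \<open>b\<close>. The first
  exponential has modulus exp (|\<xi>|^2/2), which is exactly what the Fock weight removes.\<close>

lemma bargmann_kernel_cpair:
  fixes a b x :: "real^'n"
  shows "bargmann_kernel (cpair a b) x = of_real (bargmann_const CARD('n))
      * exp (of_real (((norm a)\<^sup>2 + (norm b)\<^sup>2)/2) - \<i> * of_real (a \<bullet> b))
      * of_real (exp (- (norm (a - (1/2) *\<^sub>R x))\<^sup>2)) * exp (\<i> * of_real (b \<bullet> x))"
proof -
  have n: "(norm (a - (1/2) *\<^sub>R x))\<^sup>2 = (norm a)\<^sup>2 - a \<bullet> x + (norm x)\<^sup>2/4"
    by (simp add: power2_norm_eq_inner inner_diff_left inner_diff_right inner_commute[of x a] field_simps)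
  have "cdot (cpair a b) (cvec x) - csq (cpair a b) / 2 - of_real ((norm x)\<^sup>2 / 4)
     = (of_real (((norm a)\<^sup>2 + (norm b)\<^sup>2)/2) - \<i> * of_real (a \<bullet> b)) + of_real (- (norm (a - (1/2) *\<^sub>R x))\<^sup>2) + \<i> * of_real (b \<bullet> x)"
    unfolding cdot_cpair_cvec csq_cpair n by (simp add: complex_eq_iff field_simps)
  then show ?thesis
    unfolding bargmann_kernel_def by (simp only: exp_add exp_of_real mult.assoc)
qed

lemma cmod_bargmann_kernel:
  fixes \<xi> :: "complex^'n"
  shows "cmod (bargmann_kernel \<xi> x) = bargmann_const CARD('n) * exp ((norm \<xi>)\<^sup>2/2) * exp (- (norm (cre \<xi> - (1/2) *\<^sub>R x))\<^sup>2)"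
proof -
  have x: "\<xi> = cpair (cre \<xi>) (cim \<xi>)" by simp
  have n: "(norm (cre \<xi>))\<^sup>2 + (norm (cim \<xi>))\<^sup>2 = (norm \<xi>)\<^sup>2" using norm_cpair[of "cre \<xi>" "cim \<xi>"] by simp
  show ?thesis
    by (subst x, subst bargmann_kernel_cpair)
       (simp add: norm_mult n[symmetric] less_imp_le[OF bargmann_const_pos])
qed

lemma integrable_gauss:
  assumes "r > 0"
  shows "integrable lborel (\<lambda>x::'a::euclidean_space. exp (- r * (norm x)\<^sup>2))"
proof -
  have "integrable lborel (\<lambda>x::'a. exp (- (norm (0 + sqrt (2*r) *\<^sub>R x))\<^sup>2/2))"
    using gauss_real[where 'a='a] assms by (intro lborel_integrable_affine) (auto simp: has_bochner_integral_iff)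
  then show ?thesis using assms by (simp add: power_mult_distrib)
qed

lemma bargmann_kernel_L2:
  fixes \<xi> :: "complex^'n"
  shows "integrable lborel (\<lambda>x. (cmod (bargmann_kernel \<xi> x))\<^sup>2)"
proof -
  have "integrable lborel (\<lambda>x::real^'n. exp (- (1/2) * (norm (- (2 *\<^sub>R cre \<xi>) + x))\<^sup>2))"
    by (rule lborel_integrable_shift[OF integrable_gauss]) simp
  moreover have "(cmod (bargmann_kernel \<xi> x))\<^sup>2 = (bargmann_const CARD('n) * exp ((norm \<xi>)\<^sup>2/2))\<^sup>2 * exp (- (1/2) * (norm (- (2 *\<^sub>R cre \<xi>) + x))\<^sup>2)" for x
  proof -
    have "(norm (- (2 *\<^sub>R cre \<xi>) + x))\<^sup>2 = (norm ((-2) *\<^sub>R (cre \<xi> - (1/2) *\<^sub>R x)))\<^sup>2"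
      by (simp add: algebra_simps)
    also have "\<dots> = 4 * (norm (cre \<xi> - (1/2) *\<^sub>R x))\<^sup>2"
      unfolding norm_scaleR by (simp add: power_mult_distrib)
    finally show ?thesis unfolding cmod_bargmann_kernel power_mult_distrib
      by (simp add: power2_eq_square exp_add[symmetric])
  qed
  ultimately show ?thesis by simp
qed

lemma L2_borel: "L2 f \<Longrightarrow> f \<in> borel_measurable borel"
  by (simp add: L2_def)

lemma integrable_bargmann_integrand:
  assumes "L2 f"
  shows "integrable lborel (\<lambda>x. f x * bargmann_kernel \<xi> x)"
  using assms bargmann_kernel_L2 by (intro integrable_mult_L2) (auto simp: L2_def)

text \<open>Supplies the exponential moments required by \<open>entire_md_laplace\<close> and by the
  half-space theorem: the Gaussian outweighs exp (R |x|) for every \<open>R\<close>.\<close>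

lemma L2_gauss_exp_integrable:
  fixes f :: "real^'n \<Rightarrow> complex"
  assumes "L2 f"
  shows "integrable lborel (\<lambda>x. f x * of_real (exp (- (norm x)\<^sup>2/4)) * of_real (exp (R * norm x)))"
proof -
  have [measurable]: "f \<in> borel_measurable borel" by (rule L2_borel[OF assms])
  have "integrable lborel (\<lambda>x. f x * of_real (exp (- (norm x)\<^sup>2/4) * exp (R * norm x)))"
  proof (rule integrable_mult_L2(1))
    show "integrable lborel (\<lambda>x. (cmod (f x))\<^sup>2)" using assms by (simp add: L2_def)
    \<comment> \<open>After squaring, half of the Gaussian decay is spent on the exponential; the
      constant comes from (|x|/2 - 2 R)^2 \<ge> 0.\<close>
    have le: "(cmod (of_real (exp (- (norm x)\<^sup>2/4) * exp (R * norm x))))\<^sup>2 \<le> exp (4*R\<^sup>2) * exp (- (1/4) * (norm x)\<^sup>2)" for x :: "real^'n"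
    proof -
      have "(cmod (of_real (exp (- (norm x)\<^sup>2/4) * exp (R * norm x))))\<^sup>2 = exp (- (norm x)\<^sup>2/2 + 2 * R * norm x)"
        by (simp add: norm_mult power2_eq_square exp_add[symmetric])
      also have "\<dots> \<le> exp (4*R\<^sup>2 + - (1/4) * (norm x)\<^sup>2)"
      proof -
        have "0 \<le> (norm x / 2 - 2 * R)\<^sup>2" by simp
        then show ?thesis by (simp add: power2_eq_square algebra_simps)
      qed
      finally show ?thesis by (simp only: exp_add)
    qed
    show "integrable lborel (\<lambda>x::real^'n. (cmod (of_real (exp (- (norm x)\<^sup>2/4) * exp (R * norm x))))\<^sup>2)"
      by (rule Bochner_Integration.integrable_bound[OF integrable_mult_right[OF integrable_gauss[of "1/4"], of "exp (4*R\<^sup>2)"]])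
         (use le in auto)
  qed measurable
  then show ?thesis by (simp add: mult.assoc)
qed

lemma bargmann_laplace:
  fixes f :: "real^'n \<Rightarrow> complex"
  shows "bargmann f \<xi> = (of_real (bargmann_const CARD('n)) * exp ((- 1/2) * csq \<xi>)) *
      (\<integral>x. (f x * of_real (exp (- (norm x)\<^sup>2/4))) * exp (cdot \<xi> (cvec x)) \<partial>lborel)"
proof -
  have "f x * bargmann_kernel \<xi> x = (of_real (bargmann_const CARD('n)) * exp ((- 1/2) * csq \<xi>)) *
      ((f x * of_real (exp (- (norm x)\<^sup>2/4))) * exp (cdot \<xi> (cvec x)))" for x
  proof -
    have "cdot \<xi> (cvec x) - csq \<xi> / 2 - of_real ((norm x)\<^sup>2 / 4) = (- 1/2) * csq \<xi> + of_real (- (norm x)\<^sup>2/4) + cdot \<xi> (cvec x)"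
      by simp
    then show ?thesis unfolding bargmann_kernel_def by (simp only: exp_add exp_of_real mult_ac)
  qed
  then show ?thesis unfolding bargmann_eq by (simp only: integral_mult_right_zero)
qed

lemma entire_md_bargmann:
  fixes f :: "real^'n \<Rightarrow> complex"
  assumes "L2 f"
  shows "entire_md (bargmann f)"
proof -
  have [measurable]: "f \<in> borel_measurable borel" by (rule L2_borel[OF assms])
  have "entire_md (\<lambda>\<xi>. \<integral>x. (f x * of_real (exp (- (norm x)\<^sup>2/4))) * exp (cdot \<xi> (cvec x)) \<partial>lborel)"
    by (rule entire_md_laplace) (use L2_gauss_exp_integrable[OF assms] in simp)
  then have "entire_md (\<lambda>\<xi>. (of_real (bargmann_const CARD('n)) * exp ((- 1/2) * csq \<xi>)) *
      (\<integral>x. (f x * of_real (exp (- (norm x)\<^sup>2/4))) * exp (cdot \<xi> (cvec x)) \<partial>lborel))"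
    by (intro entire_md_mult entire_md_exp entire_md_const entire_md_csq)
  then show ?thesis by (simp only: bargmann_laplace[of f, symmetric])
qed

text \<open>Nonnegative integrals let Tonelli's theorem be applied with no integrability known
  beforehand, so membership in the Fock space and the value of the norm come out together.\<close>

lemma nn_integral_bargmann:
  fixes f :: "real^'n \<Rightarrow> complex"
  assumes f: "L2 f"
  shows "(\<integral>\<^sup>+\<xi>. ennreal ((cmod (bargmann f \<xi>))\<^sup>2 * exp (- (norm \<xi>)\<^sup>2)) \<partial>lborel)
     = ennreal (pi ^ CARD('n) * (\<integral>x. (cmod (f x))\<^sup>2 \<partial>lborel))"
proof -
  have [measurable]: "f \<in> borel_measurable borel" by (rule L2_borel[OF f])
  have f2: "integrable lborel (\<lambda>x. (cmod (f x))\<^sup>2)" using f by (simp add: L2_def)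
  have [measurable]: "bargmann f \<in> borel_measurable borel"
    by (rule entire_md_measurable[OF entire_md_bargmann[OF f]])
  define c where "c = bargmann_const CARD('n)"
  define w where "w a x = exp (- (norm (a - (1/2) *\<^sub>R x))\<^sup>2)" for a x :: "real^'n"
  define u where "u a x = f x * of_real (w a x)" for a x
  have w1: "0 < w a x" "w a x \<le> 1" for a x by (simp_all add: w_def)
  have [measurable]: "w a \<in> borel_measurable borel" for a unfolding w_def by measurable
  have "integrable lborel (\<lambda>x. (cmod (of_real (w a x)))\<^sup>2)" for a
  proof -
    have "integrable lborel (\<lambda>x::real^'n. exp (- 2 * (norm (a + (-1/2) *\<^sub>R x))\<^sup>2))"
      by (rule lborel_integrable_affine[OF _ integrable_gauss]) auto
    then show ?thesis by (simp add: w_def power2_eq_square exp_add[symmetric])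
  qed
  then have ui: "integrable lborel (u a)" for a
    unfolding u_def using f2 by (intro integrable_mult_L2) auto
  have cu: "(cmod (u a x))\<^sup>2 = (cmod (f x))\<^sup>2 * (w a x)\<^sup>2" for a x
    by (simp add: u_def norm_mult power_mult_distrib)
  have u2: "integrable lborel (\<lambda>x. (cmod (u a x))\<^sup>2)" for a
  proof (rule Bochner_Integration.integrable_bound[OF f2])
    have "(w a x)\<^sup>2 \<le> 1" for x using w1[of a x] by (simp add: power_le_one)
    then show "AE x in lborel. norm ((cmod (u a x))\<^sup>2) \<le> norm ((cmod (f x))\<^sup>2)"
      by (simp add: cu mult_left_le)
  qed (simp add: u_def)
  have bf: "(cmod (bargmann f (cpair a b)))\<^sup>2 * exp (- (norm (cpair a b))\<^sup>2) = c\<^sup>2 * (cmod (fourier (u a) b))\<^sup>2" for a b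
  proof -
    have "f x * bargmann_kernel (cpair a b) x = (of_real c * exp (of_real (((norm a)\<^sup>2 + (norm b)\<^sup>2)/2) - \<i> * of_real (a \<bullet> b)))
       * (u a x * exp (\<i> * of_real (b \<bullet> x)))" for x
      unfolding bargmann_kernel_cpair u_def w_def c_def by (simp only: mult_ac)
    then have "bargmann f (cpair a b) = (of_real c * exp (of_real (((norm a)\<^sup>2 + (norm b)\<^sup>2)/2) - \<i> * of_real (a \<bullet> b))) * fourier (u a) b"
      unfolding bargmann_eq fourier_def by (simp only: integral_mult_right_zero)
    then have "cmod (bargmann f (cpair a b)) = \<bar>c\<bar> * exp ((norm (cpair a b))\<^sup>2/2) * cmod (fourier (u a) b)"
      by (simp add: norm_mult norm_cpair)
    then have "(cmod (bargmann f (cpair a b)))\<^sup>2 = c\<^sup>2 * (exp ((norm (cpair a b))\<^sup>2/2))\<^sup>2 * (cmod (fourier (u a) b))\<^sup>2"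
      by (simp add: power_mult_distrib)
    moreover have "(exp ((norm (cpair a b))\<^sup>2/2))\<^sup>2 * exp (- (norm (cpair a b))\<^sup>2) = 1"
      by (simp add: power2_eq_square[of "exp _"] exp_add[symmetric])
    ultimately show ?thesis by (simp add: mult_ac)
  qed
  have inner: "(\<integral>\<^sup>+b. ennreal ((cmod (bargmann f (cpair a b)))\<^sup>2 * exp (- (norm (cpair a b))\<^sup>2)) \<partial>lborel)
     = ennreal (c\<^sup>2 * (2*pi) ^ CARD('n)) * (\<integral>\<^sup>+x. ennreal ((cmod (f x))\<^sup>2 * (w a x)\<^sup>2) \<partial>lborel)" for a
  proof -
    have "(\<integral>\<^sup>+b. ennreal (c\<^sup>2 * (cmod (fourier (u a) b))\<^sup>2) \<partial>lborel) = ennreal (\<integral>b. c\<^sup>2 * (cmod (fourier (u a) b))\<^sup>2 \<partial>lborel)"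
      by (rule nn_integral_eq_integral) (use fourier_L2_bound(1)[OF ui u2] in auto)
    also have "\<dots> = ennreal (c\<^sup>2 * (2*pi) ^ CARD('n) * (\<integral>x. (cmod (u a x))\<^sup>2 \<partial>lborel))"
      by (simp add: plancherel[OF ui u2] mult.assoc)
    also have "\<dots> = ennreal (c\<^sup>2 * (2*pi) ^ CARD('n)) * ennreal (\<integral>x. (cmod (u a x))\<^sup>2 \<partial>lborel)"
      by (simp add: ennreal_mult)
    also have "ennreal (\<integral>x. (cmod (u a x))\<^sup>2 \<partial>lborel) = (\<integral>\<^sup>+x. ennreal ((cmod (u a x))\<^sup>2) \<partial>lborel)"
      by (rule nn_integral_eq_integral[symmetric, OF u2]) simp
    finally show ?thesis by (simp only: bf cu)
  qed
  \<comment> \<open>The squared window has the same mass in \<open>a\<close> wherever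
    \<open>x\<close> lies, which is why integrating over the real parts gives back the norm of
    \<open>f\<close>.\<close>
  have win: "(\<integral>\<^sup>+a. ennreal ((w a x)\<^sup>2) \<partial>lborel) = ennreal ((sqrt (2*pi)/2) ^ CARD('n))" for x
  proof -
    have "has_bochner_integral lborel (\<lambda>a::real^'n. exp (- (norm (- x + 2 *\<^sub>R a))\<^sup>2/2)) ((sqrt (2*pi) ^ CARD('n)) /\<^sub>R \<bar>2\<bar> ^ CARD('n))"
      using lborel_affine_has_bochner_integral[of 2 "\<lambda>x::real^'n. exp (- (norm x)\<^sup>2/2)" "-x"] gauss_real[where 'a="real^'n"]
      by (simp add: has_bochner_integral_iff)
    moreover have "exp (- (norm (- x + 2 *\<^sub>R a))\<^sup>2/2) = (w a x)\<^sup>2" for a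
    proof -
      have "(norm (- x + 2 *\<^sub>R a))\<^sup>2 = (norm (2 *\<^sub>R (a - (1/2) *\<^sub>R x)))\<^sup>2" by (simp add: algebra_simps)
      also have "\<dots> = 4 * (norm (a - (1/2) *\<^sub>R x))\<^sup>2" unfolding norm_scaleR by (simp add: power_mult_distrib)
      finally show ?thesis by (simp add: w_def power2_eq_square[of "exp _"] exp_add[symmetric])
    qed
    ultimately have "has_bochner_integral lborel (\<lambda>a. (w a x)\<^sup>2) ((sqrt (2*pi)/2) ^ CARD('n))"
      by (simp add: power_divide field_simps)
    then show ?thesis by (auto simp: has_bochner_integral_iff nn_integral_eq_integral)
  qed
  have "(\<integral>\<^sup>+\<xi>. ennreal ((cmod (bargmann f \<xi>))\<^sup>2 * exp (- (norm \<xi>)\<^sup>2)) \<partial>lborel)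
     = (\<integral>\<^sup>+a. (\<integral>\<^sup>+b. ennreal ((cmod (bargmann f (cpair a b)))\<^sup>2 * exp (- (norm (cpair a b))\<^sup>2)) \<partial>lborel) \<partial>lborel)"
    by (rule nn_integral_complex_vec(1)) measurable
  also have "\<dots> = (\<integral>\<^sup>+a. ennreal (c\<^sup>2 * (2*pi) ^ CARD('n)) * (\<integral>\<^sup>+x. ennreal ((cmod (f x))\<^sup>2 * (w a x)\<^sup>2) \<partial>lborel) \<partial>lborel)"
    by (simp only: inner)
  also have "\<dots> = ennreal (c\<^sup>2 * (2*pi) ^ CARD('n)) * (\<integral>\<^sup>+a. (\<integral>\<^sup>+x. ennreal ((cmod (f x))\<^sup>2 * (w a x)\<^sup>2) \<partial>lborel) \<partial>lborel)"
    by (rule nn_integral_cmult) (simp add: w_def)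
  also have "(\<integral>\<^sup>+a. (\<integral>\<^sup>+x. ennreal ((cmod (f x))\<^sup>2 * (w a x)\<^sup>2) \<partial>lborel) \<partial>lborel) = (\<integral>\<^sup>+x. (\<integral>\<^sup>+a. ennreal ((cmod (f x))\<^sup>2 * (w a x)\<^sup>2) \<partial>lborel) \<partial>lborel)"
    by (rule lborel_pair.Fubini') (simp add: w_def)
  also have "\<dots> = (\<integral>\<^sup>+x. ennreal ((cmod (f x))\<^sup>2) * ennreal ((sqrt (2*pi)/2) ^ CARD('n)) \<partial>lborel)"
  proof (rule nn_integral_cong)
    fix x
    have [measurable]: "(\<lambda>a. w a x) \<in> borel_measurable borel" unfolding w_def by measurable
    show "(\<integral>\<^sup>+a. ennreal ((cmod (f x))\<^sup>2 * (w a x)\<^sup>2) \<partial>lborel) = ennreal ((cmod (f x))\<^sup>2) * ennreal ((sqrt (2*pi)/2) ^ CARD('n))"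
      by (simp add: ennreal_mult nn_integral_cmult win)
  qed
  also have "\<dots> = (\<integral>\<^sup>+x. ennreal ((cmod (f x))\<^sup>2) \<partial>lborel) * ennreal ((sqrt (2*pi)/2) ^ CARD('n))"
    by (rule nn_integral_multc) measurable
  also have "(\<integral>\<^sup>+x. ennreal ((cmod (f x))\<^sup>2) \<partial>lborel) = ennreal (\<integral>x. (cmod (f x))\<^sup>2 \<partial>lborel)"
    by (rule nn_integral_eq_integral[OF f2]) simp
  also have "ennreal (c\<^sup>2 * (2*pi) ^ CARD('n)) * (ennreal (\<integral>x. (cmod (f x))\<^sup>2 \<partial>lborel) * ennreal ((sqrt (2*pi)/2) ^ CARD('n)))
     = ennreal (c\<^sup>2 * (2*pi) ^ CARD('n) * ((\<integral>x. (cmod (f x))\<^sup>2 \<partial>lborel) * (sqrt (2*pi)/2) ^ CARD('n)))"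
    by (simp add: ennreal_mult)
  \<comment> \<open>(2 pi)^d is Plancherel's constant and (sqrt (2 pi)/2)^d the mass of the squared
    window. The square of \<open>c\<close> cancels sqrt (2 pi)^d, and the remaining pi^d is the
    factor divided out in \<open>fock_norm2\<close>.\<close>
  also have "c\<^sup>2 * (2*pi) ^ CARD('n) * ((\<integral>x. (cmod (f x))\<^sup>2 \<partial>lborel) * (sqrt (2*pi)/2) ^ CARD('n))
     = (c\<^sup>2 * sqrt (2*pi) ^ CARD('n)) * ((2*pi) ^ CARD('n) / 2 ^ CARD('n)) * (\<integral>x. (cmod (f x))\<^sup>2 \<partial>lborel)"
    by (simp add: power_divide)
  also have "\<dots> = pi ^ CARD('n) * (\<integral>x. (cmod (f x))\<^sup>2 \<partial>lborel)"
    unfolding c_def bargmann_const_square by (simp add: power_divide[symmetric])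
  finally show ?thesis .
qed

lemma bargmann_in_fock_space:
  assumes "L2 f"
  shows "bargmann f \<in> fock_space"
  unfolding fock_space_def by (simp add: entire_md_bargmann[OF assms] nn_integral_bargmann[OF assms])

lemma bargmann_isometry:
  fixes f :: "real^'n \<Rightarrow> complex"
  assumes f: "L2 f"
  shows "has_bochner_integral lborel (\<lambda>\<xi>. (cmod (bargmann f \<xi>))\<^sup>2 * exp (- (norm \<xi>)\<^sup>2))
       (pi ^ CARD('n) * (\<integral>x. (cmod (f x))\<^sup>2 \<partial>lborel))"
    and "fock_norm2 (bargmann f) = (\<integral>x. (cmod (f x))\<^sup>2 \<partial>lborel)"
proof -
  have [measurable]: "bargmann f \<in> borel_measurable borel"
    by (rule entire_md_measurable[OF entire_md_bargmann[OF f]])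
  show *: "has_bochner_integral lborel (\<lambda>\<xi>. (cmod (bargmann f \<xi>))\<^sup>2 * exp (- (norm \<xi>)\<^sup>2))
       (pi ^ CARD('n) * (\<integral>x. (cmod (f x))\<^sup>2 \<partial>lborel))"
    by (rule has_bochner_integral_nn_integral) (use nn_integral_bargmann[OF f] in auto)
  then show "fock_norm2 (bargmann f) = (\<integral>x. (cmod (f x))\<^sup>2 \<partial>lborel)"
    by (simp add: fock_norm2_def has_bochner_integral_iff)
qed

section \<open>From norms to inner products\<close>

text \<open>The inner product is expressed by the norms of F, G, F + G and F + i G alone, so an
  isometry that is linear carries it over.\<close>

lemma integral_mult_cnj_polarisation:
  fixes F G :: "'a \<Rightarrow> complex"
  assumes [measurable]: "F \<in> borel_measurable M" "G \<in> borel_measurable M"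
    and F: "integrable M (\<lambda>x. (cmod (F x))\<^sup>2)" and G: "integrable M (\<lambda>x. (cmod (G x))\<^sup>2)"
  shows "(\<integral>x. F x * cnj (G x) \<partial>M) = Complex
    (((\<integral>x. (cmod (F x + G x))\<^sup>2 \<partial>M) - (\<integral>x. (cmod (F x))\<^sup>2 \<partial>M) - (\<integral>x. (cmod (G x))\<^sup>2 \<partial>M)) / 2)
    (((\<integral>x. (cmod (F x + \<i> * G x))\<^sup>2 \<partial>M) - (\<integral>x. (cmod (F x))\<^sup>2 \<partial>M) - (\<integral>x. (cmod (G x))\<^sup>2 \<partial>M)) / 2)"
proof -
  have FG: "integrable M (\<lambda>x. F x * cnj (G x))"
    by (rule integrable_mult_L2) (use F G in auto)
  have i1: "integrable M (\<lambda>x. (cmod (F x + G x))\<^sup>2)" by (rule integrable_add_L2) (use F G in auto)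
  have i2: "integrable M (\<lambda>x. (cmod (F x + \<i> * G x))\<^sup>2)"
    by (rule integrable_add_L2) (use F G in \<open>auto simp: norm_mult\<close>)
  have re: "Re (F x * cnj (G x)) = ((cmod (F x + G x))\<^sup>2 - (cmod (F x))\<^sup>2 - (cmod (G x))\<^sup>2) / 2" for x
    unfolding cmod_power2 by (simp add: power2_eq_square algebra_simps)
  have im: "Im (F x * cnj (G x)) = ((cmod (F x + \<i> * G x))\<^sup>2 - (cmod (F x))\<^sup>2 - (cmod (G x))\<^sup>2) / 2" for x
    unfolding cmod_power2 by (simp add: power2_eq_square algebra_simps)
  show ?thesis
    by (rule complex_eqI) (simp_all only: integral_Re[OF FG, symmetric] integral_Im[OF FG, symmetric] re im complex.sel, use F G i1 i2 in auto)
qed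

lemma L2_add: "L2 f \<Longrightarrow> L2 g \<Longrightarrow> L2 (\<lambda>x. f x + g x)"
  unfolding L2_def using integrable_add_L2(1)[of f lborel g] by auto

lemma L2_cmult: "L2 f \<Longrightarrow> L2 (\<lambda>x. c * f x)"
  unfolding L2_def by (auto simp: norm_mult power_mult_distrib)

lemma bargmann_add:
  assumes "L2 f" "L2 g"
  shows "bargmann (\<lambda>x. f x + g x) \<xi> = bargmann f \<xi> + bargmann g \<xi>"
  using assms[THEN integrable_bargmann_integrand] by (simp add: bargmann_eq ring_distribs)

lemma bargmann_cmult: "bargmann (\<lambda>x. c * f x) \<xi> = c * bargmann f \<xi>"
  by (simp add: bargmann_eq mult.assoc)

text \<open>Writing the Fock weight as a square and giving one factor to each function makes the
  inner product unweighted. Polarisation then applies on both sides, and the isometry matches the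
  four norms.\<close>

lemma fock_inner_bargmann:
  fixes f g :: "real^'n \<Rightarrow> complex"
  assumes f: "L2 f" and g: "L2 g"
  shows "fock_inner (bargmann f) (bargmann g) = (\<integral>x. f x * cnj (g x) \<partial>lborel)"
proof -
  define W where "W h \<xi> = bargmann h \<xi> * of_real (exp (- (norm \<xi>)\<^sup>2/2))" for h :: "real^'n \<Rightarrow> complex" and \<xi>
  have e: "(exp (- (norm \<xi>)\<^sup>2/2))\<^sup>2 = exp (- (norm \<xi>)\<^sup>2)" for \<xi> :: "complex^'n"
    by (simp add: power2_eq_square[of "exp _"] exp_add[symmetric])
  have Wsq: "(cmod (W h \<xi>))\<^sup>2 = (cmod (bargmann h \<xi>))\<^sup>2 * exp (- (norm \<xi>)\<^sup>2)" for h \<xi>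
    unfolding e[symmetric] by (simp add: W_def norm_mult power_mult_distrib)
  have Wm: "W h \<in> borel_measurable lborel" if "L2 h" for h
  proof -
    have [measurable]: "bargmann h \<in> borel_measurable borel"
      by (rule entire_md_measurable[OF entire_md_bargmann[OF that]])
    show ?thesis unfolding W_def by measurable
  qed
  have Wi: "integrable lborel (\<lambda>\<xi>. (cmod (W h \<xi>))\<^sup>2)" "(\<integral>\<xi>. (cmod (W h \<xi>))\<^sup>2 \<partial>lborel) = pi ^ CARD('n) * (\<integral>x. (cmod (h x))\<^sup>2 \<partial>lborel)" if "L2 h" for h
    unfolding Wsq using bargmann_isometry(1)[OF that] by (auto simp: has_bochner_integral_iff)
  have s1: "W f \<xi> + W g \<xi> = W (\<lambda>x. f x + g x) \<xi>" for \<xi>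
    by (simp add: W_def bargmann_add[OF f g] ring_distribs)
  have ig: "L2 (\<lambda>x. \<i> * g x)" by (rule L2_cmult[OF g])
  have s2: "W f \<xi> + \<i> * W g \<xi> = W (\<lambda>x. f x + \<i> * g x) \<xi>" for \<xi>
    by (simp add: W_def bargmann_add[OF f ig] bargmann_cmult ring_distribs)
  have WW: "W f \<xi> * cnj (W g \<xi>) = bargmann f \<xi> * cnj (bargmann g \<xi>) * of_real (exp (- (norm \<xi>)\<^sup>2))" for \<xi>
    unfolding e[symmetric] by (simp add: W_def power2_eq_square)
  have "(\<integral>\<xi>. W f \<xi> * cnj (W g \<xi>) \<partial>lborel) = of_real (pi ^ CARD('n)) * (\<integral>x. f x * cnj (g x) \<partial>lborel)"
    unfolding integral_mult_cnj_polarisation[OF Wm[OF f] Wm[OF g] Wi(1)[OF f] Wi(1)[OF g]]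
      s1 s2 Wi(2)[OF f] Wi(2)[OF g] Wi(2)[OF L2_add[OF f g]] Wi(2)[OF L2_add[OF f ig]]
    using f g unfolding L2_def
    by (subst integral_mult_cnj_polarisation) (auto simp: complex_eq_iff algebra_simps diff_divide_distrib)
  then show ?thesis unfolding fock_inner_def WW[symmetric] by simp
qed

section \<open>The half-space kernel and the reproducing formula\<close>

lemma bargmann_kernel_product:
  fixes \<xi> \<eta> :: "complex^'n"
  shows "bargmann_kernel \<xi> x * cnj (bargmann_kernel \<eta> x) = of_real ((bargmann_const CARD('n))\<^sup>2) * exp (- (csq \<xi> + cnj (csq \<eta>))/2)
     * exp (of_real (- (norm x)\<^sup>2/2) + (cdot \<xi> (cvec x) + cnj (cdot \<eta> (cvec x))))"
proof -
  have "bargmann_kernel \<xi> x * cnj (bargmann_kernel \<eta> x) = of_real ((bargmann_const CARD('n))\<^sup>2)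
     * (exp (cdot \<xi> (cvec x) - csq \<xi> / 2 - of_real ((norm x)\<^sup>2 / 4)) * exp (cnj (cdot \<eta> (cvec x) - csq \<eta> / 2 - of_real ((norm x)\<^sup>2 / 4))))"
    unfolding bargmann_kernel_def exp_cnj complex_cnj_mult complex_cnj_complex_of_real
    by (simp only: power2_eq_square of_real_mult mult_ac)
  also have "exp (cdot \<xi> (cvec x) - csq \<xi> / 2 - of_real ((norm x)\<^sup>2 / 4)) * exp (cnj (cdot \<eta> (cvec x) - csq \<eta> / 2 - of_real ((norm x)\<^sup>2 / 4)))
    = exp (- (csq \<xi> + cnj (csq \<eta>))/2) * exp (of_real (- (norm x)\<^sup>2/2) + (cdot \<xi> (cvec x) + cnj (cdot \<eta> (cvec x))))"
    unfolding exp_add[symmetric] by (rule arg_cong[where f=exp]) (simp add: field_simps)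
  finally show ?thesis by (simp only: mult.assoc)
qed

lemma cdot_cvec_axis: "cdot \<xi> (cvec (axis k 1)) = \<xi>$k"
  by (simp add: cdot_def cvec_def axis_def if_distrib cong: if_cong)

lemma linear_kernel_exponent: "linear (\<lambda>x. cdot \<xi> (cvec x) + cnj (cdot \<eta> (cvec x)))"
proof (rule linear_compose_add[OF linear_cdot_cvec])
  show "linear (\<lambda>x. cnj (cdot \<eta> (cvec x)))"
    by (rule linearI) (simp_all add: linear_add[OF linear_cdot_cvec] linear_cmul[OF linear_cdot_cvec])
qed

text \<open>The first summand is cancelled by the prefactor in
  \<open>bargmann_kernel_product\<close>; the cross terms of the bilinear square contribute \<xi> .
  \<eta>.\<close>

lemma kernel_exponent_sum:
  fixes \<xi> \<eta> :: "complex^'n"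
  shows "(\<Sum>b\<in>Basis. (cdot \<xi> (cvec b) + cnj (cdot \<eta> (cvec b)))\<^sup>2)/2 = (csq \<xi> + cnj (csq \<eta>))/2 + cdot \<xi> \<eta>"
proof -
  have "(\<Sum>b\<in>Basis. (cdot \<xi> (cvec b) + cnj (cdot \<eta> (cvec b)))\<^sup>2) = (\<Sum>k\<in>UNIV. (\<xi>$k)\<^sup>2 + (cnj (\<eta>$k))\<^sup>2 + 2 * (\<xi>$k * cnj (\<eta>$k)))"
    unfolding sum_prod_Basis_real_vec cdot_cvec_axis
    by (intro sum.cong refl) (simp add: power2_eq_square algebra_simps)
  also have "\<dots> = csq \<xi> + cnj (csq \<eta>) + 2 * cdot \<xi> \<eta>"
    by (simp add: csq_def cdot_def sum.distrib sum_distrib_left[symmetric])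
  finally show ?thesis by (simp add: field_simps)
qed

text \<open>So the transform of the conjugate kernel at \<eta> is exp (\<xi> . \<eta>), the
  reproducing kernel of the whole Fock space. Through it, applying the adjoint and then the
  transform becomes the integral of \<open>fock_reproducing\<close>.\<close>

lemma bargmann_kernel_inner:
  "(\<integral>x. bargmann_kernel \<xi> x * cnj (bargmann_kernel \<eta> x) \<partial>lborel) = exp (cdot \<xi> \<eta>)"
proof -
  let ?l = "\<lambda>x. cdot \<xi> (cvec x) + cnj (cdot \<eta> (cvec x))"
  have "(\<integral>x. exp (of_real (- (norm x)\<^sup>2/2) + ?l x) \<partial>lborel) = of_real (sqrt (2*pi) ^ CARD('a)) * exp ((csq \<xi> + cnj (csq \<eta>))/2 + cdot \<xi> \<eta>)"
    using gauss_complex[OF linear_kernel_exponent, of \<xi> \<eta>] unfolding kernel_exponent_sum by (simp add: has_bochner_integral_iff)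
  then have "(\<integral>x. bargmann_kernel \<xi> x * cnj (bargmann_kernel \<eta> x) \<partial>lborel)
     = of_real ((bargmann_const CARD('a))\<^sup>2 * sqrt (2*pi) ^ CARD('a)) * (exp (- (csq \<xi> + cnj (csq \<eta>))/2) * exp ((csq \<xi> + cnj (csq \<eta>))/2 + cdot \<xi> \<eta>))"
    unfolding bargmann_kernel_product integral_mult_right_zero by (simp only: of_real_mult mult_ac)
  also have "\<dots> = exp (- (csq \<xi> + cnj (csq \<eta>))/2 + ((csq \<xi> + cnj (csq \<eta>))/2 + cdot \<xi> \<eta>))"
    unfolding bargmann_const_square exp_add by simp
  also have "- (csq \<xi> + cnj (csq \<eta>))/2 + ((csq \<xi> + cnj (csq \<eta>))/2 + cdot \<xi> \<eta>) = cdot \<xi> \<eta>"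
    by (simp add: field_simps)
  finally show ?thesis .
qed

text \<open>With u = - sqrt 2 s and w = z / sqrt 2 the exponent becomes z^2/2 - (w + s)^2, and the
  half line u \<le> 0 becomes the horizontal ray from \<open>w\<close> along which
  \<open>cerfc\<close> integrates.\<close>

lemma gauss_half_line:
  "(\<integral>u. exp (of_real (- u\<^sup>2/2) + z * of_real u) * of_real (indicator {..0} u) \<partial>lborel)
     = of_real (sqrt (2*pi)) / 2 * exp (z\<^sup>2/2) * cerfc (z / of_real (sqrt 2))"
proof -
  define f where "f u = exp (of_real (- u\<^sup>2/2) + z * of_real u) * of_real (indicator {..0} u)" for u :: real
  have fi: "integrable lborel f"
  proof (rule Bochner_Integration.integrable_bound)
    show "integrable lborel (\<lambda>t::real. exp (of_real (- t\<^sup>2/2) + z * of_real t))"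
      using gauss_complex_1d[of z] by (simp add: has_bochner_integral_iff)
    show "f \<in> borel_measurable lborel" unfolding f_def by measurable
    show "AE x in lborel. norm (f x) \<le> norm (exp (of_real (- x\<^sup>2/2) + z * of_real x))"
      by (auto simp: f_def norm_mult indicator_def)
  qed
  define w where "w = z / of_real (sqrt 2)"
  have zw: "z = of_real (sqrt 2) * w" by (simp add: w_def)
  have s2: "complex_of_real (sqrt 2) * complex_of_real (sqrt 2) = 2"
    by (metis of_real_mult of_real_numeral real_sqrt_mult_self abs_numeral)
  have fe: "f (0 + (- sqrt 2) * s) = exp (z\<^sup>2/2) * (indicator {0..} s *\<^sub>R exp (- ((w + of_real s)\<^sup>2)))" for s
  proof -
    have "of_real (- (0 + (- sqrt 2) * s)\<^sup>2/2) + z * of_real (0 + (- sqrt 2) * s) = z\<^sup>2/2 + - ((w + of_real s)\<^sup>2)"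
    proof -
      have p1: "of_real (- (0 + (- sqrt 2) * s)\<^sup>2/2) = - (complex_of_real s)\<^sup>2" by (simp add: power_mult_distrib)
      have p2: "z * of_real (0 + (- sqrt 2) * s) = - (complex_of_real (sqrt 2) * complex_of_real (sqrt 2)) * w * of_real s"
        by (simp add: zw)
      have p3: "z\<^sup>2/2 = w\<^sup>2"
      proof -
        have "z\<^sup>2 = (complex_of_real (sqrt 2) * complex_of_real (sqrt 2)) * w\<^sup>2"
          by (simp only: zw power2_eq_square mult_ac)
        then show ?thesis unfolding s2 by simp
      qed
      show ?thesis unfolding p1 p2 p3 s2 by (simp add: power2_eq_square algebra_simps)
    qed
    moreover have "indicator {..0} (0 + (- sqrt 2) * s) = (indicator {0..} s :: real)"
      by (auto simp: indicator_def zero_le_mult_iff)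
    ultimately show ?thesis unfolding f_def
      by (simp only: exp_add scaleR_conv_of_real mult_ac)
  qed
  have "integrable lborel (\<lambda>s. f (0 + (- sqrt 2) * s))"
    by (rule lborel_integrable_real_affine[OF fi]) simp
  then have "integrable lborel (\<lambda>s. exp (- z\<^sup>2/2) * f (0 + (- sqrt 2) * s))" by (rule integrable_mult_right)
  moreover have "exp (- z\<^sup>2/2) * f (0 + (- sqrt 2) * s) = indicator {0..} s *\<^sub>R exp (- ((w + of_real s)\<^sup>2))" for s
    unfolding fe mult.assoc[symmetric] exp_add[symmetric] by simp
  ultimately have si: "set_integrable lborel {0..} (\<lambda>s. exp (- ((w + of_real s)\<^sup>2)))"
    unfolding set_integrable_def by simp
  have "integral\<^sup>L lborel f = sqrt 2 *\<^sub>R (\<integral>s. f (0 + (- sqrt 2) * s) \<partial>lborel)"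
    using lborel_integral_real_affine[of "- sqrt 2" f 0] by simp
  also have "(\<integral>s. f (0 + (- sqrt 2) * s) \<partial>lborel) = exp (z\<^sup>2/2) * (LINT s:{0..}|lborel. exp (- ((w + of_real s)\<^sup>2)))"
    unfolding fe integral_mult_right_zero set_lebesgue_integral_def ..
  also have "(LINT s:{0..}|lborel. exp (- ((w + of_real s)\<^sup>2))) = integral {0..} (\<lambda>s. exp (- ((w + of_real s)\<^sup>2)))"
    by (rule set_borel_integral_eq_integral(2)[OF si])
  also have "\<dots> = of_real (sqrt pi / 2) * cerfc w"
    by (simp add: cerfc_def)
  also have "sqrt 2 *\<^sub>R (exp (z\<^sup>2/2) * (of_real (sqrt pi / 2) * cerfc w)) = of_real (sqrt (2*pi)) / 2 * exp (z\<^sup>2/2) * cerfc (z / of_real (sqrt 2))"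
    by (simp add: w_def scaleR_conv_of_real real_sqrt_mult)
  finally show ?thesis by (simp add: f_def[abs_def])
qed

text \<open>The orthogonal projection of the conjugate kernel onto the functions carried by the
  half-space. The cut-off makes it vanish at every point with x . v > 0, not merely almost
  everywhere.\<close>

definition half_fun :: "real^'n \<Rightarrow> complex^'n \<Rightarrow> real^'n \<Rightarrow> complex" where
  "half_fun v \<eta> x = cnj (bargmann_kernel \<eta> x) * of_real (indicator {..0} (x \<bullet> v))"

lemma L2_half_fun: "L2 (half_fun v \<eta>)"
  unfolding L2_def
proof
  show m: "half_fun v \<eta> \<in> borel_measurable lborel" unfolding half_fun_def by measurable
  then have [measurable]: "half_fun v \<eta> \<in> borel_measurable borel" by simp
  show "integrable lborel (\<lambda>x. (cmod (half_fun v \<eta> x))\<^sup>2)"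
    by (rule Bochner_Integration.integrable_bound[OF bargmann_kernel_L2[of \<eta>]])
       (auto simp: half_fun_def norm_mult indicator_def)
qed

text \<open>With the indicator of the negative half line as \<open>\<psi>\<close>,
  \<open>gauss_slice\<close> reduces the integral to \<open>gauss_half_line\<close>. The factor exp
  (- z^2/2) of the slice cancels exp (z^2/2) of the half line, so \<open>v\<close> survives only
  inside the error function.\<close>

lemma half_kernel_eq_bargmann:
  fixes v :: "real^'n"
  assumes v: "norm v = 1"
  shows "half_kernel v \<xi> \<eta> = bargmann (half_fun v \<eta>) \<xi>"
proof -
  let ?l = "\<lambda>x. cdot \<xi> (cvec x) + cnj (cdot \<eta> (cvec x))"
  let ?\<psi> = "\<lambda>u::real. complex_of_real (indicator {..0} u)"
  define z where "z = ?l v"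
  have z: "z = cdot \<xi> (cvec v) + cdot (cvec v) \<eta>" by (simp add: z_def cnj_cdot)
  have "(\<integral>x. exp (of_real (- (norm x)\<^sup>2/2) + ?l x) * ?\<psi> (x \<bullet> v) \<partial>lborel)
    = of_real (sqrt (2*pi) ^ DIM(real^'n)) * exp ((\<Sum>b\<in>Basis. (?l b)\<^sup>2)/2) * (exp (- z\<^sup>2/2) / of_real (sqrt (2*pi)))
      * (\<integral>u. exp (of_real (- u\<^sup>2/2) + z * of_real u) * ?\<psi> u \<partial>lborel)"
    unfolding z_def by (rule gauss_slice[OF linear_kernel_exponent v]) (auto simp: indicator_def)
  also have "\<dots> = of_real (sqrt (2*pi) ^ CARD('n)) * exp ((csq \<xi> + cnj (csq \<eta>))/2 + cdot \<xi> \<eta>)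
      * ((exp (- z\<^sup>2/2) * exp (z\<^sup>2/2)) * (1/2 * cerfc (z / of_real (sqrt 2))))"
    unfolding gauss_half_line kernel_exponent_sum by simp
  also have "exp (- z\<^sup>2/2) * exp (z\<^sup>2/2) = 1" unfolding exp_add[symmetric] by simp
  finally have I: "(\<integral>x. exp (of_real (- (norm x)\<^sup>2/2) + ?l x) * ?\<psi> (x \<bullet> v) \<partial>lborel)
    = of_real (sqrt (2*pi) ^ CARD('n)) * exp ((csq \<xi> + cnj (csq \<eta>))/2 + cdot \<xi> \<eta>) * (1/2 * cerfc (z / of_real (sqrt 2)))"
    by simp
  have "half_fun v \<eta> x * bargmann_kernel \<xi> x = of_real ((bargmann_const CARD('n))\<^sup>2) * exp (- (csq \<xi> + cnj (csq \<eta>))/2)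
     * (exp (of_real (- (norm x)\<^sup>2/2) + ?l x) * ?\<psi> (x \<bullet> v))" for x
  proof -
    have "half_fun v \<eta> x * bargmann_kernel \<xi> x = (bargmann_kernel \<xi> x * cnj (bargmann_kernel \<eta> x)) * ?\<psi> (x \<bullet> v)"
      by (simp only: half_fun_def mult_ac)
    then show ?thesis unfolding bargmann_kernel_product by (simp only: mult.assoc)
  qed
  then have "bargmann (half_fun v \<eta>) \<xi> = of_real ((bargmann_const CARD('n))\<^sup>2) * exp (- (csq \<xi> + cnj (csq \<eta>))/2)
      * (of_real (sqrt (2*pi) ^ CARD('n)) * exp ((csq \<xi> + cnj (csq \<eta>))/2 + cdot \<xi> \<eta>) * (1/2 * cerfc (z / of_real (sqrt 2))))"
    unfolding bargmann_eq by (simp only: integral_mult_right_zero I)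
  also have "\<dots> = of_real ((bargmann_const CARD('n))\<^sup>2 * sqrt (2*pi) ^ CARD('n)) * (exp (- (csq \<xi> + cnj (csq \<eta>))/2) * exp ((csq \<xi> + cnj (csq \<eta>))/2 + cdot \<xi> \<eta>)) * (1/2 * cerfc (z / of_real (sqrt 2)))"
    by (simp only: of_real_mult mult_ac)
  also have "exp (- (csq \<xi> + cnj (csq \<eta>))/2) * exp ((csq \<xi> + cnj (csq \<eta>))/2 + cdot \<xi> \<eta>) = exp (cdot \<xi> \<eta>)"
    unfolding exp_add[symmetric] by (rule arg_cong[where f=exp]) (simp add: field_simps)
  finally show ?thesis unfolding bargmann_const_square half_kernel_def z by simp
qed

section \<open>The reproducing formula of the Fock space\<close>

lemma fock_space_L2:
  assumes "f \<in> fock_space"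
  shows "entire_md f" and "integrable lborel (\<lambda>\<xi>. (cmod (f \<xi>))\<^sup>2 * exp (- (norm \<xi>)\<^sup>2))"
proof -
  show e: "entire_md f" using assms by (simp add: fock_space_def)
  have [measurable]: "f \<in> borel_measurable borel" by (rule entire_md_measurable[OF e])
  show "integrable lborel (\<lambda>\<xi>. (cmod (f \<xi>))\<^sup>2 * exp (- (norm \<xi>)\<^sup>2))"
    by (rule integrableI_bounded) (use assms in \<open>auto simp: fock_space_def\<close>)
qed

lemma continuous_on_cdot_right: "continuous_on UNIV (\<lambda>\<xi>. cdot \<eta> \<xi>)"
  unfolding cdot_def by (intro continuous_intros)

text \<open>The Gaussian mean value property for the Weyl translate \<open>\<xi> \<mapsto> f (\<xi> + \<eta>) exp (- \<xi> \<cdot> \<eta>)\<close>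
  is the reproducing formula of the Fock space.\<close>

lemma fock_reproducing:
  fixes f :: "complex^'n \<Rightarrow> complex"
  assumes f: "f \<in> fock_space"
  shows "integrable lborel (\<lambda>\<xi>. f \<xi> * exp (cdot \<eta> \<xi>) * of_real (exp (- (norm \<xi>)\<^sup>2)))"
    and "(\<integral>\<xi>. f \<xi> * exp (cdot \<eta> \<xi>) * of_real (exp (- (norm \<xi>)\<^sup>2)) \<partial>lborel) = of_real (pi ^ CARD('n)) * f \<eta>"
proof -
  have e: "entire_md f" and f2: "integrable lborel (\<lambda>\<xi>. (cmod (f \<xi>))\<^sup>2 * exp (- (norm \<xi>)\<^sup>2))"
    using fock_space_L2[OF f] by auto
  have [measurable]: "f \<in> borel_measurable borel" by (rule entire_md_measurable[OF e])
  have [measurable]: "(\<lambda>\<xi>::complex^'n. cdot \<eta> \<xi>) \<in> borel_measurable borel"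
    by (rule borel_measurable_continuous_onI[OF continuous_on_cdot_right])
  have hh: "(exp (- (norm \<xi>)\<^sup>2/2))\<^sup>2 = exp (- (norm \<xi>)\<^sup>2)" for \<xi> :: "complex^'n"
    by (simp add: power2_eq_square[of "exp _"] exp_add[symmetric])
  have sq: "- (norm (\<xi> + \<zeta>))\<^sup>2 = - (norm \<xi>)\<^sup>2 - (norm \<zeta>)\<^sup>2 - 2 * Re (cdot \<zeta> \<xi>)" for \<xi> \<zeta> :: "complex^'n"
  proof -
    have "complex_of_real ((norm (\<xi> + \<zeta>))\<^sup>2) = of_real ((norm \<xi>)\<^sup>2) + of_real ((norm \<zeta>)\<^sup>2) + (cdot \<zeta> \<xi> + cnj (cdot \<zeta> \<xi>))"
      unfolding cdot_self[symmetric] cdot_add cnj_cdot by (simp only: add_ac)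
    also have "cdot \<zeta> \<xi> + cnj (cdot \<zeta> \<xi>) = of_real (2 * Re (cdot \<zeta> \<xi>))" by (simp add: complex_add_cnj)
    finally have "(norm (\<xi> + \<zeta>))\<^sup>2 = (norm \<xi>)\<^sup>2 + (norm \<zeta>)\<^sup>2 + 2 * Re (cdot \<zeta> \<xi>)"
      by (simp only: of_real_add[symmetric] of_real_eq_iff)
    then show ?thesis by linarith
  qed
  \<comment> \<open>Half of the Gaussian weight goes to \<open>f\<close> and half to the
    exponential, and each of the two factors is square integrable.\<close>
  have "integrable lborel (\<lambda>\<xi>. (f \<xi> * of_real (exp (- (norm \<xi>)\<^sup>2/2))) * (exp (cdot \<eta> \<xi>) * of_real (exp (- (norm \<xi>)\<^sup>2/2))))"
  proof (rule integrable_mult_L2(1))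
    have "(cmod (f \<xi> * of_real (exp (- (norm \<xi>)\<^sup>2/2))))\<^sup>2 = (cmod (f \<xi>))\<^sup>2 * exp (- (norm \<xi>)\<^sup>2)" for \<xi>
      unfolding hh[symmetric] by (simp add: norm_mult power_mult_distrib)
    then show "integrable lborel (\<lambda>\<xi>. (cmod (f \<xi> * of_real (exp (- (norm \<xi>)\<^sup>2/2))))\<^sup>2)" using f2 by simp
    \<comment> \<open>Completing the square: 2 Re (\<eta> . \<xi>) - |\<xi>|^2 = |\<eta>|^2 - |\<xi>
      - \<eta>|^2.\<close>
    have "integrable lborel (\<lambda>\<xi>::complex^'n. exp ((norm \<eta>)\<^sup>2) * exp (- 1 * (norm (- \<eta> + \<xi>))\<^sup>2))"
      by (intro integrable_mult_right lborel_integrable_shift[OF integrable_gauss]) simp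
    moreover have "(cmod (exp (cdot \<eta> \<xi>) * of_real (exp (- (norm \<xi>)\<^sup>2/2))))\<^sup>2 = exp ((norm \<eta>)\<^sup>2) * exp (- 1 * (norm (- \<eta> + \<xi>))\<^sup>2)" for \<xi>
    proof -
      have "(cmod (exp (cdot \<eta> \<xi>) * of_real (exp (- (norm \<xi>)\<^sup>2/2))))\<^sup>2 = exp (2 * Re (cdot \<eta> \<xi>)) * exp (- (norm \<xi>)\<^sup>2)"
        unfolding hh[symmetric] exp_double
        by (simp only: norm_mult norm_exp_eq_Re norm_of_real abs_exp_cancel power_mult_distrib)
      moreover have "Re (cdot (- \<eta>) \<xi>) = - Re (cdot \<eta> \<xi>)" by (simp add: cdot_def sum_negf)
      then have "(norm \<eta>)\<^sup>2 + - 1 * (norm (- \<eta> + \<xi>))\<^sup>2 = 2 * Re (cdot \<eta> \<xi>) + - (norm \<xi>)\<^sup>2"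
        using sq[of \<xi> "- \<eta>"] by (simp add: norm_minus_commute)
      ultimately show ?thesis by (simp only: exp_add[symmetric])
    qed
    ultimately show "integrable lborel (\<lambda>\<xi>. (cmod (exp (cdot \<eta> \<xi>) * of_real (exp (- (norm \<xi>)\<^sup>2/2))))\<^sup>2)" by (simp only:)
  qed measurable
  moreover have "(f \<xi> * of_real (exp (- (norm \<xi>)\<^sup>2/2))) * (exp (cdot \<eta> \<xi>) * of_real (exp (- (norm \<xi>)\<^sup>2/2))) = f \<xi> * exp (cdot \<eta> \<xi>) * of_real (exp (- (norm \<xi>)\<^sup>2))" for \<xi>
    unfolding hh[symmetric] by (simp add: power2_eq_square)
  ultimately show i: "integrable lborel (\<lambda>\<xi>. f \<xi> * exp (cdot \<eta> \<xi>) * of_real (exp (- (norm \<xi>)\<^sup>2)))" by (simp only:)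
  \<comment> \<open>|\<eta> + \<xi>|^2 expands into four pairings. The factor exp (\<eta> . (\<eta>
    + \<xi>)) cancels the constant one and the one antiholomorphic in \<xi>, which leaves the
    holomorphic factor exp (- \<xi> . \<eta>) beside the Gaussian.\<close>
  have sh: "f (\<eta> + \<xi>) * exp (cdot \<eta> (\<eta> + \<xi>)) * of_real (exp (- (norm (\<eta> + \<xi>))\<^sup>2)) = (f (\<xi> + \<eta>) * exp ((-1) * cdot \<xi> \<eta>)) * of_real (exp (- (norm \<xi>)\<^sup>2))" for \<xi>
  proof -
    have "cdot \<eta> (\<eta> + \<xi>) + of_real (- (norm (\<eta> + \<xi>))\<^sup>2) = (-1) * cdot \<xi> \<eta> + of_real (- (norm \<xi>)\<^sup>2)"
    proof -
      have "of_real ((norm (\<eta> + \<xi>))\<^sup>2) = cdot (\<eta> + \<xi>) (\<eta> + \<xi>)" "of_real ((norm \<xi>)\<^sup>2) = cdot \<xi> \<xi>" by (simp_all only: cdot_self)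
      then show ?thesis unfolding of_real_minus by (simp add: cdot_add)
    qed
    then have "exp (cdot \<eta> (\<eta> + \<xi>)) * exp (of_real (- (norm (\<eta> + \<xi>))\<^sup>2)) = exp ((-1) * cdot \<xi> \<eta>) * exp (of_real (- (norm \<xi>)\<^sup>2))"
      unfolding exp_add[symmetric] by (simp only:)
    then show ?thesis unfolding exp_of_real by (simp add: mult.assoc add.commute)
  qed
  have ent: "entire_md (\<lambda>\<xi>. f (\<xi> + \<eta>) * exp ((-1) * cdot \<xi> \<eta>))"
    by (intro entire_md_mult entire_md_translate[OF e] entire_md_exp entire_md_const entire_md_cdot)
  have "integrable lborel (\<lambda>\<xi>. (f (\<xi> + \<eta>) * exp ((-1) * cdot \<xi> \<eta>)) * of_real (exp (- (norm \<xi>)\<^sup>2)))"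
    using lborel_integrable_shift[OF i, of \<eta>] unfolding sh .
  from gaussian_mean_value[OF ent this]
  have "(\<integral>\<xi>. (f (\<xi> + \<eta>) * exp ((-1) * cdot \<xi> \<eta>)) * of_real (exp (- (norm \<xi>)\<^sup>2)) \<partial>lborel) = of_real (pi ^ CARD('n)) * f \<eta>"
    by (simp add: cdot_def)
  then show "(\<integral>\<xi>. f \<xi> * exp (cdot \<eta> \<xi>) * of_real (exp (- (norm \<xi>)\<^sup>2)) \<partial>lborel) = of_real (pi ^ CARD('n)) * f \<eta>"
    using lborel_integral_shift[OF i, of \<eta>] unfolding sh by simp
qed

section \<open>Surjectivity of the Bargmann transform\<close>

text \<open>Uniform in \<xi> on a ball, this is the majorant in \<open>x\<close> behind the
  truncated adjoint. The rate 1/8 comes from |x/2|^2 \<le> 2 |a|^2 + 2 |a - x/2|^2 with a = Re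
  \<xi>.\<close>

lemma bargmann_kernel_bound:
  fixes \<xi> :: "complex^'n"
  assumes "norm \<xi> \<le> R"
  shows "cmod (bargmann_kernel \<xi> x) * exp (- (norm \<xi>)\<^sup>2) \<le> bargmann_const CARD('n) * exp (R\<^sup>2) * exp (- (1/8) * (norm x)\<^sup>2)"
proof -
  define a where "a = cre \<xi>"
  have "(norm a)\<^sup>2 \<le> (norm \<xi>)\<^sup>2"
    using norm_cpair[of a "cim \<xi>"] by (simp add: a_def)
  also have "\<dots> \<le> R\<^sup>2" using assms by (intro power_mono) auto
  finally have aR: "(norm a)\<^sup>2 \<le> R\<^sup>2" .
  define d where "d = norm (a - (1/2) *\<^sub>R x)"
  have "(1/2) *\<^sub>R x = a - (a - (1/2) *\<^sub>R x)" by simp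
  then have "norm ((1/2) *\<^sub>R x) \<le> norm a + d" unfolding d_def using norm_triangle_ineq4[of a "a - (1/2) *\<^sub>R x"] by metis
  then have "norm x / 2 \<le> norm a + d" by simp
  then have "(norm x / 2)\<^sup>2 \<le> (norm a + d)\<^sup>2" by (intro power_mono) auto
  also have "\<dots> \<le> 2 * (norm a)\<^sup>2 + 2 * d\<^sup>2"
    using sum_squares_bound[of "norm a" d] by (simp add: power2_sum)
  finally have "- d\<^sup>2 \<le> R\<^sup>2 + - (1/8) * (norm x)\<^sup>2" using aR by (simp add: power_divide)
  then have e: "exp (- d\<^sup>2) \<le> exp (R\<^sup>2) * exp (- (1/8) * (norm x)\<^sup>2)" unfolding exp_add[symmetric] by simp
  have "exp ((norm \<xi>)\<^sup>2/2) * exp (- (norm \<xi>)\<^sup>2) \<le> 1" unfolding exp_add[symmetric] by simp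
  moreover have "cmod (bargmann_kernel \<xi> x) * exp (- (norm \<xi>)\<^sup>2) = bargmann_const CARD('n) * (exp ((norm \<xi>)\<^sup>2/2) * exp (- (norm \<xi>)\<^sup>2)) * exp (- d\<^sup>2)"
    unfolding cmod_bargmann_kernel d_def a_def by (simp only: mult_ac)
  ultimately have "cmod (bargmann_kernel \<xi> x) * exp (- (norm \<xi>)\<^sup>2) \<le> bargmann_const CARD('n) * 1 * exp (- d\<^sup>2)"
    using bargmann_const_pos[of "CARD('n)"] by (auto intro!: mult_right_mono mult_left_mono)
  also have "\<dots> \<le> bargmann_const CARD('n) * 1 * (exp (R\<^sup>2) * exp (- (1/8) * (norm x)\<^sup>2))"
    using bargmann_const_pos[of "CARD('n)"] e by (intro mult_left_mono) auto
  finally show ?thesis by (simp add: mult.assoc)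
qed

text \<open>\<open>g\<close> is the adjoint of the Bargmann transform applied to \<open>f\<close> truncated to \<open>E\<close>; the norm
  bound holds because the transform itself is a contraction.\<close>

lemma bargmann_adjoint_truncated:
  fixes f :: "complex^'n \<Rightarrow> complex"
  assumes f: "f \<in> fock_space" and E[measurable]: "E \<in> sets borel" and ER: "E \<subseteq> ball 0 R"
  obtains g where "L2 g"
    "(\<integral>x. (cmod (g x))\<^sup>2 \<partial>lborel) \<le> (\<integral>\<xi>. indicator E \<xi> * ((cmod (f \<xi>))\<^sup>2 * exp (- (norm \<xi>)\<^sup>2)) \<partial>lborel) / pi ^ CARD('n)"
    "\<And>\<eta>. bargmann g \<eta> = of_real (1 / pi ^ CARD('n)) * (LINT \<xi>:E|lborel. f \<xi> * exp (cdot \<eta> \<xi>) * of_real (exp (- (norm \<xi>)\<^sup>2)))"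
proof -
  have e: "entire_md f" and f2: "integrable lborel (\<lambda>\<xi>. (cmod (f \<xi>))\<^sup>2 * exp (- (norm \<xi>)\<^sup>2))"
    using fock_space_L2[OF f] by auto
  have fc: "continuous_on UNIV f" by (rule entire_md_continuous[OF e])
  have [measurable]: "f \<in> borel_measurable borel" by (rule entire_md_measurable[OF e])
  define p where "p = 1 / pi ^ CARD('n)"
  have p0: "p > 0" by (simp add: p_def)
  \<comment> \<open>The truncation pays here: a continuous function is bounded on a closed ball,
    whereas \<open>f\<close> itself may grow.\<close>
  have "bounded (f ` cball 0 R)"
    by (intro compact_imp_bounded compact_continuous_image continuous_on_subset[OF fc]) auto
  then obtain M where M: "\<And>\<xi>. \<xi> \<in> cball 0 R \<Longrightarrow> cmod (f \<xi>) \<le> M" unfolding bounded_iff by blast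
  have Ei: "integrable lborel (indicator E :: _ \<Rightarrow> real)"
  proof (rule integrable_real_indicator)
    have "emeasure lborel E \<le> emeasure lborel (ball (0::complex^'n) R)" by (rule emeasure_mono[OF ER]) simp
    also have "\<dots> < \<infinity>" by (rule emeasure_lborel_ball_finite)
    finally show "emeasure lborel E < \<infinity>" .
  qed simp
  define c where "c = bargmann_const CARD('n)"
  define A where "A = \<bar>M\<bar> * (c * exp (R\<^sup>2))"
  have A0: "A \<ge> 0" using bargmann_const_pos[of "CARD('n)"] by (simp add: A_def c_def)
  define fE where "fE \<xi> = indicator E \<xi> *\<^sub>R (f \<xi> * of_real (exp (- (norm \<xi>)\<^sup>2)))" for \<xi>
  have [measurable]: "fE \<in> borel_measurable borel" unfolding fE_def by measurable
  define \<gamma> where "\<gamma> x = exp (- (1/8) * (norm x)\<^sup>2)" for x :: "real^'n"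
  have [measurable]: "\<gamma> \<in> borel_measurable borel" unfolding \<gamma>_def by measurable
  define \<Phi> where "\<Phi> \<xi> x = fE \<xi> * cnj (bargmann_kernel \<xi> x)" for \<xi> x
  have \<Phi>m: "(\<lambda>z. \<Phi> (fst z) (snd z)) \<in> borel_measurable (borel \<Otimes>\<^sub>M borel)"
    unfolding \<Phi>_def by measurable
  have \<Phi>b: "cmod (\<Phi> \<xi> x) \<le> indicator E \<xi> * (A * \<gamma> x)" for \<xi> x
  proof (cases "\<xi> \<in> E")
    case True
    then have n: "norm \<xi> \<le> R" using ER by auto
    then have "cmod (f \<xi>) \<le> \<bar>M\<bar>" using M[of \<xi>] by simp
    have "cmod (\<Phi> \<xi> x) = cmod (f \<xi>) * (cmod (bargmann_kernel \<xi> x) * exp (- (norm \<xi>)\<^sup>2))"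
      using True by (simp add: \<Phi>_def fE_def norm_mult)
    also have "\<dots> \<le> \<bar>M\<bar> * (c * exp (R\<^sup>2) * \<gamma> x)"
      unfolding c_def \<gamma>_def by (rule mult_mono[OF \<open>cmod (f \<xi>) \<le> \<bar>M\<bar>\<close> bargmann_kernel_bound[OF n]]) auto
    finally show ?thesis using True by (simp add: A_def mult.assoc)
  qed (simp add: \<Phi>_def fE_def)
  define g where "g x = of_real p * (\<integral>\<xi>. \<Phi> \<xi> x \<partial>lborel)" for x
  have gm[measurable]: "g \<in> borel_measurable borel"
  proof -
    have "(\<lambda>x. \<integral>\<xi>. \<Phi> \<xi> x \<partial>lborel) \<in> borel_measurable lborel"
      unfolding \<Phi>_def by (rule lborel.borel_measurable_lebesgue_integral) measurable
    then show ?thesis unfolding g_def by simp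
  qed
  define B where "B = p * ((\<integral>\<xi>. indicator E \<xi> \<partial>lborel) * A)"
  have gb: "cmod (g x) \<le> B * \<gamma> x" for x
  proof -
    have "cmod (\<integral>\<xi>. \<Phi> \<xi> x \<partial>lborel) \<le> (\<integral>\<xi>. indicator E \<xi> * (A * \<gamma> x) \<partial>lborel)"
      by (rule order_trans[OF integral_norm_bound integral_mono'])
         (use Ei \<Phi>b A0 in \<open>auto simp: \<gamma>_def\<close>)
    then show ?thesis using p0 by (simp add: g_def B_def norm_mult mult.assoc)
  qed
  have \<gamma>2: "integrable lborel (\<lambda>x. (\<gamma> x)\<^sup>2)"
    using integrable_gauss[of "1/4", where 'a="real^'n"] by (simp add: \<gamma>_def power2_eq_square[of "exp _"] exp_add[symmetric])
  have L2g: "L2 g"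
  proof -
    have "(cmod (g x))\<^sup>2 \<le> B\<^sup>2 * (\<gamma> x)\<^sup>2" for x
      using power_mono[OF gb[of x], of 2] by (simp add: power_mult_distrib)
    then have "integrable lborel (\<lambda>x. (cmod (g x))\<^sup>2)"
      by (intro Bochner_Integration.integrable_bound[OF integrable_mult_right[OF \<gamma>2, of "B\<^sup>2"]]) auto
    then show ?thesis by (simp add: L2_def)
  qed
  \<comment> \<open>The duality between \<open>g\<close> and the transform. Taking for
    \<open>q\<close> the kernel at \<eta> yields the formula for \<open>bargmann g\<close>, taking
    the conjugate of \<open>g\<close> yields the norm bound.\<close>
  have swap: "(\<integral>x. q x * g x \<partial>lborel) = of_real p * (\<integral>\<xi>. fE \<xi> * (\<integral>x. q x * cnj (bargmann_kernel \<xi> x) \<partial>lborel) \<partial>lborel)"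
    if q: "L2 q" for q
  proof -
    have [measurable]: "q \<in> borel_measurable borel" by (rule L2_borel[OF q])
    have qi: "integrable lborel (\<lambda>x. q x * of_real (\<gamma> x))"
      by (rule integrable_mult_L2(1)) (use q \<gamma>2 in \<open>auto simp: L2_def\<close>)
    have qn: "integrable lborel (\<lambda>x. cmod (q x) * \<gamma> x)"
      using integrable_norm[OF qi] by (simp add: norm_mult \<gamma>_def)
    have qb: "cmod (q x * \<Phi> \<xi> x) \<le> indicator E \<xi> * A * (cmod (q x) * \<gamma> x)" for \<xi> x
      using mult_left_mono[OF \<Phi>b[of \<xi> x], of "cmod (q x)"] by (simp add: norm_mult mult_ac)
    have "(\<integral>\<xi>. (\<integral>x. q x * \<Phi> \<xi> x \<partial>lborel) \<partial>lborel) = (\<integral>x. (\<integral>\<xi>. q x * \<Phi> \<xi> x \<partial>lborel) \<partial>lborel)"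
    proof (rule lborel_Fubini(4)[where g="\<lambda>\<xi>. indicator E \<xi> * (A * (\<integral>x. cmod (q x) * \<gamma> x \<partial>lborel))"])
      show "(\<lambda>(\<xi>, x). q x * \<Phi> \<xi> x) \<in> borel_measurable (lborel \<Otimes>\<^sub>M lborel)"
        unfolding \<Phi>_def by measurable
      show I: "integrable lborel (\<lambda>x. q x * \<Phi> \<xi> x)" for \<xi>
      proof (rule Bochner_Integration.integrable_bound[OF integrable_mult_right[OF qn, of "indicator E \<xi> * A"]])
        show "(\<lambda>x. q x * \<Phi> \<xi> x) \<in> borel_measurable lborel" unfolding \<Phi>_def by measurable
        show "AE x in lborel. norm (q x * \<Phi> \<xi> x) \<le> norm (indicator E \<xi> * A * (cmod (q x) * \<gamma> x))"
          unfolding real_norm_def by (intro AE_I2 order_trans[OF qb abs_ge_self])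
      qed
      show "integrable lborel (\<lambda>\<xi>. indicator E \<xi> * (A * (\<integral>x. cmod (q x) * \<gamma> x \<partial>lborel)))" using Ei by simp
      show "(\<integral>x. norm (q x * \<Phi> \<xi> x) \<partial>lborel) \<le> indicator E \<xi> * (A * (\<integral>x. cmod (q x) * \<gamma> x \<partial>lborel))" for \<xi>
      proof -
        have "(\<integral>x. norm (q x * \<Phi> \<xi> x) \<partial>lborel) \<le> (\<integral>x. indicator E \<xi> * A * (cmod (q x) * \<gamma> x) \<partial>lborel)"
          by (intro integral_mono integrable_norm I integrable_mult_right qn qb)
        then show ?thesis by (simp add: mult.assoc)
      qed
    qed
    moreover have "(\<integral>x. (\<integral>\<xi>. q x * \<Phi> \<xi> x \<partial>lborel) \<partial>lborel) * of_real p = (\<integral>x. q x * g x \<partial>lborel)"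
    proof -
      have "q x * g x = (\<integral>\<xi>. q x * \<Phi> \<xi> x \<partial>lborel) * of_real p" for x
        by (simp add: g_def)
      then show ?thesis by (simp only: integral_mult_left_zero)
    qed
    moreover have "(\<integral>x. q x * \<Phi> \<xi> x \<partial>lborel) = fE \<xi> * (\<integral>x. q x * cnj (bargmann_kernel \<xi> x) \<partial>lborel)" for \<xi>
    proof -
      have "q x * \<Phi> \<xi> x = fE \<xi> * (q x * cnj (bargmann_kernel \<xi> x))" for x by (simp only: \<Phi>_def mult_ac)
      then show ?thesis by (simp only: integral_mult_right_zero)
    qed
    ultimately show ?thesis by (simp only: mult.commute[of _ "of_real p"])
  qed
  have L2k: "L2 (bargmann_kernel \<eta>)" for \<eta> :: "complex^'n"
    using bargmann_kernel_L2[of \<eta>] by (simp add: L2_def)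
  have bg: "bargmann g \<eta> = of_real (1 / pi ^ CARD('n)) * (LINT \<xi>:E|lborel. f \<xi> * exp (cdot \<eta> \<xi>) * of_real (exp (- (norm \<xi>)\<^sup>2)))" for \<eta>
  proof -
    have "bargmann g \<eta> = (\<integral>x. bargmann_kernel \<eta> x * g x \<partial>lborel)" by (simp add: bargmann_eq mult.commute)
    also have "\<dots> = of_real p * (\<integral>\<xi>. fE \<xi> * exp (cdot \<eta> \<xi>) \<partial>lborel)"
      unfolding swap[OF L2k] bargmann_kernel_inner ..
    also have "(\<lambda>\<xi>. fE \<xi> * exp (cdot \<eta> \<xi>)) = (\<lambda>\<xi>. indicator E \<xi> *\<^sub>R (f \<xi> * exp (cdot \<eta> \<xi>) * of_real (exp (- (norm \<xi>)\<^sup>2))))"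
      by (auto simp: fE_def fun_eq_iff)
    finally show ?thesis by (simp add: p_def set_lebesgue_integral_def)
  qed
  have le: "(\<integral>x. (cmod (g x))\<^sup>2 \<partial>lborel) \<le> (\<integral>\<xi>. indicator E \<xi> * ((cmod (f \<xi>))\<^sup>2 * exp (- (norm \<xi>)\<^sup>2)) \<partial>lborel) / pi ^ CARD('n)"
  proof -
    define N where "N = (\<integral>x. (cmod (g x))\<^sup>2 \<partial>lborel)"
    define T where "T = (\<integral>\<xi>. indicator E \<xi> * ((cmod (f \<xi>))\<^sup>2 * exp (- (norm \<xi>)\<^sup>2)) \<partial>lborel)"
    have L2cg: "L2 (\<lambda>x. cnj (g x))" using L2g by (simp add: L2_def)
    have [measurable]: "bargmann g \<in> borel_measurable borel"
      by (rule entire_md_measurable[OF entire_md_bargmann[OF L2g]])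
    have Bi: "integrable lborel (\<lambda>\<xi>. (cmod (bargmann g \<xi>))\<^sup>2 * exp (- (norm \<xi>)\<^sup>2))"
      and Bv: "(\<integral>\<xi>. (cmod (bargmann g \<xi>))\<^sup>2 * exp (- (norm \<xi>)\<^sup>2) \<partial>lborel) = pi ^ CARD('n) * N"
      using bargmann_isometry(1)[OF L2g] by (auto simp: has_bochner_integral_iff N_def)
    have Ti: "integrable lborel (\<lambda>\<xi>. indicator E \<xi> * ((cmod (f \<xi>))\<^sup>2 * exp (- (norm \<xi>)\<^sup>2)))"
      by (rule Bochner_Integration.integrable_bound[OF f2]) (auto simp: indicator_def)
    have cg: "(\<integral>x. cnj (g x) * cnj (bargmann_kernel \<xi> x) \<partial>lborel) = cnj (bargmann g \<xi>)" for \<xi>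
      unfolding bargmann_eq complex_cnj_mult[symmetric] by (rule Bochner_Integration.integral_cnj)
    have "complex_of_real N = (\<integral>x. of_real ((cmod (g x))\<^sup>2) \<partial>lborel)" unfolding N_def by (rule integral_complex_of_real[symmetric])
    also have "\<dots> = (\<integral>x. cnj (g x) * g x \<partial>lborel)"
      by (simp only: complex_norm_square mult.commute)
    also have "\<dots> = of_real p * (\<integral>\<xi>. fE \<xi> * cnj (bargmann g \<xi>) \<partial>lborel)"
      unfolding swap[OF L2cg] cg ..
    finally have "cmod (complex_of_real N) = p * cmod (\<integral>\<xi>. fE \<xi> * cnj (bargmann g \<xi>) \<partial>lborel)"
      using p0 by (simp add: norm_mult)
    \<comment> \<open>The inequality of arithmetic and geometric means bounds the squared norm N of
      \<open>g\<close> by (p T + N)/2, since the transform of \<open>g\<close> has the same squared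
      norm N; absorbing N/2 on the left gives N \<le> p T.\<close>
    also have "\<dots> \<le> p * (\<integral>\<xi>. (indicator E \<xi> * ((cmod (f \<xi>))\<^sup>2 * exp (- (norm \<xi>)\<^sup>2)) + (cmod (bargmann g \<xi>))\<^sup>2 * exp (- (norm \<xi>)\<^sup>2)) / 2 \<partial>lborel)"
    proof (rule mult_left_mono[OF order_trans[OF integral_norm_bound integral_mono']])
      show "integrable lborel (\<lambda>\<xi>. (indicator E \<xi> * ((cmod (f \<xi>))\<^sup>2 * exp (- (norm \<xi>)\<^sup>2)) + (cmod (bargmann g \<xi>))\<^sup>2 * exp (- (norm \<xi>)\<^sup>2)) / 2)"
        using Ti Bi by simp
      fix \<xi>
      show "0 \<le> (indicator E \<xi> * ((cmod (f \<xi>))\<^sup>2 * exp (- (norm \<xi>)\<^sup>2)) + (cmod (bargmann g \<xi>))\<^sup>2 * exp (- (norm \<xi>)\<^sup>2)) / 2" by simp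
      show "cmod (fE \<xi> * cnj (bargmann g \<xi>)) \<le> (indicator E \<xi> * ((cmod (f \<xi>))\<^sup>2 * exp (- (norm \<xi>)\<^sup>2)) + (cmod (bargmann g \<xi>))\<^sup>2 * exp (- (norm \<xi>)\<^sup>2)) / 2"
      proof (cases "\<xi> \<in> E")
        case True
        have "cmod (f \<xi>) * cmod (bargmann g \<xi>) \<le> ((cmod (f \<xi>))\<^sup>2 + (cmod (bargmann g \<xi>))\<^sup>2) / 2"
          using sum_squares_bound[of "cmod (f \<xi>)" "cmod (bargmann g \<xi>)"] by simp
        from mult_right_mono[OF this, of "exp (- (norm \<xi>)\<^sup>2)"] show ?thesis
          using True by (simp add: fE_def norm_mult algebra_simps add_divide_distrib)
      qed (simp add: fE_def)
    qed (use p0 in auto)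
    also have "\<dots> = p * ((T + pi ^ CARD('n) * N) / 2)"
      using Ti Bi Bv by (simp add: T_def)
    also have "\<dots> = (p * T + N) / 2" by (simp add: p_def field_simps)
    finally have "N \<le> (p * T + N) / 2" using abs_ge_self[of N] by (simp only: norm_of_real)
    then have "N \<le> p * T" by simp
    then show ?thesis by (simp add: p_def N_def T_def)
  qed
  show thesis by (rule that[OF L2g le bg])
qed

text \<open>Tonelli for series: a sum with finite integral is finite almost everywhere.\<close>

lemma AE_summable_of_summable_integral:
  fixes f :: "nat \<Rightarrow> 'a \<Rightarrow> real"
  assumes i: "\<And>k. integrable M (f k)" and nn: "\<And>k x. 0 \<le> f k x" and s: "summable (\<lambda>k. \<integral>x. f k x \<partial>M)"
  shows "AE x in M. summable (\<lambda>k. f k x)"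
proof -
  have [measurable]: "f k \<in> borel_measurable M" for k using i[of k] by auto
  have "(\<integral>\<^sup>+x. (\<Sum>k. ennreal (f k x)) \<partial>M) = (\<Sum>k. \<integral>\<^sup>+x. ennreal (f k x) \<partial>M)"
    by (rule nn_integral_suminf) measurable
  also have "\<dots> = (\<Sum>k. ennreal (\<integral>x. f k x \<partial>M))"
    by (intro suminf_cong nn_integral_eq_integral i) (simp add: nn)
  also have "\<dots> \<noteq> \<infinity>"
    using s by (simp add: suminf_ennreal2 nn)
  finally have "AE x in M. (\<Sum>k. ennreal (f k x)) \<noteq> \<infinity>"
    by (intro nn_integral_PInf_AE) measurable
  then show ?thesis
    by eventually_elim (auto intro!: summable_suminf_not_top nn)
qed

text \<open>The limit is built as a series that converges almost everywhere. \<open>f\<close> is cut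
  along disjoint shells whose radii make the tails smaller than 4^-k; the adjoint images
  \<open>g k\<close> of the pieces then have a square integrable sum, the transform may be applied
  term by term, and the shell integrals add up to the reproducing integral.\<close>

lemma bargmann_surj:
  fixes f :: "complex^'n \<Rightarrow> complex"
  assumes f: "f \<in> fock_space"
  obtains g where "L2 g" "bargmann g = f"
proof -
  have e: "entire_md f" and f2: "integrable lborel (\<lambda>\<xi>. (cmod (f \<xi>))\<^sup>2 * exp (- (norm \<xi>)\<^sup>2))"
    using fock_space_L2[OF f] by auto
  have [measurable]: "f \<in> borel_measurable borel" by (rule entire_md_measurable[OF e])
  define T where "T n = (\<integral>\<xi>. indicator (- ball 0 (real n)) \<xi> * ((cmod (f \<xi>))\<^sup>2 * exp (- (norm \<xi>)\<^sup>2)) \<partial>lborel)" for n :: nat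
  have "T \<longlonglongrightarrow> integral\<^sup>L lborel (\<lambda>\<xi>::complex^'n. 0)"
    unfolding T_def
  proof (rule integral_dominated_convergence[OF _ _ f2])
    have "(\<lambda>n. indicator (- ball 0 (real n)) \<xi> * ((cmod (f \<xi>))\<^sup>2 * exp (- (norm \<xi>)\<^sup>2))) \<longlonglongrightarrow> 0" for \<xi>
    proof (rule tendsto_eventually)
      obtain n0 :: nat where "norm \<xi> < real n0" using reals_Archimedean2 by blast
      then show "\<forall>\<^sub>F n in sequentially. indicator (- ball 0 (real n)) \<xi> * ((cmod (f \<xi>))\<^sup>2 * exp (- (norm \<xi>)\<^sup>2)) = 0"
        by (intro eventually_sequentiallyI[of n0]) (auto simp: indicator_def)
    qed
    then show "AE \<xi> in lborel. (\<lambda>n. indicator (- ball 0 (real n)) \<xi> * ((cmod (f \<xi>))\<^sup>2 * exp (- (norm \<xi>)\<^sup>2))) \<longlonglongrightarrow> 0" by simp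
    show "AE \<xi> in lborel. norm (indicator (- ball 0 (real n)) \<xi> * ((cmod (f \<xi>))\<^sup>2 * exp (- (norm \<xi>)\<^sup>2))) \<le> (cmod (f \<xi>))\<^sup>2 * exp (- (norm \<xi>)\<^sup>2)" for n
      by (auto simp: indicator_def)
  qed measurable
  then have "T \<longlonglongrightarrow> 0" by simp
  then have "\<exists>N. \<forall>n\<ge>N. T n < (1/4) ^ k" for k
    using order_tendstoD(2)[of T 0 sequentially "(1/4) ^ k"] by (simp add: eventually_sequentially)
  then obtain N where N: "\<And>k n. n \<ge> N k \<Longrightarrow> T n < (1/4) ^ k" by metis
  \<comment> \<open>The partial sum dominates \<open>N k\<close> and does not decrease; the summand
    \<open>k\<close> makes the radii strictly increasing and unbounded.\<close>
  define r where "r k = (\<Sum>i\<le>k. N i) + k" for k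
  have rN: "r k \<ge> N k" for k
    unfolding r_def using member_le_sum[of k "{..k}" N] by simp
  have rk: "r k \<ge> k" for k by (simp add: r_def)
  have rS: "r k < r (Suc k)" for k by (simp add: r_def)
  have rmono: "strict_mono r" by (simp add: strict_mono_Suc_iff rS)
  \<comment> \<open>The innermost piece is a full ball. No tail bound controls it, so the decay
    estimates start at index 1.\<close>
  define E where "E k = (case k of 0 \<Rightarrow> ball 0 (real (r 0)) | Suc j \<Rightarrow> ball (0::complex^'n) (real (r (Suc j))) - ball 0 (real (r j)))" for k
  have E_sets: "E k \<in> sets borel" for k by (auto simp: E_def split: nat.split)
  have E_ball: "E k \<subseteq> ball 0 (real (r k))" for k by (auto simp: E_def split: nat.splits)
  have E_out: "norm \<xi> \<ge> real (r j)" if "\<xi> \<in> E (Suc j)" for \<xi> j using that by (auto simp: E_def)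
  have E_disj: "E i \<inter> E j = {}" if "i \<noteq> j" for i j
  proof -
    have "E i \<inter> E j = {}" if "i < j" for i j
    proof -
      obtain m where j: "j = Suc m" using \<open>i < j\<close> by (cases j) auto
      have "r i \<le> r m" using strict_mono_less_eq[OF rmono] \<open>i < j\<close> j by simp
      then show ?thesis unfolding j using E_ball[of i] E_out[of _ m] by force
    qed
    then show ?thesis using \<open>i \<noteq> j\<close> by (metis inf_commute linorder_neqE_nat)
  qed
  have E_UN: "(\<Union>k. E k) = UNIV"
  proof -
    have "\<exists>k. \<xi> \<in> E k" for \<xi>
    proof -
      obtain n :: nat where "norm \<xi> < real n" using reals_Archimedean2 by blast
      then have ex: "norm \<xi> < real (r n)" using rk[of n] by linarith
      define k where "k = (LEAST k. norm \<xi> < real (r k))"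
      have k1: "norm \<xi> < real (r k)" unfolding k_def by (rule LeastI[of _ n]) (rule ex)
      have k2: "\<not> norm \<xi> < real (r j)" if "j < k" for j using that not_less_Least unfolding k_def by blast
      show ?thesis
        by (rule exI[of _ k]) (use k1 k2 in \<open>auto simp: E_def split: nat.split\<close>)
    qed
    then show ?thesis by auto
  qed
  define Q where "Q k g \<longleftrightarrow> L2 g \<and> (\<integral>x. (cmod (g x))\<^sup>2 \<partial>lborel) \<le> (\<integral>\<xi>. indicator (E k) \<xi> * ((cmod (f \<xi>))\<^sup>2 * exp (- (norm \<xi>)\<^sup>2)) \<partial>lborel) / pi ^ CARD('n) \<and> (\<forall>\<eta>. bargmann g \<eta> = of_real (1 / pi ^ CARD('n)) * (LINT \<xi>:E k|lborel. f \<xi> * exp (cdot \<eta> \<xi>) * of_real (exp (- (norm \<xi>)\<^sup>2))))" for k g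
  have "\<exists>g. Q k g" for k
    unfolding Q_def by (rule bargmann_adjoint_truncated[OF f E_sets E_ball]) blast
  then obtain g where Q: "\<And>k. Q k (g k)" by metis
  have g: "L2 (g k)" for k using Q[of k] unfolding Q_def by blast
  have gn: "(\<integral>x. (cmod (g k x))\<^sup>2 \<partial>lborel) \<le> (\<integral>\<xi>. indicator (E k) \<xi> * ((cmod (f \<xi>))\<^sup>2 * exp (- (norm \<xi>)\<^sup>2)) \<partial>lborel) / pi ^ CARD('n)" for k using Q[of k] unfolding Q_def by blast
  have gb: "bargmann (g k) \<eta> = of_real (1 / pi ^ CARD('n)) * (LINT \<xi>:E k|lborel. f \<xi> * exp (cdot \<eta> \<xi>) * of_real (exp (- (norm \<xi>)\<^sup>2)))" for k \<eta> using Q[of k] unfolding Q_def by blast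
  have gm[measurable]: "g k \<in> borel_measurable borel" for k by (rule L2_borel[OF g])
  have g2: "integrable lborel (\<lambda>x. (cmod (g k x))\<^sup>2)" for k using g[of k] by (simp add: L2_def)
  define b where "b k = (\<integral>x. (cmod (g k x))\<^sup>2 \<partial>lborel)" for k
  have b0: "b k \<ge> 0" for k by (simp add: b_def)
  have bS: "b (Suc j) \<le> (1/4) ^ j" for j
  proof -
    have I: "integrable lborel (\<lambda>\<xi>. indicator S \<xi> * ((cmod (f \<xi>))\<^sup>2 * exp (- (norm \<xi>)\<^sup>2)))" if [measurable]: "S \<in> sets borel" for S
      by (rule Bochner_Integration.integrable_bound[OF f2]) (auto simp: indicator_def)
    have "(\<integral>\<xi>. indicator (E (Suc j)) \<xi> * ((cmod (f \<xi>))\<^sup>2 * exp (- (norm \<xi>)\<^sup>2)) \<partial>lborel) \<le> T (r j)"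
      unfolding T_def
    proof (rule integral_mono[OF I[OF E_sets] I])
      fix \<xi>
      show "indicator (E (Suc j)) \<xi> * ((cmod (f \<xi>))\<^sup>2 * exp (- (norm \<xi>)\<^sup>2)) \<le> indicator (- ball 0 (real (r j))) \<xi> * ((cmod (f \<xi>))\<^sup>2 * exp (- (norm \<xi>)\<^sup>2))"
        using E_out[of \<xi> j] by (auto simp: indicator_def)
    qed simp
    also have "\<dots> \<le> (1/4) ^ j" using N[OF rN[of j]] by simp
    finally have t: "(\<integral>\<xi>. indicator (E (Suc j)) \<xi> * ((cmod (f \<xi>))\<^sup>2 * exp (- (norm \<xi>)\<^sup>2)) \<partial>lborel) \<le> (1/4) ^ j" .
    have "pi ^ CARD('n) \<ge> 1" using pi_ge_two by (intro one_le_power) linarith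
    then have "(1/4::real) ^ j / pi ^ CARD('n) \<le> (1/4) ^ j / 1" by (intro divide_left_mono) auto
    moreover have "b (Suc j) \<le> (1/4) ^ j / pi ^ CARD('n)"
      unfolding b_def by (rule order_trans[OF gn divide_right_mono[OF t]]) simp
    ultimately show ?thesis by simp
  qed
  \<comment> \<open>The weight 2^k is affordable, as 2^k (1/4)^(k-1) = 4 (1/2)^k is still summable;
    it is what the estimates of the sum of the \<open>g k\<close> live on.\<close>
  have sb: "summable (\<lambda>k. 2 ^ k * b k)"
  proof (rule summable_comparison_test'[where N=1])
    show "summable (\<lambda>k. 4 * (1/2::real) ^ k)" by (intro summable_mult summable_geometric) simp
    show "norm (2 ^ k * b k) \<le> 4 * (1/2) ^ k" if k1: "k \<ge> 1" for k
    proof -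
      obtain j where k: "k = Suc j" using k1 by (cases k) auto
      have "2 ^ k * b k \<le> 2 ^ k * (1/4) ^ j" unfolding k by (intro mult_left_mono bS) auto
      also have "\<dots> = 4 * (1/2) ^ k" unfolding k by (simp add: power_divide field_simps power_mult_distrib[symmetric])
      finally show ?thesis using b0[of k] by simp
    qed
  qed
  define h where "h k x = 2 ^ k * (cmod (g k x))\<^sup>2" for k x
  have h0: "h k x \<ge> 0" for k x by (simp add: h_def)
  have hi: "integrable lborel (h k)" for k unfolding h_def using g2 by simp
  have hv: "integral\<^sup>L lborel (h k) = 2 ^ k * b k" for k by (simp add: h_def[abs_def] b_def)
  have hs: "AE x in lborel. summable (\<lambda>k. h k x)"
    by (rule AE_summable_of_summable_integral[OF hi h0]) (use sb in \<open>simp add: hv\<close>)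
  have Wi: "integrable lborel (\<lambda>x. \<Sum>k. h k x)"
    by (rule integrable_suminf[OF hi]) (use hs h0 sb in \<open>auto simp: hv\<close>)
  \<comment> \<open>This rests on 2^k (|g k x| - 2^-k)^2 \<ge> 0. The same square with the kernel
    inserted justifies exchanging sum and integral further down.\<close>
  have gh: "cmod (g k x) \<le> (1/2) ^ k + h k x" for k x
  proof -
    have t: "2 ^ k * (1/2::real) ^ k = 1" by (simp add: power_mult_distrib[symmetric])
    have "0 \<le> 2 ^ k * (cmod (g k x) - (1/2) ^ k)\<^sup>2" by simp
    also have "\<dots> = h k x - 2 * (2 ^ k * (1/2) ^ k) * cmod (g k x) + (2 ^ k * (1/2) ^ k) * (1/2) ^ k"
      by (simp only: h_def power2_eq_square) (simp only: algebra_simps)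
    finally have "2 * cmod (g k x) \<le> h k x + (1/2) ^ k" unfolding t by simp
    then show ?thesis using norm_ge_zero[of "g k x"] h0[of k x] by linarith
  qed
  define G where "G x = (\<Sum>k. g k x)" for x
  have Gm: "G \<in> borel_measurable borel" unfolding G_def by measurable
  have G2: "(cmod (G x))\<^sup>2 \<le> 2 * (\<Sum>k. h k x)" and gsum: "summable (\<lambda>k. cmod (g k x))" if s: "summable (\<lambda>k. h k x)" for x
  proof -
    show sg: "summable (\<lambda>k. cmod (g k x))"
      by (rule summable_comparison_test'[where N=0 and g="\<lambda>k. (1/2) ^ k + h k x"])
         (use gh s in \<open>auto intro!: summable_add summable_geometric\<close>)
    \<comment> \<open>Cauchy-Schwarz with the weights 2^-k and 2^k: the first weights sum to at most
      2, and the second ones produce the \<open>h k x\<close>.\<close>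
    have part: "(\<Sum>k<n. cmod (g k x))\<^sup>2 \<le> 2 * (\<Sum>k. h k x)" for n
    proof -
      have "(\<Sum>k<n. cmod (g k x))\<^sup>2 = (\<Sum>k<n. sqrt ((1/2) ^ k) * (sqrt (2 ^ k) * cmod (g k x)))\<^sup>2"
      proof -
        have "sqrt ((1/2) ^ k) * (sqrt (2 ^ k) * y) = y" for k y
          by (simp add: mult.assoc[symmetric] real_sqrt_mult[symmetric] power_mult_distrib[symmetric])
        then show ?thesis by (simp only:)
      qed
      also have "\<dots> \<le> (\<Sum>k<n. (sqrt ((1/2) ^ k))\<^sup>2) * (\<Sum>k<n. (sqrt (2 ^ k) * cmod (g k x))\<^sup>2)"
        by (rule Cauchy_Schwarz_ineq_sum)
      also have "\<dots> = (\<Sum>k<n. (1/2) ^ k) * (\<Sum>k<n. h k x)"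
        by (simp add: h_def power_mult_distrib)
      also have "\<dots> \<le> 2 * (\<Sum>k. h k x)"
      proof (rule mult_mono)
        show "(\<Sum>k<n. (1/2::real) ^ k) \<le> 2"
          using sum_le_suminf[of "\<lambda>k. (1/2::real) ^ k" "{..<n}"] suminf_geometric[of "1/2::real"] summable_geometric[of "1/2::real"] by simp
        show "(\<Sum>k<n. h k x) \<le> (\<Sum>k. h k x)" by (rule sum_le_suminf[OF s]) (auto simp: h0)
      qed (auto intro: sum_nonneg h0)
      finally show ?thesis .
    qed
    have "(\<lambda>n. (\<Sum>k<n. cmod (g k x))\<^sup>2) \<longlonglongrightarrow> (\<Sum>k. cmod (g k x))\<^sup>2"
      by (intro tendsto_intros summable_LIMSEQ sg)
    then have "(\<Sum>k. cmod (g k x))\<^sup>2 \<le> 2 * (\<Sum>k. h k x)"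
      by (rule LIMSEQ_le_const2) (use part in auto)
    moreover have "cmod (G x) \<le> (\<Sum>k. cmod (g k x))" unfolding G_def by (rule summable_norm[OF sg])
    then have "(cmod (G x))\<^sup>2 \<le> (\<Sum>k. cmod (g k x))\<^sup>2" by (intro power_mono) auto
    ultimately show "(cmod (G x))\<^sup>2 \<le> 2 * (\<Sum>k. h k x)" by linarith
  qed
  have L2G: "L2 G"
  proof -
    have "integrable lborel (\<lambda>x. (cmod (G x))\<^sup>2)"
    proof (rule Bochner_Integration.integrable_bound[OF integrable_mult_right[OF Wi, of 2]])
      show "AE x in lborel. norm ((cmod (G x))\<^sup>2) \<le> norm (2 * (\<Sum>k. h k x))"
        using hs
      proof eventually_elim
        case (elim x)
        then show ?case using G2[OF elim] suminf_nonneg[OF elim h0] by simp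
      qed
    qed (use Gm in measurable)
    then show ?thesis using Gm by (simp add: L2_def)
  qed
  have "bargmann G \<eta> = f \<eta>" for \<eta>
  proof -
    define \<kappa> where "\<kappa> = bargmann_kernel \<eta>"
    have [measurable]: "\<kappa> \<in> borel_measurable borel" unfolding \<kappa>_def by measurable
    have k2: "integrable lborel (\<lambda>x. (cmod (\<kappa> x))\<^sup>2)" unfolding \<kappa>_def by (rule bargmann_kernel_L2)
    have gk: "integrable lborel (\<lambda>x. g k x * \<kappa> x)" for k unfolding \<kappa>_def by (rule integrable_bargmann_integrand[OF g])
    have pt: "cmod (g k x * \<kappa> x) \<le> h k x + (1/2) ^ k * (cmod (\<kappa> x))\<^sup>2" for k x
    proof -
      have t: "2 ^ k * (1/2::real) ^ k = 1" by (simp add: power_mult_distrib[symmetric])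
      have "0 \<le> 2 ^ k * (cmod (g k x) - (1/2) ^ k * cmod (\<kappa> x))\<^sup>2" by simp
      also have "\<dots> = h k x - 2 * (2 ^ k * (1/2) ^ k) * (cmod (g k x) * cmod (\<kappa> x)) + (2 ^ k * (1/2) ^ k) * ((1/2) ^ k * (cmod (\<kappa> x))\<^sup>2)"
        by (simp only: h_def power2_eq_square) (simp only: algebra_simps)
      finally have "2 * (cmod (g k x) * cmod (\<kappa> x)) \<le> h k x + (1/2) ^ k * (cmod (\<kappa> x))\<^sup>2" unfolding t by simp
      moreover have "0 \<le> cmod (g k x) * cmod (\<kappa> x)" by simp
      ultimately show ?thesis unfolding norm_mult by linarith
    qed
    have s1: "AE x in lborel. summable (\<lambda>k. norm (g k x * \<kappa> x))"
        using hs
      proof eventually_elim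
        case (elim x)
        show ?case unfolding norm_mult by (rule summable_mult2[OF gsum[OF elim]])
      qed
    have s2: "summable (\<lambda>k. \<integral>x. norm (g k x * \<kappa> x) \<partial>lborel)"
      proof (rule summable_comparison_test'[where N=0])
        show "summable (\<lambda>k. 2 ^ k * b k + (1/2) ^ k * (\<integral>x. (cmod (\<kappa> x))\<^sup>2 \<partial>lborel))"
          by (intro summable_add sb summable_mult2 summable_geometric) simp
        have "(\<integral>x. norm (g k x * \<kappa> x) \<partial>lborel) \<le> (\<integral>x. h k x + (1/2) ^ k * (cmod (\<kappa> x))\<^sup>2 \<partial>lborel)" for k
          by (intro integral_mono integrable_norm gk Bochner_Integration.integrable_add hi integrable_mult_right k2 pt)
        also have "(\<integral>x. h k x + (1/2) ^ k * (cmod (\<kappa> x))\<^sup>2 \<partial>lborel) = 2 ^ k * b k + (1/2) ^ k * (\<integral>x. (cmod (\<kappa> x))\<^sup>2 \<partial>lborel)" for k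
          using hi[of k] k2 by (simp add: hv)
        finally show "norm (\<integral>x. norm (g k x * \<kappa> x) \<partial>lborel) \<le> 2 ^ k * b k + (1/2) ^ k * (\<integral>x. (cmod (\<kappa> x))\<^sup>2 \<partial>lborel)" for k
          by simp
      qed
    have "bargmann G \<eta> = (\<integral>x. (\<Sum>k. g k x * \<kappa> x) \<partial>lborel)"
      unfolding bargmann_eq \<kappa>_def[symmetric]
    proof (rule integral_cong_AE)
      show "AE x in lborel. G x * \<kappa> x = (\<Sum>k. g k x * \<kappa> x)"
        using hs
      proof eventually_elim
        case (elim x)
        show ?case unfolding G_def by (rule suminf_mult2[OF summable_norm_cancel[OF gsum[OF elim]]])
      qed
    qed (use Gm in measurable)
    also have "\<dots> = (\<Sum>k. \<integral>x. g k x * \<kappa> x \<partial>lborel)"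
      by (rule integral_suminf[OF gk s1 s2])
    also have "\<dots> = (\<Sum>k. of_real (1 / pi ^ CARD('n)) * (LINT \<xi>:E k|lborel. f \<xi> * exp (cdot \<eta> \<xi>) * of_real (exp (- (norm \<xi>)\<^sup>2))))"
      unfolding gb[symmetric] bargmann_eq \<kappa>_def ..
    also have "\<dots> = of_real (1 / pi ^ CARD('n)) * (\<Sum>k. (LINT \<xi>:E k|lborel. f \<xi> * exp (cdot \<eta> \<xi>) * of_real (exp (- (norm \<xi>)\<^sup>2))))"
    proof (rule suminf_mult)
      have "summable (\<lambda>k. of_real (1 / pi ^ CARD('n)) * (LINT \<xi>:E k|lborel. f \<xi> * exp (cdot \<eta> \<xi>) * of_real (exp (- (norm \<xi>)\<^sup>2))))"
        using summable_integral[OF gk s1 s2] unfolding gb[symmetric] bargmann_eq \<kappa>_def .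
      then show "summable (\<lambda>k. (LINT \<xi>:E k|lborel. f \<xi> * exp (cdot \<eta> \<xi>) * of_real (exp (- (norm \<xi>)\<^sup>2))))"
        by (rule summable_mult_D) simp
    qed
    \<comment> \<open>The shells partition the space, so countable additivity reassembles the
      reproducing integral, whose factor pi^d cancels the constant in front.\<close>
    also have "(\<Sum>k. (LINT \<xi>:E k|lborel. f \<xi> * exp (cdot \<eta> \<xi>) * of_real (exp (- (norm \<xi>)\<^sup>2))))
      = (LINT \<xi>:(\<Union>k. E k)|lborel. f \<xi> * exp (cdot \<eta> \<xi>) * of_real (exp (- (norm \<xi>)\<^sup>2)))"
    proof (rule lebesgue_integral_countable_add[symmetric])
      show "set_integrable lborel (\<Union>k. E k) (\<lambda>\<xi>. f \<xi> * exp (cdot \<eta> \<xi>) * of_real (exp (- (norm \<xi>)\<^sup>2)))"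
        unfolding E_UN set_integrable_def using fock_reproducing(1)[OF f] by simp
    qed (use E_sets E_disj in auto)
    also have "\<dots> = of_real (pi ^ CARD('n)) * f \<eta>"
      unfolding E_UN set_lebesgue_integral_def using fock_reproducing(2)[OF f, of \<eta>] by simp
    finally show ?thesis by simp
  qed
  then show thesis using that[OF L2G] by blast
qed

section \<open>A Paley--Wiener theorem for half-spaces\<close>

text \<open>Gaussian averages at scale 1/(n+1) form an approximate identity, left unnormalised so
  that the limit carries the Gaussian's mass. The second part is independent of the scale and serves
  as majorant.\<close>

lemma gauss_average_tendsto:
  fixes q :: "'a::euclidean_space \<Rightarrow> complex"
  assumes qc: "continuous_on UNIV q" and qb: "\<And>x. cmod (q x) \<le> M"
  shows "(\<lambda>n. \<integral>w. q (x + (1/real (Suc n)) *\<^sub>R w) * of_real (exp (- (norm w)\<^sup>2/2)) \<partial>lborel) \<longlonglongrightarrow> q x * of_real (sqrt (2*pi) ^ DIM('a))"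
    and "cmod (\<integral>w. q (x + r *\<^sub>R w) * of_real (exp (- (norm w)\<^sup>2/2)) \<partial>lborel) \<le> M * sqrt (2*pi) ^ DIM('a)"
proof -
  have [measurable]: "q \<in> borel_measurable borel" using qc by (rule borel_measurable_continuous_onI)
  have gi: "integrable lborel (\<lambda>w::'a. M * exp (- (norm w)\<^sup>2/2))"
    and gv: "(\<integral>w. exp (- (norm (w::'a))\<^sup>2/2) \<partial>lborel) = sqrt (2*pi) ^ DIM('a)"
    using gauss_real[where 'a='a] by (auto simp: has_bochner_integral_iff)
  have M0: "M \<ge> 0" using qb[of 0] norm_ge_zero order_trans by blast
  have pt: "cmod (q (x + r *\<^sub>R w) * of_real (exp (- (norm w)\<^sup>2/2))) \<le> M * exp (- (norm w)\<^sup>2/2)" for r w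
    using qb[of "x + r *\<^sub>R w"] by (simp add: norm_mult mult_right_mono)
  have "(\<lambda>n. \<integral>w. q (x + (1/real (Suc n)) *\<^sub>R w) * of_real (exp (- (norm w)\<^sup>2/2)) \<partial>lborel) \<longlonglongrightarrow> (\<integral>w. q x * of_real (exp (- (norm (w::'a))\<^sup>2/2)) \<partial>lborel)"
  proof (rule integral_dominated_convergence[OF _ _ gi])
    have "(\<lambda>n. q (x + (1/real (Suc n)) *\<^sub>R w) * of_real (exp (- (norm w)\<^sup>2/2))) \<longlonglongrightarrow> q x * of_real (exp (- (norm w)\<^sup>2/2))" for w
    proof -
      have "(\<lambda>n. x + inverse (real (Suc n)) *\<^sub>R w) \<longlonglongrightarrow> x + 0 *\<^sub>R w"
        by (intro tendsto_intros LIMSEQ_inverse_real_of_nat)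
      then have "(\<lambda>n. x + (1/real (Suc n)) *\<^sub>R w) \<longlonglongrightarrow> x" by (simp add: inverse_eq_divide)
      then have "(\<lambda>n. q (x + (1/real (Suc n)) *\<^sub>R w)) \<longlonglongrightarrow> q x"
        by (rule continuous_on_tendsto_compose[OF qc]) auto
      then show ?thesis by (intro tendsto_intros)
    qed
    then show "AE w in lborel. (\<lambda>n. q (x + (1/real (Suc n)) *\<^sub>R w) * of_real (exp (- (norm w)\<^sup>2/2))) \<longlonglongrightarrow> q x * of_real (exp (- (norm w)\<^sup>2/2))" by simp
    show "AE w in lborel. norm (q (x + (1/real (Suc n)) *\<^sub>R w) * of_real (exp (- (norm w)\<^sup>2/2))) \<le> M * exp (- (norm w)\<^sup>2/2)" for n
      by (rule AE_I2[OF pt])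
  qed measurable
  also have "(\<integral>w. q x * of_real (exp (- (norm (w::'a))\<^sup>2/2)) \<partial>lborel) = q x * of_real (sqrt (2*pi) ^ DIM('a))"
    unfolding integral_mult_right_zero integral_complex_of_real gv ..
  finally show "(\<lambda>n. \<integral>w. q (x + (1/real (Suc n)) *\<^sub>R w) * of_real (exp (- (norm w)\<^sup>2/2)) \<partial>lborel) \<longlonglongrightarrow> q x * of_real (sqrt (2*pi) ^ DIM('a))" .
  have "cmod (\<integral>w. q (x + r *\<^sub>R w) * of_real (exp (- (norm w)\<^sup>2/2)) \<partial>lborel) \<le> (\<integral>(w::'a). M * exp (- (norm w)\<^sup>2/2) \<partial>lborel)"
    by (rule order_trans[OF integral_norm_bound integral_mono'[OF gi]]) (use pt M0 in auto)
  then show "cmod (\<integral>w. q (x + r *\<^sub>R w) * of_real (exp (- (norm w)\<^sup>2/2)) \<partial>lborel) \<le> M * sqrt (2*pi) ^ DIM('a)"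
    unfolding integral_mult_right_zero gv .
qed

lemma power_times_gauss_tendsto_0:
  fixes c :: real
  assumes "c > 0"
  shows "(\<lambda>n. real (Suc n) ^ d * exp (- c * (real (Suc n))\<^sup>2)) \<longlonglongrightarrow> 0"
proof -
  have x: "filterlim (\<lambda>n. c * real (Suc n)) at_top sequentially"
    using assms by (intro filterlim_tendsto_pos_mult_at_top[OF tendsto_const] filterlim_compose[OF filterlim_real_sequentially filterlim_Suc]) auto
  have "(\<lambda>n. (c * real (Suc n)) ^ d / exp (c * real (Suc n))) \<longlonglongrightarrow> 0"
    by (rule filterlim_compose[OF tendsto_power_div_exp_0 x])
  then have "(\<lambda>n. (1/c) ^ d * ((c * real (Suc n)) ^ d / exp (c * real (Suc n)))) \<longlonglongrightarrow> (1/c) ^ d * 0"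
    by (intro tendsto_intros)
  then have lim: "(\<lambda>n. real (Suc n) ^ d * exp (- c * real (Suc n))) \<longlonglongrightarrow> 0"
  proof -
    have "(1/c) ^ d * ((c * N) ^ d / exp (c * N)) = N ^ d * exp (- c * N)" for N
      using assms by (simp add: power_mult_distrib power_divide exp_minus field_simps)
    then show ?thesis using \<open>(\<lambda>n. (1/c) ^ d * ((c * real (Suc n)) ^ d / exp (c * real (Suc n)))) \<longlonglongrightarrow> (1/c) ^ d * 0\<close>
      by (simp only: mult_zero_right)
  qed
  show ?thesis
  proof (rule tendsto_sandwich[OF _ _ tendsto_const lim])
    show "\<forall>\<^sub>F n in sequentially. real (Suc n) ^ d * exp (- c * (real (Suc n))\<^sup>2) \<le> real (Suc n) ^ d * exp (- c * real (Suc n))"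
    proof (intro always_eventually allI mult_left_mono)
      fix n
      have "real (Suc n) * 1 \<le> real (Suc n) * real (Suc n)" by (intro mult_left_mono) auto
      then have "real (Suc n) \<le> (real (Suc n))\<^sup>2" by (simp add: power2_eq_square)
      then show "exp (- c * (real (Suc n))\<^sup>2) \<le> exp (- c * real (Suc n))" using assms by simp
    qed auto
  qed auto
qed

text \<open>The Gaussian centred at \<open>a\<close>, divided by the exponential \<open>exp (t (x \<bullet> v))\<close> with
  \<open>t = r\<^sup>2 (a \<bullet> v)\<close>, is again a Gaussian, so its Fourier integral against the bounded function
  on the vertical plane over \<open>t v\<close> gains the factor \<open>exp (- r\<^sup>2 (a \<bullet> v)\<^sup>2 / 2)\<close>.\<close>

lemma gauss_average_decay:
  fixes h :: "real^'n \<Rightarrow> complex" and v a :: "real^'n"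
  assumes h: "\<And>R. integrable lborel (\<lambda>x. h x * of_real (exp (R * norm x)))"
    and v: "norm v = 1" and r: "r > 0" and av: "a \<bullet> v \<ge> 0"
    and C: "\<And>t y. t \<ge> 0 \<Longrightarrow> cmod (\<integral>x. h x * exp (of_real (t * (x \<bullet> v)) + \<i> * of_real (y \<bullet> x)) \<partial>lborel) \<le> C"
  shows "cmod (\<integral>x. h x * of_real (exp (- r\<^sup>2 * (norm (x - a))\<^sup>2/2)) \<partial>lborel) \<le> C * exp (- r\<^sup>2 * (a \<bullet> v)\<^sup>2/2)"
proof -
  have [measurable]: "h \<in> borel_measurable borel" using h[of 0] by auto
  define p where "p = a \<bullet> v"
  define t where "t = r\<^sup>2 * p"
  have t0: "t \<ge> 0" using av by (simp add: t_def p_def)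
  define K where "K = sqrt (2*pi) ^ CARD('n) * r ^ CARD('n)"
  have K0: "K > 0" using r by (simp add: K_def)
  define \<epsilon> where "\<epsilon> = exp (- r\<^sup>2 * p\<^sup>2/2)"
  have \<epsilon>0: "\<epsilon> > 0" by (simp add: \<epsilon>_def)
  \<comment> \<open>\<open>-b\<close> = a - p v is the projection of \<open>a\<close> onto the
    hyperplane x . v = 0. Multiplying the Gaussian centred there by exp (t (x . v)) recentres it at
    \<open>a\<close>, at the cost of the factor exp (r^2 p^2/2) = 1/\<epsilon>.\<close>
  define b where "b = p *\<^sub>R v - a"
  have vv: "v \<bullet> v = 1" using v by (simp add: norm_eq_sqrt_inner)
  have sq: "(norm (x + b))\<^sup>2 = (norm (x - a))\<^sup>2 + 2 * p * (x \<bullet> v) - p\<^sup>2" for x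
  proof -
    define u where "u = x - a"
    have e1: "x + b = u + p *\<^sub>R v" by (simp add: u_def b_def)
    have e2: "(norm (u + p *\<^sub>R v))\<^sup>2 = (norm u)\<^sup>2 + 2 * p * (u \<bullet> v) + p\<^sup>2"
      unfolding power2_norm_eq_inner
      by (simp add: inner_add_left inner_add_right vv inner_commute[of v u] power2_eq_square distrib_left)
    have e3: "u \<bullet> v = x \<bullet> v - p" by (simp add: u_def p_def inner_diff_left)
    show ?thesis unfolding e1 e2 e3 by (simp add: u_def[symmetric] power2_eq_square algebra_simps)
  qed
  have G: "has_bochner_integral lborel (\<lambda>y. exp (of_real (- (norm y)\<^sup>2/(2*r\<^sup>2)) + \<i> * of_real (y \<bullet> z))) (of_real (K * exp (- r\<^sup>2 * (norm z)\<^sup>2/2)))" for z :: "real^'n"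
    using gauss_fourier_scaled[OF r, of z] by (simp add: K_def)
  define H where "H x = h x * of_real (exp (t * (x \<bullet> v)))" for x
  have Hi: "integrable lborel H"
  proof (rule Bochner_Integration.integrable_bound[OF h[of t]])
    have "x \<bullet> v \<le> norm x" for x using Cauchy_Schwarz_ineq2[of x v] v by simp
    then have "exp (t * (x \<bullet> v)) \<le> exp (t * norm x)" for x using t0 by (simp add: mult_left_mono)
    then show "AE x in lborel. norm (H x) \<le> norm (h x * of_real (exp (t * norm x)))"
      by (intro AE_I2) (simp add: H_def norm_mult mult_left_mono)
  qed (simp add: H_def[abs_def])
  have [measurable]: "H \<in> borel_measurable borel" using Hi by auto
  \<comment> \<open>The Gaussian centred at \<open>-b\<close> is written as a Fourier integral over
    \<open>y\<close>. Integrating \<open>F\<close> over \<open>y\<close> first gives back the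
    Gaussian; integrating over \<open>x\<close> first gives the Laplace transform at t v + i y,
    where \<open>C\<close> applies.\<close>
  define F where "F x y = H x * exp (of_real (- (norm y)\<^sup>2/(2*r\<^sup>2)) + \<i> * of_real (y \<bullet> (x + b)))" for x y
  have Fn: "cmod (F x y) = cmod (H x) * exp (- (norm y)\<^sup>2/(2*r\<^sup>2))" for x y
    by (simp add: F_def norm_mult)
  have gv: "has_bochner_integral lborel (\<lambda>y::real^'n. exp (- (norm y)\<^sup>2/(2*r\<^sup>2))) K"
  proof -
    have "has_bochner_integral lborel (\<lambda>y::real^'n. Re (exp (of_real (- (norm y)\<^sup>2/(2*r\<^sup>2)) + \<i> * of_real (y \<bullet> 0)))) (Re (of_real (K * exp (- r\<^sup>2 * (norm (0::real^'n))\<^sup>2/2))))"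
      by (rule has_bochner_integral_Re[OF G])
    then show ?thesis by (simp add: Re_exp)
  qed
  have Fi: "integrable lborel (F x)" for x
    unfolding F_def using G[of "x + b"] by (intro integrable_mult_right) (simp add: has_bochner_integral_iff)
  have swap: "(\<integral>x. (\<integral>y. F x y \<partial>lborel) \<partial>lborel) = (\<integral>y. (\<integral>x. F x y \<partial>lborel) \<partial>lborel)"
  proof (rule lborel_Fubini(4)[where g="\<lambda>x. cmod (H x) * K"])
    show "(\<lambda>(x, y). F x y) \<in> borel_measurable (lborel \<Otimes>\<^sub>M lborel)" unfolding F_def by measurable
    show "integrable lborel (\<lambda>x. cmod (H x) * K)" using Hi by simp
    show "(\<integral>y. norm (F x y) \<partial>lborel) \<le> cmod (H x) * K" for x
      unfolding Fn integral_mult_right_zero using gv by (simp add: has_bochner_integral_iff)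
  qed (rule Fi)
  have left: "(\<integral>y. F x y \<partial>lborel) = of_real (K / \<epsilon>) * (h x * of_real (exp (- r\<^sup>2 * (norm (x - a))\<^sup>2/2)))" for x
  proof -
    have "(\<integral>y. F x y \<partial>lborel) = H x * of_real (K * exp (- r\<^sup>2 * (norm (x + b))\<^sup>2/2))"
      unfolding F_def integral_mult_right_zero using G[of "x + b"] by (simp add: has_bochner_integral_iff)
    also have "\<dots> = of_real (K * (exp (t * (x \<bullet> v)) * exp (- r\<^sup>2 * (norm (x + b))\<^sup>2/2))) * h x"
      by (simp add: H_def mult_ac)
    also have "exp (t * (x \<bullet> v)) * exp (- r\<^sup>2 * (norm (x + b))\<^sup>2/2) = exp (r\<^sup>2 * p\<^sup>2/2) * exp (- r\<^sup>2 * (norm (x - a))\<^sup>2/2)"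
      unfolding exp_add[symmetric] sq t_def by (rule arg_cong[where f=exp]) (simp add: field_simps)
    also have "exp (r\<^sup>2 * p\<^sup>2/2) = 1 / \<epsilon>" by (simp add: \<epsilon>_def exp_minus inverse_eq_divide)
    finally show ?thesis by (simp add: mult_ac)
  qed
  have right: "cmod (\<integral>x. F x y \<partial>lborel) \<le> exp (- (norm y)\<^sup>2/(2*r\<^sup>2)) * C" for y
  proof -
    have "F x y = (of_real (exp (- (norm y)\<^sup>2/(2*r\<^sup>2))) * exp (\<i> * of_real (y \<bullet> b))) * (h x * exp (of_real (t * (x \<bullet> v)) + \<i> * of_real (y \<bullet> x)))" for x
    proof -
      have "\<i> * of_real (y \<bullet> (x + b)) = \<i> * of_real (y \<bullet> b) + \<i> * complex_of_real (y \<bullet> x)"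
        by (simp add: inner_add_right algebra_simps)
      then show ?thesis unfolding F_def H_def by (simp only: exp_add exp_of_real mult_ac)
    qed
    then have "(\<integral>x. F x y \<partial>lborel) = (of_real (exp (- (norm y)\<^sup>2/(2*r\<^sup>2))) * exp (\<i> * of_real (y \<bullet> b))) * (\<integral>x. h x * exp (of_real (t * (x \<bullet> v)) + \<i> * of_real (y \<bullet> x)) \<partial>lborel)"
      by (simp only: integral_mult_right_zero)
    then have "cmod (\<integral>x. F x y \<partial>lborel) = exp (- (norm y)\<^sup>2/(2*r\<^sup>2)) * cmod (\<integral>x. h x * exp (of_real (t * (x \<bullet> v)) + \<i> * of_real (y \<bullet> x)) \<partial>lborel)"
      by (simp add: norm_mult)
    then show ?thesis using mult_left_mono[OF C[OF t0, of y], of "exp (- (norm y)\<^sup>2/(2*r\<^sup>2))"] by simp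
  qed
  have C0: "C \<ge> 0" using C[of 0 0] norm_ge_zero order_trans by blast
  have "cmod (of_real (K / \<epsilon>) * (\<integral>x. h x * of_real (exp (- r\<^sup>2 * (norm (x - a))\<^sup>2/2)) \<partial>lborel)) = cmod (\<integral>y. (\<integral>x. F x y \<partial>lborel) \<partial>lborel)"
    unfolding swap[symmetric] left integral_mult_right_zero ..
  also have "\<dots> \<le> (\<integral>(y::real^'n). exp (- (norm y)\<^sup>2/(2*r\<^sup>2)) * C \<partial>lborel)"
    by (rule order_trans[OF integral_norm_bound integral_mono']) (use gv right C0 in \<open>auto simp: has_bochner_integral_iff\<close>)
  also have "\<dots> = K * C" using gv by (simp add: has_bochner_integral_iff)
  finally have "K / \<epsilon> * cmod (\<integral>x. h x * of_real (exp (- r\<^sup>2 * (norm (x - a))\<^sup>2/2)) \<partial>lborel) \<le> K * C"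
    using K0 \<epsilon>0 by (simp add: norm_mult norm_divide)
  then have "cmod (\<integral>x. h x * of_real (exp (- r\<^sup>2 * (norm (x - a))\<^sup>2/2)) \<partial>lborel) \<le> C * \<epsilon>"
    using K0 \<epsilon>0 by (simp add: field_simps)
  then show ?thesis by (simp add: \<epsilon>_def p_def)
qed

text \<open>The test function \<open>q\<close> is replaced by its Gaussian averages
  \<open>A n\<close>. After exchanging integrals, every centre \<open>a\<close> that contributes has
  a . v > \<delta>, so with N = n + 1 the pairing is at most a constant times N^d exp (- N^2
  \<delta>^2/2), while \<open>A n\<close> tends to a fixed nonzero multiple of
  \<open>q\<close>.\<close>

lemma integral_test_zero:
  fixes h q :: "real^'n \<Rightarrow> complex" and v :: "real^'n"
  assumes h: "\<And>R. integrable lborel (\<lambda>x. h x * of_real (exp (R * norm x)))"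
    and v: "norm v = 1"
    and C: "\<And>t y. t \<ge> 0 \<Longrightarrow> cmod (\<integral>x. h x * exp (of_real (t * (x \<bullet> v)) + \<i> * of_real (y \<bullet> x)) \<partial>lborel) \<le> C"
    and qc: "continuous_on UNIV q" and qb: "\<And>x. cmod (q x) \<le> M" and qi: "integrable lborel q"
    and \<delta>: "\<delta> > 0" and qs: "\<And>x. x \<bullet> v \<le> \<delta> \<Longrightarrow> q x = 0"
  shows "(\<integral>x. h x * q x \<partial>lborel) = 0"
proof -
  have hi: "integrable lborel h" using h[of 0] by simp
  have [measurable]: "h \<in> borel_measurable borel" "q \<in> borel_measurable borel" using hi qi by auto
  have C0: "C \<ge> 0" using C[of 0 0] norm_ge_zero order_trans by blast
  define g where "g n x a = complex_of_real (exp (- (real (Suc n))\<^sup>2 * (norm (x - a))\<^sup>2/2))" for n and x a :: "real^'n"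
  have gn: "cmod (g n x a) \<le> 1" for n x a by (simp add: g_def)
  have gm[measurable]: "(\<lambda>z. g n (fst z) (snd z)) \<in> borel_measurable (borel \<Otimes>\<^sub>M borel)" for n unfolding g_def by measurable
  define A where "A n x = (\<integral>w. q (x + (1/real (Suc n)) *\<^sub>R w) * of_real (exp (- (norm w)\<^sup>2/2)) \<partial>lborel)" for n x
  have qg: "integrable lborel (\<lambda>a. q a * g n x a)" for n x
  proof (rule Bochner_Integration.integrable_bound[OF qi])
    show "AE a in lborel. norm (q a * g n x a) \<le> norm (q a)"
      using gn by (auto simp: norm_mult intro!: mult_left_le)
  qed (simp add: g_def)
  \<comment> \<open>Substituting a = x + w/N with N = n + 1 shows \<open>A n\<close> to be N^d times
    the integral of \<open>q\<close> against the Gaussian of width 1/N; this is the power that the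
    decay has to beat.\<close>
  have A: "(\<integral>a. q a * g n x a \<partial>lborel) = A n x /\<^sub>R real (Suc n) ^ CARD('n)" for n x
  proof -
    have "(\<integral>w. q (x + (1/real (Suc n)) *\<^sub>R w) * g n x (x + (1/real (Suc n)) *\<^sub>R w) \<partial>lborel) = (\<integral>a. q a * g n x a \<partial>lborel) /\<^sub>R \<bar>1/real (Suc n)\<bar> ^ DIM(real^'n)"
      by (rule lborel_integral_affine[OF _ qg]) simp
    moreover have "g n x (x + (1/real (Suc n)) *\<^sub>R w) = of_real (exp (- (norm w)\<^sup>2/2))" for w
      by (simp add: g_def power_mult_distrib power_divide del: of_nat_Suc)
    ultimately have "A n x = (\<integral>a. q a * g n x a \<partial>lborel) /\<^sub>R \<bar>1/real (Suc n)\<bar> ^ CARD('n)" by (simp add: A_def)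
    then show ?thesis by (simp add: power_divide del: of_nat_Suc)
  qed
  have A_meas[measurable]: "A n \<in> borel_measurable borel" for n
  proof -
    have "A n \<in> borel_measurable lborel"
      unfolding A_def by (rule lborel.borel_measurable_lebesgue_integral) measurable
    then show ?thesis by simp
  qed
  have lim1: "(\<lambda>n. \<integral>x. h x * A n x \<partial>lborel) \<longlonglongrightarrow> (\<integral>x. h x * (q x * of_real (sqrt (2*pi) ^ CARD('n))) \<partial>lborel)"
  proof (rule integral_dominated_convergence[where w="\<lambda>x. cmod (h x) * (M * sqrt (2*pi) ^ CARD('n))"])
    show "integrable lborel (\<lambda>x. cmod (h x) * (M * sqrt (2*pi) ^ CARD('n)))" using hi by simp
    have "(\<lambda>n. A n x) \<longlonglongrightarrow> q x * of_real (sqrt (2*pi) ^ CARD('n))" for x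
      unfolding A_def using gauss_average_tendsto(1)[OF qc qb, of x] by simp
    then show "AE x in lborel. (\<lambda>n. h x * A n x) \<longlonglongrightarrow> h x * (q x * of_real (sqrt (2*pi) ^ CARD('n)))"
      by (intro AE_I2 tendsto_intros)
    have "cmod (A n x) \<le> M * sqrt (2*pi) ^ CARD('n)" for n x
      unfolding A_def using gauss_average_tendsto(2)[OF qc qb, of x "1/real (Suc n)"] by simp
    then show "AE x in lborel. norm (h x * A n x) \<le> cmod (h x) * (M * sqrt (2*pi) ^ CARD('n))" for n
      by (intro AE_I2) (simp add: norm_mult mult_left_mono)
  qed measurable
  have bound: "cmod (\<integral>x. h x * A n x \<partial>lborel) \<le> real (Suc n) ^ CARD('n) * exp (- (\<delta>\<^sup>2/2) * (real (Suc n))\<^sup>2) * (C * (\<integral>a. cmod (q a) \<partial>lborel))" for n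
  proof -
    have swap: "(\<integral>x. (\<integral>a. h x * (q a * g n x a) \<partial>lborel) \<partial>lborel) = (\<integral>a. (\<integral>x. h x * (q a * g n x a) \<partial>lborel) \<partial>lborel)"
    proof (rule lborel_Fubini(4)[where g="\<lambda>x. cmod (h x) * (\<integral>a. cmod (q a) \<partial>lborel)"])
      show "(\<lambda>(x, a). h x * (q a * g n x a)) \<in> borel_measurable (lborel \<Otimes>\<^sub>M lborel)" unfolding g_def by measurable
      show "integrable lborel (\<lambda>a. h x * (q a * g n x a))" for x using qg by simp
      show "integrable lborel (\<lambda>x. cmod (h x) * (\<integral>a. cmod (q a) \<partial>lborel))" using hi by simp
      show "(\<integral>a. norm (h x * (q a * g n x a)) \<partial>lborel) \<le> cmod (h x) * (\<integral>a. cmod (q a) \<partial>lborel)" for x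
      proof -
        have "(\<integral>a. norm (q a * g n x a) \<partial>lborel) \<le> (\<integral>a. cmod (q a) \<partial>lborel)"
          by (rule integral_mono[OF integrable_norm[OF qg] integrable_norm[OF qi]])
             (use gn in \<open>auto simp: norm_mult intro!: mult_left_le\<close>)
        then show ?thesis unfolding norm_mult[of "h x"] integral_mult_right_zero by (rule mult_left_mono) simp
      qed
    qed
    have inner: "cmod (\<integral>x. h x * (q a * g n x a) \<partial>lborel) \<le> cmod (q a) * (C * exp (- (\<delta>\<^sup>2/2) * (real (Suc n))\<^sup>2))" for a
    proof (cases "a \<bullet> v \<le> \<delta>")
      case True
      then show ?thesis by (simp add: qs)
    next
      case False
      have "h x * (q a * g n x a) = q a * (h x * of_real (exp (- (real (Suc n))\<^sup>2 * (norm (x - a))\<^sup>2/2)))" for x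
        unfolding g_def by (simp only: mult_ac)
      then have "cmod (\<integral>x. h x * (q a * g n x a) \<partial>lborel) = cmod (q a) * cmod (\<integral>x. h x * of_real (exp (- (real (Suc n))\<^sup>2 * (norm (x - a))\<^sup>2/2)) \<partial>lborel)"
        by (simp only: integral_mult_right_zero norm_mult)
      also have "\<dots> \<le> cmod (q a) * (C * exp (- (real (Suc n))\<^sup>2 * (a \<bullet> v)\<^sup>2/2))"
        using False \<delta> by (intro mult_left_mono gauss_average_decay[OF h v _ _ C]) auto
      also have "\<dots> \<le> cmod (q a) * (C * exp (- (\<delta>\<^sup>2/2) * (real (Suc n))\<^sup>2))"
      proof -
        have "\<delta>\<^sup>2 \<le> (a \<bullet> v)\<^sup>2" using False \<delta> by (intro power_mono) auto
        then have "(real (Suc n))\<^sup>2 * \<delta>\<^sup>2 \<le> (real (Suc n))\<^sup>2 * (a \<bullet> v)\<^sup>2" by (intro mult_left_mono) auto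
        then have "exp (- (real (Suc n))\<^sup>2 * (a \<bullet> v)\<^sup>2/2) \<le> exp (- (\<delta>\<^sup>2/2) * (real (Suc n))\<^sup>2)" by (simp add: mult.commute)
        then show ?thesis using C0 by (intro mult_left_mono) auto
      qed
      finally show ?thesis .
    qed
    have "h x * A n x = of_real (real (Suc n) ^ CARD('n)) * (\<integral>a. h x * (q a * g n x a) \<partial>lborel)" for x
      unfolding integral_mult_right_zero A by (simp add: scaleR_conv_of_real del: of_nat_Suc)
    then have "(\<integral>x. h x * A n x \<partial>lborel) = of_real (real (Suc n) ^ CARD('n)) * (\<integral>a. (\<integral>x. h x * (q a * g n x a) \<partial>lborel) \<partial>lborel)"
      by (simp only: integral_mult_right_zero[of _ "of_real (real (Suc n) ^ CARD('n))"] swap)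
    then have "cmod (\<integral>x. h x * A n x \<partial>lborel) = real (Suc n) ^ CARD('n) * cmod (\<integral>a. (\<integral>x. h x * (q a * g n x a) \<partial>lborel) \<partial>lborel)"
      by (simp add: norm_mult norm_power del: of_nat_Suc)
    also have "\<dots> \<le> real (Suc n) ^ CARD('n) * (\<integral>a. cmod (q a) * (C * exp (- (\<delta>\<^sup>2/2) * (real (Suc n))\<^sup>2)) \<partial>lborel)"
      by (intro mult_left_mono order_trans[OF integral_norm_bound integral_mono'])
         (use qi C0 inner in \<open>auto simp del: of_nat_Suc\<close>)
    also have "\<dots> = real (Suc n) ^ CARD('n) * exp (- (\<delta>\<^sup>2/2) * (real (Suc n))\<^sup>2) * (C * (\<integral>a. cmod (q a) \<partial>lborel))"
      unfolding integral_mult_left_zero by (simp only: mult_ac)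
    finally show ?thesis .
  qed
  have "(\<lambda>n. real (Suc n) ^ CARD('n) * exp (- (\<delta>\<^sup>2/2) * (real (Suc n))\<^sup>2) * (C * (\<integral>a. cmod (q a) \<partial>lborel))) \<longlonglongrightarrow> 0 * (C * (\<integral>a. cmod (q a) \<partial>lborel))"
    using \<delta> by (intro tendsto_mult tendsto_const power_times_gauss_tendsto_0) auto
  then have "(\<lambda>n. real (Suc n) ^ CARD('n) * exp (- (\<delta>\<^sup>2/2) * (real (Suc n))\<^sup>2) * (C * (\<integral>a. cmod (q a) \<partial>lborel))) \<longlonglongrightarrow> 0"
    by simp
  then have "(\<lambda>n. \<integral>x. h x * A n x \<partial>lborel) \<longlonglongrightarrow> 0"
    by (rule Lim_null_comparison[rotated]) (intro always_eventually allI bound)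
  then have "(\<integral>x. h x * (q x * of_real (sqrt (2*pi) ^ CARD('n))) \<partial>lborel) = 0"
    using lim1 LIMSEQ_unique by blast
  then have "(\<integral>x. h x * q x \<partial>lborel) * of_real (sqrt (2*pi) ^ CARD('n)) = 0"
    by (simp only: mult.assoc[symmetric] integral_mult_left_zero)
  then show ?thesis by simp
qed

text \<open>The conjugate phase of \<open>h\<close> would be the ideal test function. It is
  approximated by continuous functions of modulus at most 1, multiplied by a weight that vanishes
  for x . v \<le> \<delta>. In the limit the pairing becomes the integral of |h| times this weight,
  so \<open>h\<close> is 0 almost everywhere where the weight is positive.\<close>

lemma paley_wiener_half_space:
  fixes h :: "real^'n \<Rightarrow> complex" and v :: "real^'n"
  assumes h: "\<And>R. integrable lborel (\<lambda>x. h x * of_real (exp (R * norm x)))"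
    and v: "norm v = 1"
    and C: "\<And>t y. t \<ge> 0 \<Longrightarrow> cmod (\<integral>x. h x * exp (of_real (t * (x \<bullet> v)) + \<i> * of_real (y \<bullet> x)) \<partial>lborel) \<le> C"
  shows "AE x in lborel. x \<bullet> v > 0 \<longrightarrow> h x = 0"
proof -
  have hi: "integrable lborel h" using h[of 0] by simp
  have [measurable]: "h \<in> borel_measurable borel" using hi by auto
  have "AE x in lborel. x \<bullet> v > \<delta> \<longrightarrow> h x = 0" if \<delta>: "\<delta> > 0" for \<delta>
  proof -
    define s where "s x = cnj (sgn (h x))" for x
    have sb: "cmod (s x) \<le> 1" for x by (simp add: s_def norm_sgn)
    have [measurable]: "s \<in> borel_measurable borel" unfolding s_def sgn_div_norm by measurable
    obtain \<psi> where \<psi>c: "\<And>n. continuous_on UNIV (\<psi> n)" and \<psi>b: "\<And>n x. cmod (\<psi> n x) \<le> 1"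
      and \<psi>l: "AE x in lborel. (\<lambda>n::nat. \<psi> n x) \<longlonglongrightarrow> s x"
      by (rule bounded_measurable_limit_continuous[of s 1]) (use sb in auto)
    \<comment> \<open>The Gaussian factor makes the test functions integrable; the clipped linear
      factor is continuous, vanishes up to \<delta> and is positive beyond it.\<close>
    define \<theta> where "\<theta> x = exp (- 1 * (norm x)\<^sup>2) * min 1 (max 0 (x \<bullet> v - \<delta>))" for x :: "real^'n"
    have \<theta>c: "continuous_on UNIV \<theta>" unfolding \<theta>_def by (intro continuous_intros)
    have [measurable]: "\<theta> \<in> borel_measurable borel" using \<theta>c by (rule borel_measurable_continuous_onI)
    have \<theta>0: "\<theta> x \<ge> 0" and \<theta>1: "\<theta> x \<le> exp (- 1 * (norm x)\<^sup>2)" for x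
      by (auto simp: \<theta>_def mult_left_le)
    have \<theta>11: "\<theta> x \<le> 1" for x using \<theta>1[of x] by (rule order_trans) simp
    have \<theta>i: "integrable lborel \<theta>"
      by (rule Bochner_Integration.integrable_bound[OF integrable_gauss[of 1]]) (use \<theta>0 \<theta>1 in auto)
    have z: "(\<integral>x. h x * (\<psi> n x * of_real (\<theta> x)) \<partial>lborel) = 0" for n
    proof (rule integral_test_zero[OF h v C, where M=1 and \<delta>=\<delta>])
      have [measurable]: "\<psi> n \<in> borel_measurable borel" using \<psi>c by (rule borel_measurable_continuous_onI)
      show "continuous_on UNIV (\<lambda>x. \<psi> n x * of_real (\<theta> x))" by (intro continuous_intros \<psi>c \<theta>c)
      show "cmod (\<psi> n x * of_real (\<theta> x)) \<le> 1" for x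
        using \<psi>b[of n x] \<theta>0[of x] \<theta>11[of x] by (simp add: norm_mult mult_le_one)
      show "integrable lborel (\<lambda>x. \<psi> n x * of_real (\<theta> x))"
        by (rule Bochner_Integration.integrable_bound[OF \<theta>i])
           (use \<psi>b \<theta>0 in \<open>auto simp: norm_mult intro!: mult_left_le_one_le\<close>)
      show "\<psi> n x * of_real (\<theta> x) = 0" if "x \<bullet> v \<le> \<delta>" for x using that by (simp add: \<theta>_def)
    qed (use \<delta> in auto)
    have "(\<lambda>n. \<integral>x. h x * (\<psi> n x * of_real (\<theta> x)) \<partial>lborel) \<longlonglongrightarrow> (\<integral>x. h x * (s x * of_real (\<theta> x)) \<partial>lborel)"
    proof (rule integral_dominated_convergence[where w="\<lambda>x. cmod (h x)"])
      have [measurable]: "\<psi> n \<in> borel_measurable borel" for n using \<psi>c by (rule borel_measurable_continuous_onI)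
      show "(\<lambda>x. h x * (\<psi> n x * of_real (\<theta> x))) \<in> borel_measurable lborel" for n by measurable
      show "AE x in lborel. (\<lambda>n. h x * (\<psi> n x * of_real (\<theta> x))) \<longlonglongrightarrow> h x * (s x * of_real (\<theta> x))"
        using \<psi>l by eventually_elim (intro tendsto_intros)
      have "cmod (\<psi> n x * of_real (\<theta> x)) \<le> 1" for n x
        using \<psi>b[of n x] \<theta>0[of x] \<theta>11[of x] by (simp add: norm_mult mult_le_one)
      then show "AE x in lborel. norm (h x * (\<psi> n x * of_real (\<theta> x))) \<le> cmod (h x)" for n
        by (intro AE_I2) (simp add: norm_mult[of "h _"] mult_left_le)
    qed (use hi in auto)
    then have "(\<integral>x. h x * (s x * of_real (\<theta> x)) \<partial>lborel) = 0"
      unfolding z using LIMSEQ_unique tendsto_const by blast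
    moreover have "h x * (s x * of_real (\<theta> x)) = of_real (cmod (h x) * \<theta> x)" for x
    proof (cases "h x = 0")
      case False
      have "h x * cnj (h x) = of_real (cmod (h x)) * of_real (cmod (h x))"
        unfolding complex_norm_square[symmetric] by (simp add: power2_eq_square)
      then show ?thesis using False
        by (simp add: s_def sgn_div_norm scaleR_conv_of_real field_simps)
    qed simp
    ultimately have "complex_of_real (\<integral>x. cmod (h x) * \<theta> x \<partial>lborel) = 0"
      by (simp only: integral_complex_of_real[symmetric])
    then have i0: "(\<integral>x. cmod (h x) * \<theta> x \<partial>lborel) = 0" by simp
    have "integrable lborel (\<lambda>x. cmod (h x) * \<theta> x)"
      by (rule Bochner_Integration.integrable_bound[OF hi]) (use \<theta>0 \<theta>11 in \<open>auto simp: abs_mult intro!: mult_left_le\<close>)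
    then have "AE x in lborel. cmod (h x) * \<theta> x = 0"
      using i0 \<theta>0 by (subst (asm) integral_nonneg_eq_0_iff_AE) auto
    then show ?thesis
      by eventually_elim (auto simp: \<theta>_def)
  qed
  \<comment> \<open>The open half-space is the union of the countably many sets x . v > 1/(n+1), so
    the exceptional null sets can be collected.\<close>
  then have "AE x in lborel. \<forall>n::nat. x \<bullet> v > 1 / real (Suc n) \<longrightarrow> h x = 0"
    unfolding AE_all_countable by auto
  then show ?thesis
  proof eventually_elim
    case (elim x)
    show ?case
    proof
      assume "x \<bullet> v > 0"
      then obtain n where "inverse (real (Suc n)) < x \<bullet> v" using reals_Archimedean by blast
      then show "h x = 0" using elim[rule_format, of n] by (simp add: inverse_eq_divide)
    qed
  qed
qed

section \<open>The subspace of a half-space\<close>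

lemma bargmann_exp_csq:
  fixes f :: "real^'n \<Rightarrow> complex"
  shows "bargmann f \<xi> * exp (csq \<xi> / 2) = of_real (bargmann_const CARD('n)) *
      (\<integral>x. (f x * of_real (exp (- (norm x)\<^sup>2/4))) * exp (cdot \<xi> (cvec x)) \<partial>lborel)" (is "_ = _ * ?I")
proof -
  have "bargmann f \<xi> * exp (csq \<xi> / 2) = of_real (bargmann_const CARD('n)) * (exp ((- 1/2) * csq \<xi>) * exp (csq \<xi> / 2)) * ?I"
    unfolding bargmann_laplace by (simp only: mult_ac)
  also have "exp ((- 1/2) * csq \<xi>) * exp (csq \<xi> / 2) = 1" unfolding exp_add[symmetric] by simp
  finally show ?thesis by simp
qed

text \<open>Over a point with real part t v the exponential has modulus exp (t (x . v)), which is at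
  most 1 on the support of \<open>g\<close>. Hence the L1 norm of g exp (- |x|^2/4) bounds the
  Laplace transform for all t \<ge> 0 at once.\<close>

lemma bargmann_in_H_space:
  fixes g :: "real^'n \<Rightarrow> complex"
  assumes g: "L2 g" and s: "\<And>x. x \<bullet> v > 0 \<Longrightarrow> g x = 0"
  shows "bargmann g \<in> H_space v"
proof -
  define h where "h x = g x * of_real (exp (- (norm x)\<^sup>2/4))" for x
  have hi: "integrable lborel h" using L2_gauss_exp_integrable[OF g, of 0] by (simp add: h_def[abs_def])
  have "cmod (bargmann g \<xi> * exp (csq \<xi> / 2)) \<le> bargmann_const CARD('n) * (\<integral>x. cmod (h x) \<partial>lborel)"
    if "t \<ge> 0" "cre \<xi> = t *\<^sub>R v" for \<xi> t
  proof -
    have "cmod (h x * exp (cdot \<xi> (cvec x))) \<le> cmod (h x)" for x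
    proof (cases "x \<bullet> v > 0")
      case True
      then show ?thesis by (simp add: h_def s)
    next
      case False
      have "Re (cdot \<xi> (cvec x)) = cre \<xi> \<bullet> x" using cdot_cpair_cvec[of "cre \<xi>" "cim \<xi>" x] by simp
      also have "\<dots> = t * (x \<bullet> v)" using that(2) by (simp add: inner_commute)
      also have "\<dots> \<le> 0" using False that(1) by (simp add: mult_nonneg_nonpos)
      finally show ?thesis by (simp add: norm_mult mult_left_le)
    qed
    then have "cmod (\<integral>x. h x * exp (cdot \<xi> (cvec x)) \<partial>lborel) \<le> (\<integral>x. cmod (h x) \<partial>lborel)"
      using hi by (intro order_trans[OF integral_norm_bound integral_mono']) auto
    then show ?thesis
      unfolding bargmann_exp_csq h_def[symmetric] norm_mult
      using bargmann_const_pos[of "CARD('n)"] by (simp add: mult_left_mono)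
  qed
  then show ?thesis unfolding H_space_def using bargmann_in_fock_space[OF g] by blast
qed

lemma H_space_imp_bargmann:
  fixes f :: "complex^'n \<Rightarrow> complex" and v :: "real^'n"
  assumes f: "f \<in> H_space v" and v: "norm v = 1"
  obtains g where "L2 g" "\<And>x. x \<bullet> v > 0 \<Longrightarrow> g x = 0" "f = bargmann g"
proof -
  from f obtain C where ff: "f \<in> fock_space"
    and C: "\<And>\<xi> t. t \<ge> 0 \<Longrightarrow> cre \<xi> = t *\<^sub>R v \<Longrightarrow> cmod (f \<xi> * exp (csq \<xi> / 2)) \<le> C"
    unfolding H_space_def by blast
  obtain g where g: "L2 g" and fg: "bargmann g = f" by (rule bargmann_surj[OF ff])
  have [measurable]: "g \<in> borel_measurable borel" by (rule L2_borel[OF g])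
  define h where "h x = g x * of_real (exp (- (norm x)\<^sup>2/4))" for x
  define c where "c = bargmann_const CARD('n)"
  have c0: "c > 0" by (simp add: c_def bargmann_const_pos)
  have "AE x in lborel. x \<bullet> v > 0 \<longrightarrow> h x = 0"
  proof (rule paley_wiener_half_space[OF _ v, where C="C / c"])
    show "integrable lborel (\<lambda>x. h x * of_real (exp (R * norm x)))" for R
      unfolding h_def by (rule L2_gauss_exp_integrable[OF g])
    fix t :: real and y :: "real^'n"
    assume t: "t \<ge> 0"
    \<comment> \<open>The points \<open>cpair (t *\<^sub>R v) y\<close> with t \<ge> 0 are exactly
      those on which \<open>H_space\<close> demands a bound. There f exp (\<xi>^2/2) is
      \<open>c\<close> times the Laplace transform of \<open>h\<close>, whence the constant C /
      c.\<close>
    have "cmod (f (cpair (t *\<^sub>R v) y) * exp (csq (cpair (t *\<^sub>R v) y) / 2)) \<le> C"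
      by (rule C[OF t]) simp
    moreover have "cdot (cpair (t *\<^sub>R v) y) (cvec x) = of_real (t * (x \<bullet> v)) + \<i> * of_real (y \<bullet> x)" for x
      by (simp add: cdot_cpair_cvec inner_commute)
    ultimately have "cmod (of_real c * (\<integral>x. h x * exp (of_real (t * (x \<bullet> v)) + \<i> * of_real (y \<bullet> x)) \<partial>lborel)) \<le> C"
      unfolding fg[symmetric] bargmann_exp_csq c_def h_def by simp
    then show "cmod (\<integral>x. h x * exp (of_real (t * (x \<bullet> v)) + \<i> * of_real (y \<bullet> x)) \<partial>lborel) \<le> C / c"
      using c0 by (simp add: norm_mult field_simps)
  qed
  then have ae: "AE x in lborel. x \<bullet> v > 0 \<longrightarrow> g x = 0" by (simp add: h_def)
  \<comment> \<open>\<open>g\<close> is known to vanish on the open half-space only almost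
    everywhere; resetting it to 0 there leaves the transform unchanged and makes the support
    condition pointwise.\<close>
  define G where "G x = (if x \<bullet> v > 0 then 0 else g x)" for x
  have Gm[measurable]: "G \<in> borel_measurable borel" unfolding G_def by measurable
  have aeG: "AE x in lborel. g x = G x" using ae by eventually_elim (auto simp: G_def)
  have "L2 G"
  proof -
    have "integrable lborel (\<lambda>x. (cmod (G x))\<^sup>2)"
      by (rule Bochner_Integration.integrable_bound[of _ "\<lambda>x. (cmod (g x))\<^sup>2"]) (use g in \<open>auto simp: L2_def G_def\<close>)
    then show ?thesis by (simp add: L2_def)
  qed
  moreover have "bargmann g \<xi> = bargmann G \<xi>" for \<xi>
    unfolding bargmann_eq
  proof (rule integral_cong_AE)
    show "AE x in lborel. g x * bargmann_kernel \<xi> x = G x * bargmann_kernel \<xi> x"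
      using aeG by eventually_elim simp
  qed measurable
  then have "f = bargmann G" unfolding fg[symmetric] by blast
  ultimately show thesis using that[of G] by (simp add: G_def)
qed

text \<open>Functions on the half-space x . v \<le> 0 are encoded by their extension by zero. The
  unit vector is real, as the condition Re \<xi> = t v presupposes.\<close>

theorem theorem3:
  fixes v :: "real^'n"
  assumes "norm v = 1"
  shows "(\<forall>\<eta>. (\<lambda>\<xi>. half_kernel v \<xi> \<eta>) \<in> H_space v)
    \<and> (\<forall>f \<in> H_space v. \<forall>\<eta>. f \<eta> = fock_inner f (\<lambda>\<xi>. half_kernel v \<xi> \<eta>))
    \<and> H_space v = bargmann ` {f. L2 f \<and> (\<forall>x. x \<bullet> v > 0 \<longrightarrow> f x = 0)}
    \<and> (\<forall>f. L2 f \<and> (\<forall>x. x \<bullet> v > 0 \<longrightarrow> f x = 0) \<longrightarrow>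
          fock_norm2 (bargmann f) = (\<integral> x. (cmod (f x))\<^sup>2 \<partial>lborel))"
proof (intro conjI allI ballI impI)
  have hk: "(\<lambda>\<xi>. half_kernel v \<xi> \<eta>) = bargmann (half_fun v \<eta>)" for \<eta>
    using half_kernel_eq_bargmann[OF assms] by blast
  show "(\<lambda>\<xi>. half_kernel v \<xi> \<eta>) \<in> H_space v" for \<eta>
    unfolding hk by (rule bargmann_in_H_space[OF L2_half_fun]) (simp add: half_fun_def)
  show "f \<eta> = fock_inner f (\<lambda>\<xi>. half_kernel v \<xi> \<eta>)" if f: "f \<in> H_space v" for f \<eta>
  proof -
    obtain g where g: "L2 g" "\<And>x. x \<bullet> v > 0 \<Longrightarrow> g x = 0" "f = bargmann g"
      by (rule H_space_imp_bargmann[OF f assms]) blast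
    \<comment> \<open>The cut-off in \<open>half_fun\<close> only discards points where
      \<open>g\<close> is 0, so pairing with it equals pairing with the full kernel, which is
      f(\<eta>).\<close>
    have "g x * cnj (half_fun v \<eta> x) = g x * bargmann_kernel \<eta> x" for x
      using g(2)[of x] by (cases "x \<bullet> v > 0") (auto simp: half_fun_def)
    then show ?thesis
      unfolding hk g(3) fock_inner_bargmann[OF g(1) L2_half_fun] by (simp only: bargmann_eq)
  qed
  show "H_space v = bargmann ` {f. L2 f \<and> (\<forall>x. x \<bullet> v > 0 \<longrightarrow> f x = 0)}"
  proof
    show "H_space v \<subseteq> bargmann ` {f. L2 f \<and> (\<forall>x. x \<bullet> v > 0 \<longrightarrow> f x = 0)}"
    proof
      fix f assume "f \<in> H_space v"
      from H_space_imp_bargmann[OF this assms] show "f \<in> bargmann ` {f. L2 f \<and> (\<forall>x. x \<bullet> v > 0 \<longrightarrow> f x = 0)}"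
        by blast
    qed
    show "bargmann ` {f. L2 f \<and> (\<forall>x. x \<bullet> v > 0 \<longrightarrow> f x = 0)} \<subseteq> H_space v"
      using bargmann_in_H_space by blast
  qed
  show "fock_norm2 (bargmann f) = (\<integral>x. (cmod (f x))\<^sup>2 \<partial>lborel)" if "L2 f \<and> (\<forall>x. x \<bullet> v > 0 \<longrightarrow> f x = 0)" for f
    using that by (simp add: bargmann_isometry(2))
qed

end
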